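(* Define $$\alpha_0^{(3)}=\frac{1}{2^{1/2}3^{1/4}}\prod_{p\equiv 2 \bmod 3}\Bigl(1-\frac{1}{p^2}\Bigr)^{-1/2}$$ and $$\beta_0=\frac{3^{1/4}\sqrt{\pi}}{2^{5/4}}\cdot\frac{(\log(2+\sqrt{3}))^{1/4}}{\Gamma(1/4)}\prod_{p\equiv 5,7,11 \bmod 12}\Bigl(1-\frac{1}{p^2}\Bigr)^{-1/2},$$ the products being over prime numbers $p$ in the indicated residue classes. Then the decimal expansions of these constants begin with the following 100 decimals: $$\begin{aligned}\alpha_0^{(3)}=0.&63890\,94054\,45343\,88225\,49426\,74928\,24509\,37549\,75508\,02912\\&33454\,21692\,36570\,80763\,10027\,64965\,82468\,97179\,11252\,86643\cdots\end{aligned}$$ and $$\begin{aligned}\beta_0=0.&30231\,61423\,57065\,63794\,77699\,00480\,19971\,56024\,12795\,18936\\&96454\,58867\,84128\,88654\,48752\,41051\,08994\,87467\,81397\,92727\cdots\end{aligned}$$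
   Context: $\Gamma$ is Euler's Gamma function and $\log$ the natural logarithm. Writing $x=0.d_1d_2\ldots d_{100}\cdots$ means that the displayed digits are the first 100 decimals of $x$, i.e. $0.d_1\ldots d_{100}\le x< 0.d_1\ldots d_{100}+10^{-100}$. *)

theory Defs
  imports
    "HOL-Analysis.Analysis"
    "HOL-Computational_Algebra.Primes"
begin

(* The product is taken over the primes p with p mod m in R, in increasing order; all other
   indices contribute the factor 1.  For the moduli and residues used below it converges
   absolutely (lemma abs_convergent_prime_factor), so the order is immaterial. *)
definition prime_factor :: "nat \<Rightarrow> nat set \<Rightarrow> nat \<Rightarrow> real" where
  "prime_factor m R p =
     (if prime p \<and> p mod m \<in> R then (1 - 1 / (real p)\<^sup>2) powr (- (1/2)) else 1)"

definition prime_product :: "nat \<Rightarrow> nat set \<Rightarrow> real" where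
  "prime_product m R = prodinf (prime_factor m R)"

definition alpha0_3 :: real where
  "alpha0_3 = 1 / (2 powr (1/2) * 3 powr (1/4)) * prime_product 3 {2}"

definition beta0 :: real where
  "beta0 = (3 powr (1/4) * sqrt pi) / 2 powr (5/4)
             * ((ln (2 + sqrt 3)) powr (1/4) / Gamma (1/4))
             * prime_product 12 {5, 7, 11}"

(* d is the number 0.d_1...d_n given by the first n displayed decimals of x *)
definition decimals_begin :: "real \<Rightarrow> nat \<Rightarrow> real \<Rightarrow> bool" where
  "decimals_begin x n d \<longleftrightarrow> d \<le> x \<and> x < d + 1 / 10 ^ n"

lemma prime_factor_bound:
  "norm (prime_factor m R p - 1) \<le> 1 / (real p)\<^sup>2"
proof (cases "prime p \<and> p mod m \<in> R")
  case True
  define u where "u = 1 / (real p)\<^sup>2"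
  have "real p \<ge> 2" using True prime_ge_2_nat by auto
  hence "(real p)\<^sup>2 \<ge> 4" using power_mono[of 2 "real p" 2] by simp
  hence u: "0 < u" "u \<le> 1/4"
    using \<open>real p \<ge> 2\<close> by (auto simp: u_def divide_simps)
  have "u * (1 - u - u\<^sup>2) \<ge> 0"
    using u power_mono[of u "1/4" 2] by (intro mult_nonneg_nonneg) (auto simp: power2_eq_square)
  hence 1: "1 \<le> (1 + u)\<^sup>2 * (1 - u)" by (simp add: power2_eq_square algebra_simps)
  have s: "(1 - u) powr (- (1/2)) = 1 / sqrt (1 - u)"
    using u by (simp add: powr_minus powr_half_sqrt inverse_eq_divide)
  have "1 \<le> (1 + u) * sqrt (1 - u)"
    using real_sqrt_le_mono[OF 1] u by (simp add: real_sqrt_mult)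
  hence "1 / sqrt (1 - u) \<le> 1 + u" using u by (simp add: field_simps)
  moreover have "1 / sqrt (1 - u) \<ge> 1" using u by (simp add: field_simps)
  ultimately have "norm ((1 - u) powr (- (1/2)) - 1) \<le> u" using s by simp
  thus ?thesis using True by (simp add: prime_factor_def u_def)
qed (auto simp: prime_factor_def)

lemma abs_convergent_prime_factor: "abs_convergent_prod (prime_factor m R)"
proof -
  have "summable (\<lambda>p. 1 / (real p)\<^sup>2)"
    using inverse_power_summable[of 2, where 'a = real] by (simp add: inverse_eq_divide)
  hence "summable (\<lambda>p. norm (prime_factor m R p - 1))"
    by (rule summable_comparison_test') (use prime_factor_bound in auto)
  thus ?thesis by (rule summable_imp_abs_convergent_prod)
qed

end

theory Submission
  imports Defs "HOL-Computational_Algebra.Polynomial"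
begin

text \<open>
  Let \<open>X(s)\<close> and \<open>Y(s)\<close> be the Euler products of \<open>1 / (1 - 1/p^s)\<close> over the primes
  \<open>p = 5 mod 6\<close> and \<open>p = 7 mod 12\<close>.  If \<open>U\<close>, \<open>V\<close>, \<open>A\<close>, \<open>B\<close> are the \<open>L\<close>-series of the four real
  characters mod 12, with conductors 1, 3, 4, 12, then comparing Euler factors gives
  \<open>X(s)^2 V(s) = X(2s) U(s)\<close> and \<open>Y(s)^4 A(s) B(s) = Y(2s)^2 U(s) V(s)\<close>.  As \<open>X(256)\<close> and \<open>Y(256)\<close> are
  negligibly close to 1, the values \<open>X(2)\<close> and \<open>Y(2)\<close> follow from the \<open>L\<close>-values at
  \<open>s = 2, 4, ..., 128\<close>, and \<open>U(2)\<close> also provides \<open>pi^2\<close>.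

  All these \<open>L\<close>-values are combinations of alternating sums \<open>\<Sum>j. (-1)^j / (q j + r)^s\<close>, which are
  accelerated with Chebyshev polynomials (Cohen, Rodriguez Villegas and Zagier): \<open>1 / (q j + r)^s\<close> is the
  \<open>j\<close>-th moment of a positive functional on the polynomials on \<open>[0, 1]\<close>, and
  \<open>(T(3) - T(1 - 2 x)) / (1 + x)\<close> approximates \<open>T(3) / (1 + x)\<close> with error at most 1 there, where \<open>T\<close> is
  the Chebyshev polynomial of degree 140 and \<open>T(3) > 10^106\<close>.  The value \<open>Gamma(1/4)\<close> comes from the
  incomplete Gamma function at 256, and the logarithm from the series of \<open>artanh (1 / sqrt 3)\<close>.
\<close>

section \<open>Acceleration of alternating moment sums\<close>

text \<open>Every table entry is a guess that is only verified: quotients and square roots become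
  products of integers, and the fourth roots in both constants become two successive squarings. The
  relations are multiplicative, so errors are carried as differences of logarithms, where they add.
  Passing from \<open>2 * s\<close> to \<open>s\<close> halves the inherited error, and so one
  tolerance, \<open>30 * ulp\<close>, survives all seven doublings of the exponent. The exponent
  doubles because 1 + x = (1 - x^2) / (1 - x) at the primes where a character is -1. Stopping at s =
  128 would be too early: the prime 5 still contributes 5^(-128), about 10^(-90), whereas 5^(-256)
  is below 10^(-178). The point 256 for the Gamma function is a fourth power, so that the prefactor
  is exactly 4; \<open>exp 256\<close> is reached by eight squarings from \<open>exp 1\<close>; and
  the neglected part of the integral is governed by exp(-256), which is below 10^(-111).\<close>

text \<open>With \<open>x = y ^ q\<close>, the new polynomial times \<open>y ^ r\<close> is the
  integral from 0 to \<open>y\<close> of \<open>t ^ (r - 1)\<close> times the old polynomial at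
  \<open>t ^ q\<close>; \<open>g\<close> is that antiderivative. At \<open>x = 0\<close> the factor
  \<open>y ^ r\<close> cannot be cancelled, so this point is treated apart.\<close>

lemma moment_step_nonneg:
  fixes a :: "nat \<Rightarrow> real"
  assumes nonneg: "\<And>x. 0 \<le> x \<Longrightarrow> x \<le> 1 \<Longrightarrow> 0 \<le> (\<Sum>j\<le>K. a j * x ^ j)"
    and q: "q > 0" and r: "r > 0" and x: "0 \<le> x" "x \<le> 1"
  shows "0 \<le> (\<Sum>j\<le>K. a j / real (q * j + r) * x ^ j)"
proof (cases "x = 0")
  case True
  have "0 \<le> a 0" using nonneg[of 0] by (simp add: power_0_left sum.delta if_distrib cong: if_cong)
  thus ?thesis using True r by (simp add: power_0_left sum.delta if_distrib cong: if_cong)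
next
  case False
  define y where "y = root q x"
  have y: "0 < y" "y \<le> 1" "y ^ q = x"
    using False x q by (auto simp: y_def)
  define g where "g = (\<lambda>t. \<Sum>j\<le>K. a j / real (q * j + r) * t ^ (q * j + r))"
  have deriv: "(g has_real_derivative t ^ (r - 1) * (\<Sum>j\<le>K. a j * (t ^ q) ^ j)) (at t)" for t
    unfolding g_def sum_distrib_left
  proof (rule DERIV_sum)
    fix j
    have "((\<lambda>t. a j / real (q * j + r) * t ^ (q * j + r)) has_real_derivative
            a j / real (q * j + r) * (real (q * j + r) * t ^ (q * j + r - 1))) (at t)"
      by (intro DERIV_cmult) (auto intro!: derivative_eq_intros)
    also have "a j / real (q * j + r) * (real (q * j + r) * t ^ (q * j + r - 1)) = t ^ (r - 1) * (a j * (t ^ q) ^ j)"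
    proof -
      have "q * j + r - 1 = r - 1 + q * j" using r by simp
      moreover have "real (q * j + r) \<noteq> 0" using r by (simp only: of_nat_eq_0_iff)
      ultimately show ?thesis by (simp only: power_add power_mult) auto
    qed
    finally show "((\<lambda>t. a j / real (q * j + r) * t ^ (q * j + r)) has_real_derivative t ^ (r - 1) * (a j * (t ^ q) ^ j)) (at t)" .
  qed
  have "g 0 \<le> g y"
  proof (rule DERIV_nonneg_imp_nondecreasing[of 0 y g])
    fix t assume "0 \<le> t" "t \<le> y"
    hence "0 \<le> t ^ q" "t ^ q \<le> 1" using y by (auto intro: power_le_one)
    hence "0 \<le> t ^ (r - 1) * (\<Sum>j\<le>K. a j * (t ^ q) ^ j)"
      using nonneg[of "t ^ q"] \<open>0 \<le> t\<close> by (intro mult_nonneg_nonneg) simp_all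
    thus "\<exists>d. (g has_real_derivative d) (at t) \<and> 0 \<le> d" using deriv[of t] by blast
  qed (use y in auto)
  moreover have "g 0 = 0" using r by (simp add: g_def power_0_left)
  moreover have "g y = y ^ r * (\<Sum>j\<le>K. a j / real (q * j + r) * x ^ j)"
    unfolding g_def sum_distrib_left power_add power_mult y(3) by (simp add: mult_ac)
  ultimately have "0 \<le> y ^ r * (\<Sum>j\<le>K. a j / real (q * j + r) * x ^ j)" by simp
  thus ?thesis using zero_less_power[OF y(1), of r] by (simp only: zero_le_mult_iff) auto
qed

text \<open>One division of the coefficients by \<open>q * j + r\<close> preserves nonnegativity on
  the whole interval, so it can be repeated \<open>s\<close> times; the claim is the value at 1.
  This is the positivity of the functional with moments
  \<open>1 / real (q * j + r) ^ s\<close>.\<close>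

lemma moment_nonneg:
  fixes a :: "nat \<Rightarrow> real"
  assumes "\<And>x. 0 \<le> x \<Longrightarrow> x \<le> 1 \<Longrightarrow> 0 \<le> (\<Sum>j\<le>K. a j * x ^ j)" "q > 0" "r > 0"
  shows "0 \<le> (\<Sum>j\<le>K. a j / real (q * j + r) ^ s)"
proof -
  have "0 \<le> (\<Sum>j\<le>K. a j / real (q * j + r) ^ s * x ^ j)" if "0 \<le> x" "x \<le> 1" for x
    using that
  proof (induction s arbitrary: x)
    case 0
    thus ?case using assms(1) by simp
  next
    case (Suc s)
    have "0 \<le> (\<Sum>j\<le>K. a j / real (q * j + r) ^ s / real (q * j + r) * x ^ j)"
      by (rule moment_step_nonneg) (use Suc assms in auto)
    thus ?case by (simp add: field_simps)
  qed
  from this[of 1] show ?thesis by simp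
qed

lemma moment_abs_le:
  fixes a b :: "nat \<Rightarrow> real"
  assumes le: "\<And>x. 0 \<le> x \<Longrightarrow> x \<le> 1 \<Longrightarrow> \<bar>\<Sum>j\<le>K. a j * x ^ j\<bar> \<le> (\<Sum>j\<le>K. b j * x ^ j)"
    and "q > 0" "r > 0"
  shows "\<bar>\<Sum>j\<le>K. a j / real (q * j + r) ^ s\<bar> \<le> (\<Sum>j\<le>K. b j / real (q * j + r) ^ s)"
proof -
  have "0 \<le> (\<Sum>j\<le>K. (b j - a j) / real (q * j + r) ^ s)"
    by (rule moment_nonneg) (use assms le in \<open>force simp: algebra_simps sum_subtractf abs_le_iff\<close>)+
  moreover have "0 \<le> (\<Sum>j\<le>K. (b j + a j) / real (q * j + r) ^ s)"
    by (rule moment_nonneg) (use assms le in \<open>force simp: algebra_simps sum.distrib abs_le_iff\<close>)+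
  ultimately show ?thesis
    by (simp add: diff_divide_distrib add_divide_distrib sum_subtractf sum.distrib abs_le_iff)
qed

text \<open>The absolute values of the coefficients of T(1 - 2 x) for the Chebyshev polynomial T of
  degree \<open>n\<close>, which is the hypergeometric polynomial 2F1(-n, n; 1/2; x). The recurrence
  is free of division so that integer arithmetic can confirm it.\<close>

definition cheb_coeffs :: "nat \<Rightarrow> (nat \<Rightarrow> real) \<Rightarrow> bool" where
  "cheb_coeffs n t \<longleftrightarrow> t 0 = 1 \<and>
     (\<forall>j<n. t (Suc j) * ((2 * real j + 1) * (real j + 1)) = t j * (2 * ((real n)\<^sup>2 - (real j)\<^sup>2)))"

text \<open>With x = (1 - cos u) / 2 the polynomial is cos(n u), and the energy \<open>E\<close> is
  n^2 (sin^2 + cos^2). Its constancy follows from the differential equation alone, and dropping the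
  first summand bounds the polynomial.\<close>

lemma cheb_bound:
  assumes t: "cheb_coeffs n t" and n: "n > 0" and x: "0 \<le> x" "x \<le> 1"
  shows "\<bar>\<Sum>j\<le>n. t j * (- x) ^ j\<bar> \<le> 1"
proof -
  define a where "a j = (if j \<le> n then (-1) ^ j * t j else 0)" for j
  define P where "P = (\<Sum>j\<le>n. monom (a j) j)"
  have coeff_P: "coeff P j = a j" for j
    by (simp add: P_def coeff_sum a_def)
  have rec: "(2 * real j + 1) * (real j + 1) * a (Suc j) = - 2 * ((real n)\<^sup>2 - (real j)\<^sup>2) * a j" for j
  proof (cases "j < n")
    case True
    hence "t (Suc j) * ((2 * real j + 1) * (real j + 1)) = t j * (2 * ((real n)\<^sup>2 - (real j)\<^sup>2))"
      using t by (simp add: cheb_coeffs_def)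
    hence "(-1) ^ j * (t (Suc j) * ((2 * real j + 1) * (real j + 1))) =
           (-1) ^ j * (t j * (2 * ((real n)\<^sup>2 - (real j)\<^sup>2)))" by (rule arg_cong)
    moreover have "a (Suc j) = - ((-1) ^ j * t (Suc j))" "a j = (-1) ^ j * t j"
      using True by (simp_all add: a_def)
    ultimately show ?thesis by (simp only: mult_ac mult_minus_left mult_minus_right)
  qed (cases "j = n"; simp add: a_def)
  \<comment> \<open>The hypergeometric differential equation; comparing the coefficients of x^k
    gives back the recurrence \<open>rec\<close>.\<close>
  have ode: "[:0, 2, -2:] * pderiv (pderiv P) + [:1, -2:] * pderiv P + smult (2 * (real n)\<^sup>2) P = 0" (is "?Q = 0")
  proof (rule poly_eqI)
    fix k
    have "coeff ?Q k = (2 * real k + 1) * (real k + 1) * a (Suc k) + 2 * ((real n)\<^sup>2 - (real k)\<^sup>2) * a k"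
      by (cases k; cases "k - 1")
         (auto simp: coeff_pderiv coeff_P coeff_pCons algebra_simps power2_eq_square split: nat.splits)
    thus "coeff ?Q k = coeff 0 k" using rec[of k] by (simp only: coeff_0)
  qed
  define E where "E x = x * (1 - x) * (poly (pderiv P) x)\<^sup>2 + (real n)\<^sup>2 * (poly P x)\<^sup>2" for x
  have "(E has_real_derivative 0) (at x)" for x
  proof -
    have "(E has_real_derivative poly (pderiv P) x * poly ?Q x) (at x)"
      unfolding E_def
      by (rule derivative_eq_intros poly_DERIV refl | simp add: algebra_simps power2_eq_square)+
    thus ?thesis by (simp only: ode poly_0 mult_zero_right)
  qed
  hence "E x = E 0" using DERIV_isconst_all[of E] by blast
  moreover have "poly P 0 = 1"
    using coeff_P[of 0] t by (simp add: poly_0_coeff_0 a_def cheb_coeffs_def)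
  ultimately have "x * (1 - x) * (poly (pderiv P) x)\<^sup>2 + (real n)\<^sup>2 * (poly P x)\<^sup>2 = (real n)\<^sup>2"
    by (simp add: E_def)
  moreover have "0 \<le> x * (1 - x) * (poly (pderiv P) x)\<^sup>2" using x by simp
  ultimately have "(real n)\<^sup>2 * (poly P x)\<^sup>2 \<le> (real n)\<^sup>2 * 1" by linarith
  hence "(poly P x)\<^sup>2 \<le> 1" using n by (simp only: mult_le_cancel_left_pos zero_less_power of_nat_0_less_iff)
  hence "\<bar>poly P x\<bar> \<le> 1" by (simp add: abs_square_le_1)
  moreover have "poly P x = (\<Sum>j\<le>n. t j * (- x) ^ j)"
    by (simp add: P_def poly_sum poly_monom a_def power_minus[of x] mult_ac)
  ultimately show ?thesis by simp
qed

text \<open>Here \<open>D\<close> is T(3), and the tail sums \<open>c j\<close> are, up to sign, the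
  coefficients of (T(3) - T(1 - 2 x)) / (1 + x). The difference to be bounded is the functional
  applied to (T(1 - 2 x) - D (-x)^N) / (1 + x), which \<open>1 + D * x ^ N\<close> dominates on
  [0, 1]; the right-hand side is the functional applied to that bound. Partial sums appear first
  because the functional acts on polynomials.\<close>

lemma accel_partial_sum:
  fixes t :: "nat \<Rightarrow> real"
  assumes t: "cheb_coeffs n t" and n: "n > 0" and q: "q > 0" and r: "r > 0"
    and D: "D = (\<Sum>i\<le>n. t i)" and D0: "D \<ge> 0"
    and c: "\<And>j. c j = D - (\<Sum>i\<le>j. t i)"
  shows "\<bar>D * (\<Sum>j<N. (-1) ^ j / real (q * j + r) ^ s) - (\<Sum>j<n. (-1) ^ j * c j / real (q * j + r) ^ s)\<bar>
           \<le> 1 / real r ^ s + D / real (q * N + r) ^ s"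
proof -
  define K where "K = N + n"
  define a where "a j = (if j < N then D * (-1) ^ j else 0) - (if j < n then (-1) ^ j * c j else 0)" for j
  define b where "b j = (if j = 0 then 1 else 0) + (if j = N then D else 0)" for j
  have restr: "(\<Sum>j\<le>K. (if j < M then f j else 0) * g j) = (\<Sum>j<M. f j * g j)" if "M \<le> K" for M and f g :: "nat \<Rightarrow> real"
    using that by (intro sum.mono_neutral_cong_right) auto
  have b_sum: "(\<Sum>j\<le>K. b j * g j) = g 0 + D * g N" for g :: "nat \<Rightarrow> real"
    by (simp add: b_def K_def distrib_right sum.distrib if_distrib[of "\<lambda>x. x * _"] sum.delta cong: if_cong)
  have a_sum: "(\<Sum>j\<le>K. a j * g j) = (\<Sum>j<N. D * (-1) ^ j * g j) - (\<Sum>j<n. (-1) ^ j * c j * g j)" for g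
    using restr[of N "\<lambda>j. D * (-1) ^ j" g] restr[of n "\<lambda>j. (-1) ^ j * c j" g]
    by (simp add: a_def K_def left_diff_distrib sum_subtractf)
  have "\<bar>\<Sum>j\<le>K. a j * x ^ j\<bar> \<le> (\<Sum>j\<le>K. b j * x ^ j)" if x: "0 \<le> x" "x \<le> 1" for x
  proof -
    have c0: "(1 + x) * (\<Sum>j<m. (-1) ^ j * c j * x ^ j) = D - (\<Sum>j<m. t j * (- x) ^ j) - c (m - 1) * (- x) ^ m"
      if "m > 0" for m
      using that
    proof (induction m rule: nat_induct_non_zero)
      case 1
      show ?case by (simp add: c algebra_simps)
    next
      case (Suc m)
      have "c (m - 1) = c m + t m" using Suc by (cases m) (simp_all add: c)
      thus ?case using Suc.IH by (simp add: algebra_simps power_minus[of x])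
    qed
    \<comment> \<open>The last tail is the single coefficient \<open>t n\<close>, so the leftover
      term of \<open>c0\<close> completes the sum to the full Chebyshev polynomial.\<close>
    have cn: "c (n - 1) = t n"
      using n by (cases n) (simp_all add: c D del: One_nat_def)
    have "(1 + x) * (\<Sum>j<n. (-1) ^ j * c j * x ^ j) = D - (\<Sum>j\<le>n. t j * (- x) ^ j)"
      using c0[OF n] by (simp add: cn[simplified] lessThan_Suc_atMost[symmetric])
    moreover have "(1 + x) * (\<Sum>j<N. D * (-1) ^ j * x ^ j) = D - D * (- x) ^ N"
      by (induction N) (simp_all add: algebra_simps power_minus[of x])
    ultimately have eq: "(1 + x) * (\<Sum>j\<le>K. a j * x ^ j) = (\<Sum>j\<le>n. t j * (- x) ^ j) - D * (- x) ^ N"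
      by (simp add: a_sum right_diff_distrib)
    have "\<bar>\<Sum>j\<le>K. a j * x ^ j\<bar> \<le> \<bar>(1 + x) * (\<Sum>j\<le>K. a j * x ^ j)\<bar>"
      using x mult_right_mono[of 1 "1 + x" "\<bar>\<Sum>j\<le>K. a j * x ^ j\<bar>"] by (simp add: abs_mult)
    also have "\<dots> \<le> 1 + D * x ^ N"
      using cheb_bound[OF t n x] D0 x unfolding eq
      by (intro order_trans[OF abs_triangle_ineq4] add_mono) (auto simp: abs_mult power_abs)
    finally show ?thesis by (simp add: b_sum)
  qed
  from moment_abs_le[where K = K and a = a and b = b, OF this q r, of s]
  have "\<bar>\<Sum>j\<le>K. a j * (1 / real (q * j + r) ^ s)\<bar> \<le> (\<Sum>j\<le>K. b j * (1 / real (q * j + r) ^ s))"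
    by simp
  thus ?thesis by (simp only: a_sum b_sum) (simp add: sum_distrib_left)
qed

lemma accel_sums:
  fixes t :: "nat \<Rightarrow> real"
  assumes t: "cheb_coeffs n t" and n: "n > 0" and q: "q > 0" and r: "r > 0" and s: "s > 0"
    and D: "D = (\<Sum>i\<le>n. t i)" and D0: "D \<ge> 0"
    and c: "\<And>j. c j = D - (\<Sum>i\<le>j. t i)"
    and F: "(\<lambda>j. (-1) ^ j / real (q * j + r) ^ s) sums F"
  shows "\<bar>D * F - (\<Sum>j<n. (-1) ^ j * c j / real (q * j + r) ^ s)\<bar> \<le> 1"
proof -
  have "filterlim (\<lambda>N. q * N + r) at_top at_top"
    using q by (intro filterlim_at_top_mono[OF filterlim_ident] always_eventually allI)
               (metis One_nat_def Suc_leI add.commute le_add2 mult.commute mult_le_mono2 mult_1_right order_trans)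
  hence "filterlim (\<lambda>N. real (q * N + r)) at_top at_top"
    by (rule filterlim_compose[OF filterlim_real_sequentially])
  hence "filterlim (\<lambda>N. real (q * N + r) ^ s) at_top at_top"
    using s by (intro filterlim_pow_at_top)
  hence "(\<lambda>N. D / real (q * N + r) ^ s) \<longlonglongrightarrow> 0"
    by (intro tendsto_divide_0[OF tendsto_const] filterlim_at_top_imp_at_infinity)
  hence "(\<lambda>N. 1 / real r ^ s + D / real (q * N + r) ^ s) \<longlonglongrightarrow> 1 / real r ^ s + 0"
    by (intro tendsto_intros)
  moreover have lim: "(\<lambda>N. \<bar>D * (\<Sum>j<N. (-1) ^ j / real (q * j + r) ^ s) - (\<Sum>j<n. (-1) ^ j * c j / real (q * j + r) ^ s)\<bar>)
      \<longlonglongrightarrow> \<bar>D * F - (\<Sum>j<n. (-1) ^ j * c j / real (q * j + r) ^ s)\<bar>"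
    using F unfolding sums_def by (intro tendsto_intros)
  ultimately have "\<bar>D * F - (\<Sum>j<n. (-1) ^ j * c j / real (q * j + r) ^ s)\<bar> \<le> 1 / real r ^ s + 0"
    by (intro LIMSEQ_le[OF lim]) (use accel_partial_sum[OF t n q r D D0 c] in auto)
  also have "\<dots> \<le> 1" using r by (simp add: divide_le_eq_1)
  finally show ?thesis .
qed

section \<open>Euler products\<close>

definition completely_mult :: "(nat \<Rightarrow> real) \<Rightarrow> bool" where
  "completely_mult f \<longleftrightarrow> f 0 = 0 \<and> f 1 = 1 \<and> (\<forall>m n. f (m * n) = f m * f n)"

definition drop_multiples :: "nat \<Rightarrow> (nat \<Rightarrow> real) \<Rightarrow> nat \<Rightarrow> real" where
  "drop_multiples p f n = (if p dvd n then 0 else f n)"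

lemma completely_mult_drop_multiples:
  assumes "completely_mult f" "prime p"
  shows "completely_mult (drop_multiples p f)"
  using assms by (auto simp: completely_mult_def drop_multiples_def prime_dvd_mult_iff)

text \<open>Complete multiplicativity makes the terms at the multiples of \<open>p\<close> add up to
  \<open>f p * S\<close>.\<close>

lemma drop_multiples_sums:
  assumes "completely_mult f" "f sums S" "p > 0"
  shows "drop_multiples p f sums ((1 - f p) * S)"
proof -
  define h where "h n = (if p dvd n then f n else 0)" for n
  have "(\<lambda>k. h (p * k)) sums (f p * S)"
    using assms(1) sums_mult[OF assms(2), of "f p"] by (simp add: h_def completely_mult_def)
  hence "h sums (f p * S)"
    using assms(3) by (subst (asm) sums_mono_reindex) (auto simp: strict_mono_def h_def elim!: dvdE)
  hence "(\<lambda>n. f n - h n) sums (S - f p * S)" by (intro sums_diff assms(2))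
  moreover have "f n - h n = drop_multiples p f n" for n by (simp add: h_def drop_multiples_def)
  ultimately show ?thesis by (simp add: algebra_simps)
qed

text \<open>The alternating series is twice the sum over odd indices minus the whole sum.\<close>

lemma alternating_sums:
  assumes "completely_mult f" "f sums S"
  shows "(\<lambda>n. (-1) ^ (n + 1) * f n) sums ((1 - 2 * f 2) * S)"
proof -
  have "(\<lambda>n. 2 * drop_multiples 2 f n - f n) sums (2 * ((1 - f 2) * S) - S)"
    by (intro sums_diff sums_mult drop_multiples_sums assms) auto
  moreover have "2 * drop_multiples 2 f n - f n = (-1) ^ (n + 1) * f n" for n
    by (cases "even n") (auto simp: drop_multiples_def)
  ultimately show ?thesis by (simp add: algebra_simps)
qed

primrec sift :: "(nat \<Rightarrow> real) \<Rightarrow> nat \<Rightarrow> nat \<Rightarrow> real" where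
  "sift f 0 = f"
| "sift f (Suc N) = (if prime (Suc N) then drop_multiples (Suc N) (sift f N) else sift f N)"

lemma sift_eq: "sift f N n = (if \<exists>q\<le>N. prime q \<and> q dvd n then 0 else f n)"
proof (induction N)
  case 0
  show ?case by auto
next
  case (Suc N)
  thus ?case by (auto simp: drop_multiples_def le_Suc_eq)
qed

lemma sift_sums:
  assumes "completely_mult f" "f sums S"
  shows "completely_mult (sift f N) \<and> sift f N sums ((\<Prod>p\<le>N. if prime p then 1 - f p else 1) * S)"
proof (induction N)
  case 0
  thus ?case using assms by simp
next
  case (Suc N)
  show ?case
  proof (cases "prime (Suc N)")
    case True
    \<comment> \<open>A prime is divisible by no smaller prime, so earlier sifting has left its
      value intact and the new factor is the original \<open>1 - f (Suc N)\<close>.\<close>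
    have "sift f N (Suc N) = f (Suc N)"
      using True primes_dvd_imp_eq[of _ "Suc N"] by (metis sift_eq Suc_n_not_le_n)
    thus ?thesis
      using True Suc completely_mult_drop_multiples[of "sift f N" "Suc N"] drop_multiples_sums[of "sift f N" _ "Suc N"]
      by (simp add: mult_ac) (metis mult.left_commute mult.commute)
  qed (use Suc in simp)
qed

text \<open>After sifting by all primes up to \<open>N\<close>, only the index 1 and indices beyond
  \<open>N\<close> can survive, so the distance from 1 is at most a tail of the absolutely
  convergent series. Keeping \<open>S\<close> as a factor avoids every quotient by an
  L-value.\<close>

lemma euler_product_tendsto:
  assumes f: "completely_mult f" and abs: "summable (\<lambda>n. \<bar>f n\<bar>)" and S: "f sums S"
  shows "(\<lambda>N. (\<Prod>p\<le>N. if prime p then 1 - f p else 1) * S) \<longlonglongrightarrow> 1"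
proof -
  let ?P = "\<lambda>N. (\<Prod>p\<le>N. if prime p then 1 - f p else 1) * S"
  have le: "\<bar>?P N - 1\<bar> \<le> (\<Sum>n. \<bar>f n\<bar>) - (\<Sum>n<Suc N. \<bar>f n\<bar>)" if "N > 0" for N
  proof -
    have sm: "sift f N sums ?P N" using sift_sums[OF f S] by blast
    have "sift f N n = (if n = 1 then 1 else 0)" if "n < Suc N" for n
    proof (cases "n = 0 \<or> n = 1")
      case True
      thus ?thesis using f by (auto simp: sift_eq completely_mult_def)
    next
      case False
      then obtain q where "prime q" "q dvd n" using prime_factor_nat by blast
      moreover from this have "q \<le> N" using dvd_imp_le[of q n] False \<open>n < Suc N\<close> by simp
      ultimately show ?thesis using False by (auto simp: sift_eq)
    qed
    hence "(\<Sum>n<Suc N. sift f N n) = (\<Sum>n<Suc N. if n = 1 then 1 else 0)" by (intro sum.cong) auto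
    also have "\<dots> = 1" using that by (simp add: sum.delta)
    finally have "(\<lambda>n. sift f N (n + Suc N)) sums (?P N - 1)"
      using sm sums_iff_shift[of "sift f N" "Suc N" "?P N - 1"] by simp
    moreover have "(\<lambda>n. \<bar>f (n + Suc N)\<bar>) sums ((\<Sum>n. \<bar>f n\<bar>) - (\<Sum>n<Suc N. \<bar>f n\<bar>))"
      using summable_sums[OF abs] sums_iff_shift[of "\<lambda>n. \<bar>f n\<bar>" "Suc N"] by simp
    moreover have "\<bar>sift f N n\<bar> \<le> \<bar>f n\<bar>" for n by (simp add: sift_eq)
    ultimately have "?P N - 1 \<le> (\<Sum>n. \<bar>f n\<bar>) - (\<Sum>n<Suc N. \<bar>f n\<bar>)" 
       "- (?P N - 1) \<le> (\<Sum>n. \<bar>f n\<bar>) - (\<Sum>n<Suc N. \<bar>f n\<bar>)"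
      by (meson sums_le abs_le_D1, meson sums_le[OF _ sums_minus] abs_le_D2)
    thus ?thesis by (simp only: abs_le_iff)
  qed
  have "(\<lambda>N. (\<Sum>n. \<bar>f n\<bar>) - (\<Sum>n<Suc N. \<bar>f n\<bar>)) \<longlonglongrightarrow> (\<Sum>n. \<bar>f n\<bar>) - (\<Sum>n. \<bar>f n\<bar>)"
    by (intro tendsto_intros LIMSEQ_Suc[OF summable_LIMSEQ[OF abs]])
  hence "(\<lambda>N. ?P N - 1) \<longlonglongrightarrow> 0"
    by (intro Lim_null_comparison[of "\<lambda>N. ?P N - 1"] eventually_sequentiallyI[of 1]) (use le in auto)
  from tendsto_add[OF this tendsto_const[of 1]] show ?thesis by simp
qed

lemma sums_residue_classes:
  fixes g :: "nat \<Rightarrow> real"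
  assumes "r1 < q" "r2 < q" "r1 \<noteq> r2"
    and zero: "\<And>n. n mod q \<noteq> r1 \<Longrightarrow> n mod q \<noteq> r2 \<Longrightarrow> g n = 0"
    and "(\<lambda>j. g (q * j + r1)) sums c1" "(\<lambda>j. g (q * j + r2)) sums c2"
  shows "g sums (c1 + c2)"
proof -
  have *: "(\<lambda>n. if n mod q = r then g n else 0) sums c" if "r < q" "(\<lambda>j. g (q * j + r)) sums c" for r c
  proof (subst sums_mono_reindex[symmetric, of "\<lambda>j. q * j + r"])
    show "strict_mono (\<lambda>j. q * j + r)" using that by (auto simp: strict_mono_def)
    show "(if n mod q = r then g n else 0) = 0" if "n \<notin> range (\<lambda>j. q * j + r)" for n
      using that by (metis mult_div_mod_eq rangeI)
  qed (use that in simp)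
  have "(\<lambda>n. (if n mod q = r1 then g n else 0) + (if n mod q = r2 then g n else 0)) sums (c1 + c2)"
    by (intro sums_add * assms)
  moreover have "(if n mod q = r1 then g n else 0) + (if n mod q = r2 then g n else 0) = g n" for n
    using assms(3) zero[of n] by auto
  ultimately show ?thesis by simp
qed

section \<open>Euler products over the primes of one residue class\<close>

definition euler_factor :: "nat \<Rightarrow> nat \<Rightarrow> nat \<Rightarrow> nat \<Rightarrow> real" where
  "euler_factor m r s p = (if prime p \<and> p mod m = r then 1 / (1 - 1 / real p ^ s) else 1)"

definition euler_prod :: "nat \<Rightarrow> nat \<Rightarrow> nat \<Rightarrow> real" where
  "euler_prod m r s = prodinf (euler_factor m r s)"

lemma prime_power_ge_4:
  assumes "prime p" "s \<ge> 2"
  shows "real p ^ s \<ge> (real p)\<^sup>2" "(real p)\<^sup>2 \<ge> 4"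
proof -
  have "real p \<ge> 2" using prime_ge_2_nat[OF assms(1)] by simp
  thus "real p ^ s \<ge> (real p)\<^sup>2" "(real p)\<^sup>2 \<ge> 4"
    using assms(2) power_mono[of 2 "real p" 2] by (auto intro!: power_increasing)
qed

lemma euler_factor_bounds:
  assumes "s \<ge> 2"
  shows "1 \<le> euler_factor m r s p"
    "euler_factor m r s p - 1 \<le> (if prime p \<and> p mod m = r then 2 / real p ^ s else 0)"
proof -
  have "1 \<le> 1 / (1 - 1 / real p ^ s) \<and> 1 / (1 - 1 / real p ^ s) - 1 \<le> 2 / real p ^ s" if "prime p"
  proof -
    have "4 \<le> real p ^ s" using prime_power_ge_4[OF that assms] by linarith
    moreover define x where "x = 1 / real p ^ s"
    ultimately have x: "0 < x" "x \<le> 1 / 4"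
      using divide_left_mono[of 4 "real p ^ s" 1] prime_gt_0_nat[OF that] by auto
    have "1 / (1 - x) - 1 = x / (1 - x)" using x by (simp add: field_simps)
    also have "\<dots> \<le> 2 * x" using x by (simp add: field_simps)
    finally show ?thesis using x by (simp add: x_def)
  qed
  thus "1 \<le> euler_factor m r s p"
    "euler_factor m r s p - 1 \<le> (if prime p \<and> p mod m = r then 2 / real p ^ s else 0)"
    by (auto simp: euler_factor_def)
qed

lemma euler_prod_LIMSEQ:
  assumes "s \<ge> 2"
  shows "(\<lambda>N. \<Prod>p\<le>N. euler_factor m r s p) \<longlonglongrightarrow> euler_prod m r s"
proof -
  have "summable (\<lambda>p. 2 / (real p)\<^sup>2)"
    using summable_mult[OF inverse_power_summable[of 2, where 'a = real], of 2] by (simp add: field_simps)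
  hence "summable (\<lambda>p. norm (euler_factor m r s p - 1))"
  proof (rule summable_comparison_test')
    fix p
    have "\<bar>euler_factor m r s p - 1\<bar> \<le> (if prime p \<and> p mod m = r then 2 / real p ^ s else 0)"
      using euler_factor_bounds[OF assms, of m r p] by simp
    also have "\<dots> \<le> 2 / (real p)\<^sup>2"
      using prime_power_ge_4[of p s] assms prime_gt_0_nat[of p] by (auto intro!: divide_left_mono mult_pos_pos)
    finally show "norm (norm (euler_factor m r s p - 1)) \<le> 2 / (real p)\<^sup>2" by simp
  qed
  hence "convergent_prod (euler_factor m r s)"
    by (intro abs_convergent_prod_imp_convergent_prod summable_imp_abs_convergent_prod)
  thus ?thesis unfolding euler_prod_def by (rule convergent_prod_LIMSEQ)
qed

lemma euler_prod_ge_1: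
  assumes "s \<ge> 2"
  shows "1 \<le> euler_prod m r s"
  by (rule LIMSEQ_le_const[OF euler_prod_LIMSEQ[OF assms]])
     (auto intro!: prod_ge_1 euler_factor_bounds assms)

text \<open>Two of the \<open>s\<close> powers of \<open>p\<close> are kept for convergence, where
  the sum of inverse squares is at most 2; the other \<open>s - 2\<close> are bounded by those of
  the least prime. This is what makes the products at large \<open>s\<close> negligible.\<close>

lemma euler_prod_le:
  assumes s: "s \<ge> 2" and b: "b > 0" "\<And>p. prime p \<Longrightarrow> p mod m = r \<Longrightarrow> p \<ge> b"
  shows "euler_prod m r s \<le> exp (4 / real b ^ (s - 2))"
proof (rule LIMSEQ_le_const2[OF euler_prod_LIMSEQ[OF s]], intro exI allI impI)
  fix N :: nat
  have le: "euler_factor m r s p - 1 \<le> 2 / real b ^ (s - 2) * (1 / (real p)\<^sup>2)" for p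
  proof (cases "prime p \<and> p mod m = r")
    case True
    have "real b ^ (s - 2) * (real p)\<^sup>2 \<le> real p ^ (s - 2) * (real p)\<^sup>2"
      using b True by (intro mult_right_mono power_mono) auto
    also have "\<dots> = real p ^ s" by (simp only: power_add[symmetric] le_add_diff_inverse2[OF s])
    finally have "2 / real p ^ s \<le> 2 / (real b ^ (s - 2) * (real p)\<^sup>2)"
      using b True prime_gt_0_nat[of p] by (intro divide_left_mono) auto
    thus ?thesis using euler_factor_bounds(2)[OF s, of m r p] True by simp
  qed (use b in \<open>auto simp: euler_factor_def\<close>)
  have "(\<Sum>p\<le>N. 1 / (real p)\<^sup>2) \<le> pi\<^sup>2 / 6"
  proof -
    have "(\<lambda>n. 1 / (real n)\<^sup>2) sums (pi\<^sup>2 / 6)"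
      using inverse_squares_sums sums_Suc_iff[of "\<lambda>n. 1 / (real n)\<^sup>2" "pi\<^sup>2 / 6"] by (simp add: add.commute)
    thus ?thesis using sum_le_suminf[of "\<lambda>n. 1 / (real n)\<^sup>2" "{..N}"] by (auto simp: sums_iff)
  qed
  also have "\<dots> \<le> 2"
    using pi_less_4 pi_approx(2) power_mono[of pi "3.2" 2] by (simp add: power2_eq_square)
  finally have sum: "(\<Sum>p\<le>N. 1 / (real p)\<^sup>2) \<le> 2" .
  have "(\<Prod>p\<le>N. euler_factor m r s p) \<le> (\<Prod>p\<le>N. exp (euler_factor m r s p - 1))"
  proof (rule prod_mono)
    fix p
    show "0 \<le> euler_factor m r s p \<and> euler_factor m r s p \<le> exp (euler_factor m r s p - 1)"
      using euler_factor_bounds(1)[OF s, of m r p] exp_ge_add_one_self[of "euler_factor m r s p - 1"] by simp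
  qed
  also have "\<dots> = exp (\<Sum>p\<le>N. euler_factor m r s p - 1)" by (simp add: exp_sum)
  also have "\<dots> \<le> exp (\<Sum>p\<le>N. 2 / real b ^ (s - 2) * (1 / (real p)\<^sup>2))"
    by (simp only: exp_le_cancel_iff) (intro sum_mono le)
  also have "\<dots> = exp (2 / real b ^ (s - 2) * (\<Sum>p\<le>N. 1 / (real p)\<^sup>2))" by (simp add: sum_distrib_left)
  also have "\<dots> \<le> exp (2 / real b ^ (s - 2) * 2)"
    using b sum by (simp only: exp_le_cancel_iff) (intro mult_left_mono, auto)
  finally show "(\<Prod>p\<le>N. euler_factor m r s p) \<le> exp (4 / real b ^ (s - 2))" by simp
qed

section \<open>Real characters modulo 12\<close>

definition dirichlet :: "(nat \<Rightarrow> int) \<Rightarrow> nat \<Rightarrow> nat \<Rightarrow> real" where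
  "dirichlet \<psi> s n = of_int (\<psi> n) / real n ^ s"

definition real_character :: "(nat \<Rightarrow> int) \<Rightarrow> bool" where
  "real_character \<psi> \<longleftrightarrow> \<psi> 0 = 0 \<and> \<psi> 1 = 1 \<and> (\<forall>m n. \<psi> (m * n) = \<psi> m * \<psi> n) \<and> (\<forall>n. \<bar>\<psi> n\<bar> \<le> 1)"

lemma completely_mult_dirichlet: "real_character \<psi> \<Longrightarrow> completely_mult (dirichlet \<psi> s)"
  by (simp add: real_character_def completely_mult_def dirichlet_def power_mult_distrib)

lemma summable_inverse_powers: "s \<ge> 2 \<Longrightarrow> summable (\<lambda>n. 1 / real n ^ s)"
  using inverse_power_summable[of s, where 'a = real] by (simp add: inverse_eq_divide)

lemma summable_dirichlet:
  assumes "real_character \<psi>" "s \<ge> 2"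
  shows "summable (\<lambda>n. \<bar>dirichlet \<psi> s n\<bar>)"
proof (rule summable_comparison_test'[OF summable_inverse_powers[OF assms(2)]])
  fix n
  have "\<bar>real_of_int (\<psi> n)\<bar> \<le> 1" using assms(1) by (simp add: real_character_def flip: of_int_abs)
  thus "norm \<bar>dirichlet \<psi> s n\<bar> \<le> 1 / real n ^ s"
    by (simp add: dirichlet_def abs_mult divide_right_mono)
qed

definition L_series :: "(nat \<Rightarrow> int) \<Rightarrow> nat \<Rightarrow> real" where
  "L_series \<psi> s = (\<Sum>n. dirichlet \<psi> s n)"

lemma dirichlet_sums:
  assumes "real_character \<psi>" "s \<ge> 2"
  shows "dirichlet \<psi> s sums L_series \<psi> s"
  unfolding L_series_def by (rule summable_sums[OF summable_rabs_cancel[OF summable_dirichlet[OF assms]]])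

lemma L_series_euler_product:
  assumes "real_character \<psi>" "s \<ge> 2"
  shows "(\<lambda>N. (\<Prod>p\<le>N. if prime p then 1 - dirichlet \<psi> s p else 1) * L_series \<psi> s) \<longlonglongrightarrow> 1"
  using assms by (intro euler_product_tendsto completely_mult_dirichlet summable_dirichlet dirichlet_sums)

definition residue_char :: "nat \<Rightarrow> nat set \<Rightarrow> nat set \<Rightarrow> nat \<Rightarrow> int" where
  "residue_char m A B n = (if n mod m \<in> A then 1 else if n mod m \<in> B then -1 else 0)"

lemma real_character_residue_char:
  assumes "m > 0" "0 \<notin> A" "0 \<notin> B" "1 mod m \<in> A"
    and "\<forall>a<m. \<forall>b<m. residue_char m A B (a * b) = residue_char m A B a * residue_char m A B b"
  shows "real_character (residue_char m A B)"
proof -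
  have "residue_char m A B (x * y) = residue_char m A B x * residue_char m A B y" for x y
  proof -
    have "residue_char m A B (x * y) = residue_char m A B ((x mod m) * (y mod m))"
      by (simp add: residue_char_def mod_mult_eq)
    also have "\<dots> = residue_char m A B (x mod m) * residue_char m A B (y mod m)" using assms by simp
    finally show ?thesis by (simp add: residue_char_def)
  qed
  thus ?thesis using assms by (auto simp: real_character_def residue_char_def)
qed

text \<open>\<open>chi3_0\<close> and \<open>chi12_0\<close> are principal; the suffix of the other
  characters modulo 12 is the conductor. The series U, V, A, B of the overview belong to
  \<open>chi12_0\<close>, \<open>chi12_3\<close>, \<open>chi12_4\<close>,
  \<open>chi12_12\<close>.\<close>

abbreviation "chi3_0 \<equiv> residue_char 3 {1, 2} {}"
abbreviation "chi3 \<equiv> residue_char 3 {1} {2}"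
abbreviation "chi12_0 \<equiv> residue_char 12 {1, 5, 7, 11} {}"
abbreviation "chi12_3 \<equiv> residue_char 12 {1, 7} {5, 11}"
abbreviation "chi12_4 \<equiv> residue_char 12 {1, 5} {7, 11}"
abbreviation "chi12_12 \<equiv> residue_char 12 {1, 11} {5, 7}"

lemma all_less_12: "(\<forall>a<12. P a) \<longleftrightarrow> P 0 \<and> P 1 \<and> P 2 \<and> P 3 \<and> P 4 \<and> P 5 \<and> P 6 \<and> P 7 \<and> P 8 \<and> P 9 \<and> P 10 \<and> P (11::nat)"
  by (simp add: numeral_eq_Suc All_less_Suc conj_ac)

lemma all_less_3: "(\<forall>a<3. P a) \<longleftrightarrow> P 0 \<and> P 1 \<and> P (2::nat)"
  by (simp add: numeral_eq_Suc All_less_Suc conj_ac)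

lemma all_less_4: "(\<forall>a<4. P a) \<longleftrightarrow> P 0 \<and> P 1 \<and> P 2 \<and> P (3::nat)"
  by (simp add: numeral_eq_Suc All_less_Suc conj_ac)

lemma real_character_mult:
  assumes "real_character \<psi>" "real_character \<phi>"
  shows "real_character (\<lambda>n. \<psi> n * \<phi> n)"
  using assms unfolding real_character_def abs_mult by (auto intro: mult_le_one)

text \<open>Factoring through the moduli 4 and 3 reduces the check of multiplicativity from 144
  pairs of residues to 16 and 9.\<close>

lemma chi12_eq:
  "chi12_0 = (\<lambda>n. residue_char 4 {1, 3} {} n * chi3_0 n)" "chi12_3 = (\<lambda>n. residue_char 4 {1, 3} {} n * chi3 n)"
  "chi12_4 = (\<lambda>n. residue_char 4 {1} {3} n * chi3_0 n)" "chi12_12 = (\<lambda>n. residue_char 4 {1} {3} n * chi3 n)"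
proof -
  let ?P = "\<lambda>n. chi12_0 n = residue_char 4 {1, 3} {} n * chi3_0 n \<and> chi12_3 n = residue_char 4 {1, 3} {} n * chi3 n \<and>
    chi12_4 n = residue_char 4 {1} {3} n * chi3_0 n \<and> chi12_12 n = residue_char 4 {1} {3} n * chi3 n"
  have "\<forall>n<12. ?P n" by (simp add: all_less_12 residue_char_def)
  hence "?P (n mod 12)" for n by simp
  moreover have "n mod 12 mod 3 = n mod 3" "n mod 12 mod 4 = n mod 4" for n :: nat
    by (simp_all add: mod_mod_cancel)
  ultimately have "?P n" for n by (simp only: residue_char_def mod_mod_trivial)
  thus "chi12_0 = (\<lambda>n. residue_char 4 {1, 3} {} n * chi3_0 n)" "chi12_3 = (\<lambda>n. residue_char 4 {1, 3} {} n * chi3 n)"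
    "chi12_4 = (\<lambda>n. residue_char 4 {1} {3} n * chi3_0 n)" "chi12_12 = (\<lambda>n. residue_char 4 {1} {3} n * chi3 n)"
    by auto
qed

lemma real_characters:
  "real_character chi3_0" "real_character chi3" "real_character chi12_0"
  "real_character chi12_3" "real_character chi12_4" "real_character chi12_12"
proof -
  show c3: "real_character chi3_0" "real_character chi3"
    by (rule real_character_residue_char; simp add: all_less_3 residue_char_def)+
  have c4: "real_character (residue_char 4 {1, 3} {})" "real_character (residue_char 4 {1} {3})"
    by (rule real_character_residue_char; simp add: all_less_4 residue_char_def)+
  show "real_character chi12_0" "real_character chi12_3" "real_character chi12_4" "real_character chi12_12"
    unfolding chi12_eq by (intro real_character_mult c3 c4)+
qed

lemma prime_mod_12:
  assumes "prime (p::nat)"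
  shows "p = 2 \<or> p = 3 \<or> p mod 12 = 1 \<or> p mod 12 = 5 \<or> p mod 12 = 7 \<or> p mod 12 = 11"
proof (cases "p = 2 \<or> p = 3")
  case False
  hence "\<not> 2 dvd p" "\<not> 3 dvd p" using assms primes_dvd_imp_eq[of 2 p] primes_dvd_imp_eq[of 3 p] by auto
  thus ?thesis by presburger
qed auto

lemma mod_6_eq_mod_12: "(n::nat) mod 6 = n mod 12 mod 6" by (simp add: mod_mod_cancel)

section \<open>Relations between the Euler products at s and 2 s\<close>

text \<open>The two characters differ only at the primes 5 mod 6, where they are 1 and -1; with x =
  p^(-s) the local identity is (1 - x) / (1 - x)^2 = (1 + x) / (1 - x^2). The finite identity is
  multiplied by both L-values before the limit, so that each product over
  \<open>1 - dirichlet\<close> meets its own L-value and tends to 1.\<close>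

lemma euler_prod_5_mod_6:
  assumes s: "s \<ge> 2"
  shows "(euler_prod 6 5 s)\<^sup>2 * L_series chi12_3 s = euler_prod 6 5 (2 * s) * L_series chi12_0 s"
proof -
  let ?P = "\<lambda>\<psi> N. \<Prod>p\<le>N. if prime p then 1 - dirichlet \<psi> s p else (1::real)"
  let ?E = "\<lambda>s N. \<Prod>p\<le>N. euler_factor 6 5 s p"
  have factor: "(euler_factor 6 5 s p)\<^sup>2 * (if prime p then 1 - dirichlet chi12_0 s p else 1) =
      euler_factor 6 5 (2 * s) p * (if prime p then 1 - dirichlet chi12_3 s p else 1)" for p
  proof (cases "prime p")
    case True
    define x where "x = 1 / real p ^ s"
    have "4 \<le> real p ^ s" using prime_power_ge_4[OF True s] by linarith
    hence x: "0 < x" "x < 1" using prime_gt_0_nat[OF True] by (auto simp: x_def)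
    have dir: "dirichlet \<psi> s p = of_int (\<psi> p) * x" for \<psi> by (simp add: dirichlet_def x_def)
    have x2: "1 / real p ^ (2 * s) = x\<^sup>2" by (simp add: x_def power_mult power_divide mult.commute[of 2])
    have "(1 / (1 - x))\<^sup>2 * (1 - x) = 1 / (1 - x\<^sup>2) * (1 + x)"
    proof -
      have "1 - x\<^sup>2 = (1 - x) * (1 + x)" by (simp add: power2_eq_square algebra_simps)
      thus ?thesis using x by (simp add: power2_eq_square)
    qed
    thus ?thesis using prime_mod_12[OF True] True
      by (auto simp: euler_factor_def dir residue_char_def mod_6_eq_mod_12[of p] x_def[symmetric] x2)
  qed (simp add: euler_factor_def)
  have "(?E s N)\<^sup>2 * ?P chi12_0 N = ?E (2 * s) N * ?P chi12_3 N" for N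
    unfolding prod_power_distrib prod.distrib[symmetric] factor ..
  hence "(\<lambda>N. (?E s N)\<^sup>2 * (?P chi12_0 N * L_series chi12_0 s) * L_series chi12_3 s) =
         (\<lambda>N. ?E (2 * s) N * (?P chi12_3 N * L_series chi12_3 s) * L_series chi12_0 s)"
    by (auto simp: fun_eq_iff mult_ac)
  moreover have "(\<lambda>N. (?E s N)\<^sup>2 * (?P chi12_0 N * L_series chi12_0 s) * L_series chi12_3 s)
      \<longlonglongrightarrow> (euler_prod 6 5 s)\<^sup>2 * 1 * L_series chi12_3 s"
    by (intro tendsto_intros euler_prod_LIMSEQ L_series_euler_product real_characters s)
  moreover have "(\<lambda>N. ?E (2 * s) N * (?P chi12_3 N * L_series chi12_3 s) * L_series chi12_0 s)
      \<longlonglongrightarrow> euler_prod 6 5 (2 * s) * 1 * L_series chi12_0 s"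
    by (intro tendsto_intros euler_prod_LIMSEQ L_series_euler_product real_characters) (use s in auto)
  ultimately show ?thesis by (simp add: LIMSEQ_unique)
qed

text \<open>At primes 1, 5, 11 mod 12 the pair \<open>chi12_0\<close>, \<open>chi12_3\<close> takes
  the same two values as the pair \<open>chi12_4\<close>, \<open>chi12_12\<close>, up to order. Only
  at 7 mod 12 do they differ: 1, 1 against -1, -1, which gives the square of the preceding local
  identity.\<close>

lemma euler_prod_7_mod_12:
  assumes s: "s \<ge> 2"
  shows "(euler_prod 12 7 s) ^ 4 * (L_series chi12_4 s * L_series chi12_12 s) =
         (euler_prod 12 7 (2 * s))\<^sup>2 * (L_series chi12_0 s * L_series chi12_3 s)"
proof -
  let ?L = "\<lambda>\<psi>. L_series \<psi> s"
  let ?P = "\<lambda>\<psi> N. \<Prod>p\<le>N. if prime p then 1 - dirichlet \<psi> s p else (1::real)"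
  let ?E = "\<lambda>s N. \<Prod>p\<le>N. euler_factor 12 7 s p"
  have factor: "(euler_factor 12 7 s p) ^ 4 * ((if prime p then 1 - dirichlet chi12_0 s p else 1) *
        (if prime p then 1 - dirichlet chi12_3 s p else 1)) =
      (euler_factor 12 7 (2 * s) p)\<^sup>2 * ((if prime p then 1 - dirichlet chi12_4 s p else 1) *
        (if prime p then 1 - dirichlet chi12_12 s p else 1))" for p
  proof (cases "prime p")
    case True
    define x where "x = 1 / real p ^ s"
    have "4 \<le> real p ^ s" using prime_power_ge_4[OF True s] by linarith
    hence x: "0 < x" "x < 1" using prime_gt_0_nat[OF True] by (auto simp: x_def)
    have dir: "dirichlet \<psi> s p = of_int (\<psi> p) * x" for \<psi> by (simp add: dirichlet_def x_def)
    have x2: "1 / real p ^ (2 * s) = x\<^sup>2" by (simp add: x_def power_mult power_divide mult.commute[of 2])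
    have "(1 / (1 - x)) ^ 4 * ((1 - x) * (1 - x)) = (1 / (1 - x\<^sup>2))\<^sup>2 * ((1 + x) * (1 + x))"
    proof -
      have "1 - x\<^sup>2 = (1 - x) * (1 + x)" by (simp add: power2_eq_square algebra_simps)
      thus ?thesis using x by (simp add: power2_eq_square power4_eq_xxxx)
    qed
    thus ?thesis using prime_mod_12[OF True] True
      by (auto simp: euler_factor_def dir residue_char_def x_def[symmetric] x2)
  qed (simp add: euler_factor_def)
  have "(?E s N) ^ 4 * (?P chi12_0 N * ?P chi12_3 N) = (?E (2 * s) N)\<^sup>2 * (?P chi12_4 N * ?P chi12_12 N)" for N
    unfolding prod_power_distrib prod.distrib[symmetric] factor ..
  hence "(\<lambda>N. (?E s N) ^ 4 * ((?P chi12_0 N * ?L chi12_0) * (?P chi12_3 N * ?L chi12_3)) * (?L chi12_4 * ?L chi12_12)) =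
         (\<lambda>N. (?E (2 * s) N)\<^sup>2 * ((?P chi12_4 N * ?L chi12_4) * (?P chi12_12 N * ?L chi12_12)) * (?L chi12_0 * ?L chi12_3))"
    by (simp add: fun_eq_iff)
  moreover have "(\<lambda>N. (?E s N) ^ 4 * ((?P chi12_0 N * ?L chi12_0) * (?P chi12_3 N * ?L chi12_3)) * (?L chi12_4 * ?L chi12_12))
      \<longlonglongrightarrow> (euler_prod 12 7 s) ^ 4 * (1 * 1) * (?L chi12_4 * ?L chi12_12)"
    by (intro tendsto_intros euler_prod_LIMSEQ L_series_euler_product real_characters s)
  moreover have "(\<lambda>N. (?E (2 * s) N)\<^sup>2 * ((?P chi12_4 N * ?L chi12_4) * (?P chi12_12 N * ?L chi12_12)) * (?L chi12_0 * ?L chi12_3))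
      \<longlonglongrightarrow> (euler_prod 12 7 (2 * s))\<^sup>2 * (1 * 1) * (?L chi12_0 * ?L chi12_3)"
    by (intro tendsto_intros euler_prod_LIMSEQ L_series_euler_product real_characters) (use s in auto)
  ultimately show ?thesis by (simp add: LIMSEQ_unique)
qed

lemma prime_product_LIMSEQ: "(\<lambda>N. \<Prod>p\<le>N. prime_factor m R p) \<longlonglongrightarrow> prime_product m R"
  unfolding prime_product_def
  by (intro convergent_prod_LIMSEQ abs_convergent_prod_imp_convergent_prod abs_convergent_prime_factor)

lemma prime_factor_square:
  "(prime_factor m R p)\<^sup>2 = (if prime p \<and> p mod m \<in> R then 1 / (1 - 1 / (real p)\<^sup>2) else 1)"
proof (cases "prime p")
  case True
  have "1 / (real p)\<^sup>2 < 1" using prime_power_ge_4(2)[OF True, of 2] by (simp add: divide_less_eq)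
  hence "0 < 1 - 1 / (real p)\<^sup>2" by simp
  thus ?thesis by (auto simp: prime_factor_def powr_minus powr_half_sqrt power_inverse inverse_eq_divide power_divide simp del: diff_gt_0_iff_gt)
qed (simp add: prime_factor_def)

lemma prime_product_nonneg: "0 \<le> prime_product m R"
  by (rule LIMSEQ_le_const[OF prime_product_LIMSEQ]) (auto intro!: prod_nonneg simp: prime_factor_def)

text \<open>The primes 2 mod 3 are those 5 mod 6 together with 2, whose squared factor is 1 / (1 -
  1/4) = 4/3.\<close>

lemma prime_product_3: "(prime_product 3 {2})\<^sup>2 = 4 / 3 * euler_prod 6 5 2"
proof -
  have "(prime_factor 3 {2} p)\<^sup>2 = (if p = 2 then 4 / 3 else 1) * euler_factor 6 5 2 p" for p
  proof (cases "prime p")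
    case True
    have "p mod 12 mod 3 = p mod 3" by (simp add: mod_mod_cancel)
    thus ?thesis using prime_mod_12[OF True] True
      by (auto simp: prime_factor_square euler_factor_def mod_6_eq_mod_12[of p])
  qed (auto simp: prime_factor_square euler_factor_def)
  hence eq: "(\<Prod>p\<le>N. prime_factor 3 {2} p)\<^sup>2 = (\<Prod>p\<le>N. if p = 2 then 4 / 3 else 1) * (\<Prod>p\<le>N. euler_factor 6 5 2 p)" for N
    by (simp add: prod_power_distrib prod.distrib)
  have "(\<lambda>N. (\<Prod>p\<le>N. prime_factor 3 {2} p)\<^sup>2) \<longlonglongrightarrow> (prime_product 3 {2})\<^sup>2"
    by (intro tendsto_intros prime_product_LIMSEQ)
  moreover have "(\<lambda>N. (\<Prod>p\<le>N. prime_factor 3 {2} p)\<^sup>2) \<longlonglongrightarrow> 4 / 3 * euler_prod 6 5 2"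
  proof (rule Lim_transform_eventually)
    show "(\<lambda>N. 4 / 3 * (\<Prod>p\<le>N. euler_factor 6 5 2 p)) \<longlonglongrightarrow> 4 / 3 * euler_prod 6 5 2"
      by (intro tendsto_intros euler_prod_LIMSEQ) simp
    show "\<forall>\<^sub>F N in sequentially. 4 / 3 * (\<Prod>p\<le>N. euler_factor 6 5 2 p) = (\<Prod>p\<le>N. prime_factor 3 {2} p)\<^sup>2"
      using eventually_ge_at_top[of 2] by eventually_elim (simp only: eq, simp add: prod.delta)
  qed
  ultimately show ?thesis by (rule LIMSEQ_unique)
qed

text \<open>The classes 5 and 11 mod 12 together form the class 5 mod 6; the class 7 is the second
  product.\<close>

lemma prime_product_12: "(prime_product 12 {5, 7, 11})\<^sup>2 = euler_prod 6 5 2 * euler_prod 12 7 2"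
proof -
  have "(prime_factor 12 {5, 7, 11} p)\<^sup>2 = euler_factor 6 5 2 p * euler_factor 12 7 2 p" for p
  proof (cases "prime p")
    case True
    thus ?thesis using prime_mod_12[OF True]
      by (auto simp: prime_factor_square euler_factor_def mod_6_eq_mod_12[of p])
  qed (auto simp: prime_factor_square euler_factor_def)
  hence eq: "(\<Prod>p\<le>N. prime_factor 12 {5, 7, 11} p)\<^sup>2 = (\<Prod>p\<le>N. euler_factor 6 5 2 p) * (\<Prod>p\<le>N. euler_factor 12 7 2 p)" for N
    by (simp add: prod_power_distrib prod.distrib)
  have "(\<lambda>N. (\<Prod>p\<le>N. prime_factor 12 {5, 7, 11} p)\<^sup>2) \<longlonglongrightarrow> (prime_product 12 {5, 7, 11})\<^sup>2"
    by (intro tendsto_intros prime_product_LIMSEQ)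
  moreover have "(\<lambda>N. (\<Prod>p\<le>N. prime_factor 12 {5, 7, 11} p)\<^sup>2) \<longlonglongrightarrow> euler_prod 6 5 2 * euler_prod 12 7 2"
    unfolding eq by (intro tendsto_intros euler_prod_LIMSEQ) auto
  ultimately show ?thesis by (rule LIMSEQ_unique)
qed

section \<open>L-values as combinations of alternating sums\<close>

definition alt_sum :: "nat \<Rightarrow> nat \<Rightarrow> nat \<Rightarrow> real" where
  "alt_sum q r s = (\<Sum>j. (-1) ^ j / real (q * j + r) ^ s)"

lemma alt_sum_sums:
  assumes "q > 0" "r > 0" "s \<ge> 2"
  shows "(\<lambda>j. (-1) ^ j / real (q * j + r) ^ s) sums alt_sum q r s"
  unfolding alt_sum_def
proof (rule summable_sums[OF summable_comparison_test'[of "\<lambda>j. 1 / real (j + 1) ^ s"]])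
  show "summable (\<lambda>j. 1 / real (j + 1) ^ s)"
    using summable_iff_shift[of "\<lambda>n. 1 / real n ^ s" 1] summable_inverse_powers[OF assms(3)] by simp
  fix j :: nat
  have "1 * j \<le> q * j" using assms by (intro mult_le_mono1) simp
  hence "j + 1 \<le> q * j + r" using assms by linarith
  hence "real (j + 1) ^ s \<le> real (q * j + r) ^ s" by (intro power_mono) (simp_all del: of_nat_add of_nat_mult)
  thus "norm ((-1) ^ j / real (q * j + r) ^ s) \<le> 1 / real (j + 1) ^ s"
    using assms by (simp add: norm_divide norm_power divide_left_mono del: of_nat_add of_nat_mult)
qed

lemma minus_one_power_3: "(-1::real) ^ (3 * j + k) = (-1) ^ j * (-1) ^ k"
  by (simp add: power_add power_mult)

lemma mod_12_residues:
  "(6 * j + 1) mod 12 = (if even j then 1 else 7)" "(6 * j + 5) mod 12 = (if even j then 5 else 11)" for j :: nat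
  by presburger+

text \<open>The progression 6 j + 1 runs alternately through 1 and 7 mod 12, and 6 j + 5 through 5
  and 11; the character changes sign between the members of each pair, so its series already
  alternates.\<close>

lemma L_chi12_4:
  assumes "s \<ge> 2"
  shows "L_series chi12_4 s = alt_sum 6 1 s + alt_sum 6 5 s"
proof -
  have "dirichlet chi12_4 s sums (alt_sum 6 1 s + alt_sum 6 5 s)"
  proof (rule sums_residue_classes[of 1 6 5])
    show "dirichlet chi12_4 s n = 0" if "n mod 6 \<noteq> 1" "n mod 6 \<noteq> 5" for n
      using that by (auto simp: dirichlet_def residue_char_def mod_6_eq_mod_12[of n])
    have "dirichlet chi12_4 s (6 * j + 1) = (-1) ^ j / real (6 * j + 1) ^ s" for j
      unfolding dirichlet_def residue_char_def mod_12_residues by simp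
    thus "(\<lambda>j. dirichlet chi12_4 s (6 * j + 1)) sums alt_sum 6 1 s" using alt_sum_sums[of 6 1 s] assms by simp
    have "dirichlet chi12_4 s (6 * j + 5) = (-1) ^ j / real (6 * j + 5) ^ s" for j
      unfolding dirichlet_def residue_char_def mod_12_residues by simp
    thus "(\<lambda>j. dirichlet chi12_4 s (6 * j + 5)) sums alt_sum 6 5 s" using alt_sum_sums[of 6 5 s] assms by simp
  qed auto
  thus ?thesis using dirichlet_sums[OF real_characters(5) assms] by (simp add: sums_unique2)
qed

lemma L_chi12_12:
  assumes "s \<ge> 2"
  shows "L_series chi12_12 s = alt_sum 6 1 s - alt_sum 6 5 s"
proof -
  have "dirichlet chi12_12 s sums (alt_sum 6 1 s + - alt_sum 6 5 s)"
  proof (rule sums_residue_classes[of 1 6 5])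
    show "dirichlet chi12_12 s n = 0" if "n mod 6 \<noteq> 1" "n mod 6 \<noteq> 5" for n
      using that by (auto simp: dirichlet_def residue_char_def mod_6_eq_mod_12[of n])
    have "dirichlet chi12_12 s (6 * j + 1) = (-1) ^ j / real (6 * j + 1) ^ s" for j
      unfolding dirichlet_def residue_char_def mod_12_residues by simp
    thus "(\<lambda>j. dirichlet chi12_12 s (6 * j + 1)) sums alt_sum 6 1 s" using alt_sum_sums[of 6 1 s] assms by simp
    have "dirichlet chi12_12 s (6 * j + 5) = - ((-1) ^ j / real (6 * j + 5) ^ s)" for j
      unfolding dirichlet_def residue_char_def mod_12_residues by simp
    thus "(\<lambda>j. dirichlet chi12_12 s (6 * j + 5)) sums - alt_sum 6 5 s"
      using sums_minus[OF alt_sum_sums[of 6 5 s]] assms by simp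
  qed auto
  thus ?thesis using dirichlet_sums[OF real_characters(6) assms] by (simp add: sums_unique2)
qed

text \<open>The character is constant along 3 j + 1 and along 3 j + 2, so alternation has to be
  created: the sign (-1)^(n + 1) costs the factor \<open>1 - 2 * f 2\<close>, and 3 j has the parity
  of j. For \<open>chi3\<close> the value -1 at 2 turns the factor into
  \<open>1 + 2 / 2 ^ s\<close>.\<close>

lemma L_chi3_0:
  assumes "s \<ge> 2"
  shows "(1 - 2 / 2 ^ s) * L_series chi3_0 s = alt_sum 3 1 s - alt_sum 3 2 s"
proof -
  have "(\<lambda>n. (-1) ^ (n + 1) * dirichlet chi3_0 s n) sums (alt_sum 3 1 s + - alt_sum 3 2 s)"
  proof (rule sums_residue_classes[of 1 3 2])
    show "(-1) ^ (n + 1) * dirichlet chi3_0 s n = 0" if "n mod 3 \<noteq> 1" "n mod 3 \<noteq> 2" for n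
      using that by (auto simp: dirichlet_def residue_char_def)
    have "(-1) ^ (3 * j + 1 + 1) * dirichlet chi3_0 s (3 * j + 1) = (-1) ^ j / real (3 * j + 1) ^ s" for j
      unfolding dirichlet_def residue_char_def add.assoc minus_one_power_3 by simp
    thus "(\<lambda>j. (-1) ^ (3 * j + 1 + 1) * dirichlet chi3_0 s (3 * j + 1)) sums alt_sum 3 1 s"
      using alt_sum_sums[of 3 1 s] assms by simp
    have "(-1) ^ (3 * j + 2 + 1) * dirichlet chi3_0 s (3 * j + 2) = - ((-1) ^ j / real (3 * j + 2) ^ s)" for j
      unfolding dirichlet_def residue_char_def add.assoc minus_one_power_3 by (simp add: mod_Suc)
    thus "(\<lambda>j. (-1) ^ (3 * j + 2 + 1) * dirichlet chi3_0 s (3 * j + 2)) sums - alt_sum 3 2 s"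
      using sums_minus[OF alt_sum_sums[of 3 2 s]] assms by simp
  qed auto
  moreover have "(\<lambda>n. (-1) ^ (n + 1) * dirichlet chi3_0 s n) sums ((1 - 2 * dirichlet chi3_0 s 2) * L_series chi3_0 s)"
    by (intro alternating_sums completely_mult_dirichlet dirichlet_sums real_characters assms)
  ultimately show ?thesis by (simp add: sums_unique2 dirichlet_def residue_char_def)
qed

lemma L_chi3:
  assumes "s \<ge> 2"
  shows "(1 + 2 / 2 ^ s) * L_series chi3 s = alt_sum 3 1 s + alt_sum 3 2 s"
proof -
  have "(\<lambda>n. (-1) ^ (n + 1) * dirichlet chi3 s n) sums (alt_sum 3 1 s + alt_sum 3 2 s)"
  proof (rule sums_residue_classes[of 1 3 2])
    show "(-1) ^ (n + 1) * dirichlet chi3 s n = 0" if "n mod 3 \<noteq> 1" "n mod 3 \<noteq> 2" for n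
      using that by (auto simp: dirichlet_def residue_char_def)
    have "(-1) ^ (3 * j + 1 + 1) * dirichlet chi3 s (3 * j + 1) = (-1) ^ j / real (3 * j + 1) ^ s" for j
      unfolding dirichlet_def residue_char_def add.assoc minus_one_power_3 by simp
    thus "(\<lambda>j. (-1) ^ (3 * j + 1 + 1) * dirichlet chi3 s (3 * j + 1)) sums alt_sum 3 1 s"
      using alt_sum_sums[of 3 1 s] assms by simp
    have "(-1) ^ (3 * j + 2 + 1) * dirichlet chi3 s (3 * j + 2) = (-1) ^ j / real (3 * j + 2) ^ s" for j
      unfolding dirichlet_def residue_char_def add.assoc minus_one_power_3 by (simp add: mod_Suc)
    thus "(\<lambda>j. (-1) ^ (3 * j + 2 + 1) * dirichlet chi3 s (3 * j + 2)) sums alt_sum 3 2 s"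
      using alt_sum_sums[of 3 2 s] assms by simp
  qed auto
  moreover have "(\<lambda>n. (-1) ^ (n + 1) * dirichlet chi3 s n) sums ((1 - 2 * dirichlet chi3 s 2) * L_series chi3 s)"
    by (intro alternating_sums completely_mult_dirichlet dirichlet_sums real_characters assms)
  ultimately show ?thesis by (simp add: sums_unique2 dirichlet_def residue_char_def)
qed

lemma L_chi12_of_L_chi3:
  assumes "s \<ge> 2"
  shows "L_series chi12_0 s = (1 - 1 / 2 ^ s) * L_series chi3_0 s"
    "L_series chi12_3 s = (1 + 1 / 2 ^ s) * L_series chi3 s"
proof -
  let ?P = "\<lambda>n. (if even n then 0 else chi3_0 n) = chi12_0 n \<and> (if even n then 0 else chi3 n) = chi12_3 n"
  have "\<forall>r<12. ?P r" by (simp add: all_less_12 residue_char_def)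
  hence "?P (n mod 12)" for n by simp
  moreover have "even (n mod 12) \<longleftrightarrow> even n" "n mod 12 mod 3 = n mod 3" for n :: nat
    by (simp_all add: mod_mod_cancel dvd_mod_iff)
  ultimately have "?P n" for n by (simp only: residue_char_def mod_mod_trivial)
  hence "drop_multiples 2 (dirichlet chi3_0 s) = dirichlet chi12_0 s"
    "drop_multiples 2 (dirichlet chi3 s) = dirichlet chi12_3 s"
    unfolding drop_multiples_def dirichlet_def fun_eq_iff by (metis div_0 of_int_0)+
  thus "L_series chi12_0 s = (1 - 1 / 2 ^ s) * L_series chi3_0 s"
    "L_series chi12_3 s = (1 + 1 / 2 ^ s) * L_series chi3 s"
    using drop_multiples_sums[OF completely_mult_dirichlet[OF real_characters(1)] dirichlet_sums[OF real_characters(1) assms], of 2]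
      drop_multiples_sums[OF completely_mult_dirichlet[OF real_characters(2)] dirichlet_sums[OF real_characters(2) assms], of 2]
      dirichlet_sums[OF real_characters(3) assms] dirichlet_sums[OF real_characters(4) assms]
    by (simp_all add: sums_unique2 dirichlet_def residue_char_def)
qed

text \<open>This is zeta(2) without its Euler factors at 2 and 3: (3/4) (8/9) pi^2 / 6.\<close>

lemma L_chi12_0_2: "L_series chi12_0 2 = pi\<^sup>2 / 9"
proof -
  define f where "f = (\<lambda>n. 1 / (real n)\<^sup>2)"
  have f: "f sums (pi\<^sup>2 / 6)"
    using inverse_squares_sums sums_Suc_iff[of "\<lambda>n. 1 / (real n)\<^sup>2" "pi\<^sup>2 / 6"] by (simp add: add.commute f_def)
  have "completely_mult f" by (simp add: completely_mult_def f_def power_mult_distrib)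
  hence "drop_multiples 3 f sums ((1 - f 3) * (pi\<^sup>2 / 6))" by (intro drop_multiples_sums f) auto
  moreover have "drop_multiples 3 f = dirichlet chi3_0 2"
  proof
    fix n :: nat
    have "n mod 3 < 3" by simp
    thus "drop_multiples 3 f n = dirichlet chi3_0 2 n"
      by (auto simp: drop_multiples_def dirichlet_def residue_char_def f_def dvd_eq_mod_eq_0)
  qed
  ultimately have "L_series chi3_0 2 = (1 - f 3) * (pi\<^sup>2 / 6)"
    using sums_unique2[OF dirichlet_sums[OF real_characters(1), of 2]] by simp
  thus ?thesis using L_chi12_of_L_chi3(1)[of 2] by (simp add: f_def)
qed

section \<open>Series for the elementary constants\<close>

text \<open>The function increases up to its maximum at \<open>b\<close>; after taking logarithms,
  ln y <= y - 1 at y = t / T suffices. It bounds the truncation remainder of the Gamma integral on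
  [0, T].\<close>

lemma exp_minus_powr_mono:
  fixes t T b :: real
  assumes "0 \<le> t" "t \<le> T" "T \<le> b" "T > 0"
  shows "exp (- t) * t powr b \<le> exp (- T) * T powr b"
proof (cases "t = 0")
  case False
  hence t: "t > 0" using assms by simp
  have ln: "1 - t / T \<le> ln (T / t)" "0 \<le> ln (T / t)"
    using ln_le_minus_one[of "t / T"] t assms by (simp_all add: ln_div)
  have "T * (1 - t / T) \<le> T * ln (T / t)" using ln(1) assms by (intro mult_left_mono) auto
  also have "\<dots> \<le> b * ln (T / t)" using ln(2) assms by (intro mult_right_mono)
  finally have "T * (1 - t / T) \<le> b * ln (T / t)" .
  hence "b * ln t - t \<le> b * ln T - T" using t assms by (simp add: ln_div algebra_simps)
  hence "exp (b * ln t - t) \<le> exp (b * ln T - T)" by simp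
  thus ?thesis using t assms by (simp add: powr_def exp_diff exp_minus field_simps)
qed (use assms in simp)

text \<open>\<open>G\<close> truncates the series exp(-t) t^a sum t^k / (a)_(k+1) of the lower
  incomplete Gamma function, and its derivative telescopes to the integrand minus one term. Dropping
  that term gives the lower bound. For the upper bound, the term is replaced by its largest value
  \<open>c\<close>, attained at \<open>T\<close>, and beyond \<open>T\<close> the factor
  \<open>t powr (a - 1)\<close> is replaced by its value at \<open>T\<close>.\<close>

lemma Gamma_incomplete_series:
  fixes a T :: real
  assumes a: "0 < a" "a \<le> 1" and T: "T > 0" "T \<le> a + real N - 1"
  defines "S \<equiv> \<Sum>k<N. T ^ k / pochhammer a (Suc k)"
  shows "T powr a * exp (- T) * S \<le> Gamma a"
    "Gamma a \<le> T powr a * exp (- T) * (S + T ^ N / pochhammer a N + 1 / T)"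
proof -
  define f where "f t = t powr (a - 1) / exp t" for t
  define G where "G t = (\<Sum>k<N. exp (- t) * t powr (a + real k) / pochhammer a (Suc k))" for t
  define g where "g t = f t - exp (- t) * t powr (a + real N - 1) / pochhammer a N" for t
  define c where "c = exp (- T) * T powr (a + real N - 1) / pochhammer a N"
  have poch: "pochhammer a k > 0" for k using a by (simp add: pochhammer_pos)
  have deriv: "(G has_real_derivative g t) (at t)" if "t > 0" for t
  proof -
    have "(G has_real_derivative (\<Sum>k<N. exp (- t) * t powr (a + real k - 1) / pochhammer a k
             - exp (- t) * t powr (a + real (Suc k) - 1) / pochhammer a (Suc k))) (at t)"
      unfolding G_def
    proof (rule DERIV_sum)
      fix k
      have "((\<lambda>t. exp (- t) * t powr (a + real k) / pochhammer a (Suc k)) has_real_derivative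
         (- exp (- t) * t powr (a + real k) + exp (- t) * ((a + real k) * t powr (a + real k - 1))) / pochhammer a (Suc k)) (at t)"
        by (rule DERIV_cdivide) (use that in \<open>auto intro!: derivative_eq_intros simp: algebra_simps\<close>)
      also have "(- exp (- t) * t powr (a + real k) + exp (- t) * ((a + real k) * t powr (a + real k - 1))) / pochhammer a (Suc k)
          = exp (- t) * t powr (a + real k - 1) / pochhammer a k
             - exp (- t) * t powr (a + real (Suc k) - 1) / pochhammer a (Suc k)"
      proof -
        have *: "(- E * P + E * (q * R)) / (p * q) = E * R / p - E * P / (p * q)" if "q \<noteq> 0" "p \<noteq> 0" for E P q R p :: real
          using that by (simp add: field_simps)
        have "a + real (Suc k) - 1 = a + real k" "a + real k \<noteq> 0" using a by simp_all
        thus ?thesis using poch[of k] by (simp only: pochhammer_Suc) (subst *, auto)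
      qed
      finally show "((\<lambda>t. exp (- t) * t powr (a + real k) / pochhammer a (Suc k)) has_real_derivative
          exp (- t) * t powr (a + real k - 1) / pochhammer a k
             - exp (- t) * t powr (a + real (Suc k) - 1) / pochhammer a (Suc k)) (at t)" .
    qed
    also have "(\<Sum>k<N. exp (- t) * t powr (a + real k - 1) / pochhammer a k
             - exp (- t) * t powr (a + real (Suc k) - 1) / pochhammer a (Suc k)) = g t"
      using sum_lessThan_telescope'[of "\<lambda>k. exp (- t) * t powr (a + real k - 1) / pochhammer a k" N]
      by (simp add: g_def f_def exp_minus field_simps)
    finally show ?thesis .
  qed
  have "(g has_integral G T - G 0) {0..T}"
  proof (rule fundamental_theorem_of_calculus_interior)
    show "continuous_on {0..T} G"
      unfolding G_def using a less_imp_neq[OF poch]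
      by (intro continuous_on_sum continuous_on_divide continuous_on_mult continuous_on_powr' continuous_intros) auto
    show "(G has_vector_derivative g t) (at t)" if "t \<in> {0<..<T}" for t
      using deriv[of t] that by (simp add: has_real_derivative_iff_has_vector_derivative)
  qed (use T in simp)
  moreover have "G 0 = 0" using a by (simp add: G_def)
  ultimately have g: "(g has_integral G T) {0..T}" by simp
  have GT: "G T = T powr a * exp (- T) * S"
    using T by (simp add: G_def S_def sum_distrib_left powr_add powr_realpow mult_ac)
  have f: "(f has_integral Gamma a) {0..}" unfolding f_def by (rule Gamma_integral_real[OF a(1)])

  have l: "((\<lambda>t. if t \<in> {0..T} then g t else 0) has_integral G T) {0..}"
    using g by (subst has_integral_restrict) auto
  have "(if t \<in> {0..T} then g t else 0) \<le> f t" if "t \<in> {0..}" for t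
    using poch[of N] by (auto simp: g_def f_def)
  from has_integral_le[OF l f this] show "T powr a * exp (- T) * S \<le> Gamma a" by (simp only: GT)

  have "((\<lambda>t. g t + c) has_integral G T + T * c) {0..T}"
    using has_integral_add[OF g has_integral_const_real[of c 0 T]] T by simp
  hence 1: "((\<lambda>t. if t \<le> T then g t + c else T powr (a - 1) * exp (- t)) has_integral G T + T * c) {0..T}"
    by (rule has_integral_eq[rotated]) auto
  have "((\<lambda>t. T powr (a - 1) * exp (- 1 * t)) has_integral T powr (a - 1) * (exp (- 1 * T) / 1)) {T..}"
    by (intro has_integral_mult_right has_integral_exp_minus_to_infinity) simp
  hence "((\<lambda>t. T powr (a - 1) * exp (- t)) has_integral T powr (a - 1) * exp (- T)) {T..}" by simp
  hence 2: "((\<lambda>t. if t \<le> T then g t + c else T powr (a - 1) * exp (- t)) has_integral T powr (a - 1) * exp (- T)) {T..}"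
    by (rule has_integral_spike[of "{T}", rotated 2]) auto
  have "((\<lambda>t. if t \<le> T then g t + c else T powr (a - 1) * exp (- t)) has_integral
          (G T + T * c) + T powr (a - 1) * exp (- T)) ({0..T} \<union> {T..})"
    by (rule has_integral_Un[OF 1 2]) (use T in \<open>auto intro!: negligible_subset[of "{T}"]\<close>)
  also have "{0..T} \<union> {T..} = {0..}" using T by auto
  finally have u: "((\<lambda>t. if t \<le> T then g t + c else T powr (a - 1) * exp (- t)) has_integral
          (G T + T * c) + T powr (a - 1) * exp (- T)) {0..}" .
  have "f t \<le> (if t \<le> T then g t + c else T powr (a - 1) * exp (- t))" if "t \<in> {0..}" for t
  proof (cases "t \<le> T")
    case True
    have "exp (- t) * t powr (a + real N - 1) / pochhammer a N \<le> c"
      unfolding c_def using that True T poch[of N] by (intro divide_right_mono exp_minus_powr_mono) auto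
    thus ?thesis using True by (simp add: g_def)
  next
    case False
    have "t powr (a - 1) \<le> T powr (a - 1)" using False T a by (intro powr_mono2') auto
    thus ?thesis using False by (simp add: f_def exp_minus field_simps)
  qed
  hence "Gamma a \<le> (G T + T * c) + T powr (a - 1) * exp (- T)" by (rule has_integral_le[OF f u])
  also have "\<dots> = T powr a * exp (- T) * (S + T ^ N / pochhammer a N + 1 / T)"
    using T poch[of N] by (simp add: GT c_def powr_diff powr_add powr_realpow field_simps)
  finally show "Gamma a \<le> T powr a * exp (- T) * (S + T ^ N / pochhammer a N + 1 / T)" .
qed

lemma power_div_fact_le_exp:
  fixes x :: real
  assumes "x \<ge> 0"
  shows "x ^ n / fact n \<le> exp x"
proof -
  have s: "(\<lambda>n. x ^ n / fact n) sums exp x"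
    using exp_converges[of x] by (simp add: field_simps)
  have "(\<Sum>k\<in>{n}. x ^ k / fact k) \<le> exp x"
    unfolding sums_unique[OF s] using assms s by (intro sum_le_suminf) (auto simp: sums_iff)
  thus ?thesis by simp
qed

lemma pochhammer_ge_fact: "a \<ge> 0 \<Longrightarrow> a * fact n \<le> pochhammer (a::real) (Suc n)"
proof (induction n)
  case (Suc n)
  have "a * fact (Suc n) = (a * fact n) * (real n + 1)" by simp
  also have "\<dots> \<le> pochhammer a (Suc n) * (a + real (Suc n))"
    using Suc order_trans[OF _ Suc.IH, of 0] by (intro mult_mono) auto
  also have "\<dots> = pochhammer a (Suc (Suc n))" by (simp only: pochhammer_Suc[of a "Suc n"])
  finally show ?case .
qed simp

lemma fact_ge_power: "(real n / (272 / 100)) ^ n \<le> fact n"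
proof -
  have "real n ^ n / fact n \<le> exp 1 ^ n"
    using power_div_fact_le_exp[of "real n" n] exp_of_nat_mult[of n "1 :: real"] by simp
  also have "\<dots> \<le> (272 / 100) ^ n" using e_less_272 by (intro power_mono) auto
  finally show ?thesis by (simp add: power_divide field_simps)
qed

text \<open>The Pochhammer symbol is at least n! / (4 n), and n! >= (n / 2.72)^n. Weakening 2.72 to
  3 leaves the factor (272/300)^n to absorb 4 n.\<close>

lemma power_le_pochhammer:
  assumes "n > 0" "4 * real n * (272 / 300) ^ n \<le> 1"
  shows "(real n / 3) ^ n \<le> pochhammer (1 / 4) n"
proof -
  have "(real n / 3) ^ n = (272 / 300) ^ n * (real n / (272 / 100)) ^ n"
    by (simp flip: power_mult_distrib)
  also have "\<dots> \<le> (272 / 300) ^ n * fact n" by (intro mult_left_mono fact_ge_power) auto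
  also have "\<dots> \<le> 1 / (4 * real n) * fact n"
    using assms by (intro mult_right_mono) (auto simp: field_simps)
  also have "\<dots> = 1 / 4 * fact (n - 1)" using assms(1) by (simp add: fact_reduce[of n])
  also have "\<dots> \<le> pochhammer (1 / 4) n" using pochhammer_ge_fact[of "1/4" "n - 1"] assms(1) by simp
  finally show ?thesis .
qed

text \<open>The length 768 = 3 * 256 is what turns n / 3 into 256; hence 768 terms of the Gamma
  series leave a remainder of at most 1.\<close>

lemma pow_256_768_le_pochhammer: "256 ^ 768 \<le> pochhammer (1 / 4 :: real) 768"
proof -
  have "((272 / 300) ^ 768 :: real) = ((272 / 300) ^ 8) ^ 96"
    by (simp only: power_mult[symmetric]) simp
  also have "\<dots> \<le> (1 / 2) ^ 96" by (intro power_mono) (simp_all add: power_divide)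
  also have "\<dots> \<le> 1 / (4 * 768)" by (simp add: power_divide)
  finally have "4 * real 768 * (272 / 300) ^ 768 \<le> 1" by linarith
  from power_le_pochhammer[OF _ this] show ?thesis by simp
qed

text \<open>This series and the next two are written as sums of running products of ratios (a i + b)
  / (c i + d), the form that the Horner loop evaluates. The slack 2 covers the truncation remainder,
  at most 1, and the tail 1/256.\<close>

lemma Gamma_quarter_bounds:
  fixes N :: nat
  assumes N: "N > 256" "256 ^ N \<le> pochhammer (1 / 4 :: real) N"
  defines "S \<equiv> 4 * (\<Sum>k<N. \<Prod>i<k. 1024 / (4 * real i + 5))"
  shows "4 * exp (- 256) * S \<le> Gamma (1 / 4)" "Gamma (1 / 4) \<le> 4 * exp (- 256) * (S + 2)"
proof -
  have "256 ^ k / pochhammer (1 / 4) (Suc k) = 4 * (\<Prod>i<k. 1024 / (4 * real i + 5))" for k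
  proof (induction k)
    case (Suc k)
    have "256 ^ Suc k / pochhammer (1 / 4) (Suc (Suc k)) =
        256 ^ k / pochhammer (1 / 4) (Suc k) * (256 / (1 / 4 + real (Suc k)))"
      by (simp add: pochhammer_Suc[of "1/4" "Suc k"])
    also have "256 / (1 / 4 + real (Suc k)) = 1024 / (4 * real k + 5)" by (simp add: field_simps)
    finally show ?case by (simp add: Suc)
  qed simp
  hence S: "(\<Sum>k<N. 256 ^ k / pochhammer (1 / 4) (Suc k)) = S" by (simp add: S_def sum_distrib_left)
  have root: "(256 :: real) powr (1 / 4) = 4"
  proof -
    have "(256 :: real) powr (1 / 4) = (4 powr 4) powr (1 / 4)" by simp
    also have "\<dots> = 4" by (subst powr_powr) simp
    finally show ?thesis .
  qed
  have N': "(256 :: real) \<le> 1 / 4 + real N - 1" using N(1) by linarith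
  show "4 * exp (- 256) * S \<le> Gamma (1 / 4)"
    using Gamma_incomplete_series(1)[OF _ _ _ N'] S root by simp
  have "256 ^ N / pochhammer (1 / 4 :: real) N \<le> 1"
    using N(2) pochhammer_pos[of "1/4 :: real" N] by (simp add: divide_le_eq_1)
  moreover have "Gamma (1 / 4) \<le> 4 * exp (- 256) * (S + 256 ^ N / pochhammer (1 / 4) N + 1 / 256)"
    using Gamma_incomplete_series(2)[OF _ _ _ N'] S root by simp
  ultimately have "Gamma (1 / 4) \<le> 4 * exp (- 256) * (S + 256 ^ N / pochhammer (1 / 4) N + 1 / 256)"
    "S + 256 ^ N / pochhammer (1 / 4) N + 1 / 256 \<le> S + 2" by simp_all
  thus "Gamma (1 / 4) \<le> 4 * exp (- 256) * (S + 2)"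
    by (elim order_trans) (intro mult_left_mono, auto)
qed

lemma exp_1_bounds:
  fixes n :: nat
  defines "S \<equiv> \<Sum>k<n. \<Prod>i<k. 1 / (real i + 1)"
  shows "S \<le> exp 1" "exp 1 \<le> S + 3 / fact n"
proof -
  have "(\<Prod>i<k. 1 / (real i + 1)) = 1 / fact k" for k
  proof (induction k)
    case (Suc k)
    show ?case by (simp only: prod.lessThan_Suc Suc fact_Suc) (simp add: add.commute mult.commute)
  qed simp
  hence S: "S = (\<Sum>k<n. 1 / fact k)" by (simp add: S_def)
  obtain t :: real where t: "\<bar>t\<bar> \<le> 1" "exp 1 = (\<Sum>k<n. 1 ^ k / fact k) + exp t / fact n * 1 ^ n"
    using Maclaurin_exp_le[of 1 n] by auto
  have "exp t \<le> exp 1" using t(1) by simp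
  also have "\<dots> \<le> 3" using e_less_272 by simp
  finally have *: "exp t / fact n \<le> 3 / fact n" by (simp add: divide_right_mono)
  show "S \<le> exp 1" using t(2) by (simp add: S)
  show "exp 1 \<le> S + 3 / fact n" using t(2) * by (simp only: S power_one mult_1_right)
qed

text \<open>It rests on 80 / 2.72 > 29, 29^2 > 800 and 2^10 > 10^3, so the factorial itself is never
  evaluated.\<close>

lemma fact_80_ge: "10 ^ 116 \<le> (fact 80 :: real)"
proof -
  have "(10 :: real) ^ 116 = (10 ^ 3) ^ 12 * 100 ^ 40" by (simp only: power_mult[symmetric] power_add[symmetric]) simp
  also have "\<dots> \<le> (2 ^ 10) ^ 12 * 100 ^ 40" by (intro mult_right_mono power_mono) simp_all
  also have "\<dots> = (8 * 100) ^ 40" unfolding power_mult_distrib by (simp only: power_mult[symmetric]) simp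
  also have "\<dots> \<le> (29\<^sup>2) ^ 40" by (intro power_mono) simp_all
  also have "\<dots> = 29 ^ 80" by (simp only: power_mult[symmetric]) simp
  also have "\<dots> \<le> (real 80 / (272 / 100)) ^ 80" by (intro power_mono) simp_all
  also have "\<dots> \<le> fact 80" by (rule fact_ge_power)
  finally show ?thesis .
qed

text \<open>In ln x = 2 artanh((x - 1) / (x + 1)) the argument at x = 2 + sqrt 3 is 1 / sqrt 3. The
  running product telescopes to 1 / (3^k (2 k + 1)).\<close>

lemma ln_2_plus_sqrt_3_bounds:
  fixes n :: nat
  defines "S \<equiv> \<Sum>k<n. \<Prod>i<k. (2 * real i + 1) / (6 * real i + 9)"
  shows "2 / sqrt 3 * S \<le> ln (2 + sqrt 3)" "ln (2 + sqrt 3) \<le> 2 / sqrt 3 * (S + 2 / 3 ^ n)"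
proof -
  define y where "y = (2 + sqrt 3 - 1) / (2 + sqrt 3 + 1)"
  have y: "y = 1 / sqrt 3"
  proof -
    have "(2 + sqrt 3 - 1) * sqrt 3 = 2 + sqrt 3 + 1" by (simp add: algebra_simps)
    moreover have "2 + sqrt 3 + 1 > 0" by (simp add: add_pos_pos)
    ultimately show ?thesis unfolding y_def by (simp add: frac_eq_eq)
  qed
  have pow: "y ^ (2 * k + 1) = 1 / sqrt 3 / 3 ^ k" for k
    by (simp add: y power_divide power_mult)
  have summand: "2 * y ^ (2 * k + 1) / real (2 * k + 1) = 2 / sqrt 3 * (\<Prod>i<k. (2 * real i + 1) / (6 * real i + 9))" for k
  proof -
    have "(\<Prod>i<k. (2 * real i + 1) / (6 * real i + 9)) = 1 / (3 ^ k * (2 * real k + 1))"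
    proof (induction k)
      case (Suc k)
      have "6 * real k + 9 = 3 * (2 * real (Suc k) + 1)" by simp
      moreover have "2 * real k + 1 > 0" "2 * real (Suc k) + 1 > 0" by (simp_all add: add_nonneg_pos)
      ultimately show ?case by (simp only: prod.lessThan_Suc Suc power_Suc) (simp del: of_nat_Suc)
    qed simp
    thus ?thesis by (simp only: pow) (simp add: add.commute)
  qed
  have sum: "(\<Sum>k<n. 2 * y ^ (2 * k + 1) / real (2 * k + 1)) = 2 / sqrt 3 * S"
    by (simp only: summand S_def sum_distrib_left)
  have b: "ln (2 + sqrt 3) \<in> {2 / sqrt 3 * S..2 / sqrt 3 * S + 2 * (y ^ (2 * n + 1) / (1 - y\<^sup>2) / real (2 * n + 1))}"
    using ln_approx_bounds[of "2 + sqrt 3" n] sum by (simp only: y_def) (simp add: add_pos_pos)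
  show "2 / sqrt 3 * S \<le> ln (2 + sqrt 3)" using b by simp
  have "2 * (y ^ (2 * n + 1) / (1 - y\<^sup>2) / real (2 * n + 1)) = 2 / sqrt 3 * (3 / 2 / 3 ^ n / (2 * real n + 1))"
    by (simp only: pow) (simp add: y power_divide)
  also have "\<dots> \<le> 2 / sqrt 3 * (2 / 3 ^ n)"
  proof (intro mult_left_mono)
    have "3 / 2 / 3 ^ n / (2 * real n + 1) \<le> 3 / 2 / 3 ^ n / 1" by (intro divide_left_mono) auto
    also have "3 / 2 / 3 ^ n / 1 \<le> (2 :: real) / 3 ^ n" unfolding div_by_1 by (intro divide_right_mono) auto
    finally show "3 / 2 / 3 ^ n / (2 * real n + 1) \<le> 2 / (3 :: real) ^ n" .
  qed simp
  finally show "ln (2 + sqrt 3) \<le> 2 / sqrt 3 * (S + 2 / 3 ^ n)" using b by (simp add: distrib_left)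
qed

section \<open>Arithmetic in base 4\<close>

text \<open>
  Digits are listed from the least significant one; \<open>C0\<close> adds a digit 0 unless the number is 0, so that
  numbers do not accumulate leading zeros.  Rewriting with the
  equations below is an order of magnitude faster than rewriting binary numerals, which would make the
  evaluations at the end infeasible.
\<close>

datatype quat = QE | Q0 quat | Q1 quat | Q2 quat | Q3 quat

primrec qval :: "quat \<Rightarrow> nat" where
  "qval QE = 0"
| "qval (Q0 x) = 4 * qval x"
| "qval (Q1 x) = 4 * qval x + 1"
| "qval (Q2 x) = 4 * qval x + 2"
| "qval (Q3 x) = 4 * qval x + 3"

fun C0 :: "quat \<Rightarrow> quat" where
  "C0 QE = QE"
| "C0 (Q0 x) = Q0 (Q0 x)"
| "C0 (Q1 x) = Q0 (Q1 x)"
| "C0 (Q2 x) = Q0 (Q2 x)"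
| "C0 (Q3 x) = Q0 (Q3 x)"

fun inc :: "quat \<Rightarrow> quat" where
  "inc QE = Q1 QE"
| "inc (Q0 x) = Q1 x"
| "inc (Q1 x) = Q2 x"
| "inc (Q2 x) = Q3 x"
| "inc (Q3 x) = Q0 (inc x)"

fun dec :: "quat \<Rightarrow> quat" where
  "dec QE = QE"
| "dec (Q0 x) = Q3 (dec x)"
| "dec (Q1 x) = C0 x"
| "dec (Q2 x) = Q1 x"
| "dec (Q3 x) = Q2 x"

fun add :: "quat \<Rightarrow> quat \<Rightarrow> quat" where
  "add QE y = y"
| "add x QE = x"
| "add (Q0 x) (Q0 y) = Q0 (add x y)"
| "add (Q0 x) (Q1 y) = Q1 (add x y)"
| "add (Q0 x) (Q2 y) = Q2 (add x y)"
| "add (Q0 x) (Q3 y) = Q3 (add x y)"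
| "add (Q1 x) (Q0 y) = Q1 (add x y)"
| "add (Q1 x) (Q1 y) = Q2 (add x y)"
| "add (Q1 x) (Q2 y) = Q3 (add x y)"
| "add (Q1 x) (Q3 y) = Q0 (inc (add x y))"
| "add (Q2 x) (Q0 y) = Q2 (add x y)"
| "add (Q2 x) (Q1 y) = Q3 (add x y)"
| "add (Q2 x) (Q2 y) = Q0 (inc (add x y))"
| "add (Q2 x) (Q3 y) = Q1 (inc (add x y))"
| "add (Q3 x) (Q0 y) = Q3 (add x y)"
| "add (Q3 x) (Q1 y) = Q0 (inc (add x y))"
| "add (Q3 x) (Q2 y) = Q1 (inc (add x y))"
| "add (Q3 x) (Q3 y) = Q2 (inc (add x y))"

fun sub :: "quat \<Rightarrow> quat \<Rightarrow> quat" where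
  "sub x QE = x"
| "sub QE y = QE"
| "sub (Q0 x) (Q0 y) = C0 (sub x y)"
| "sub (Q0 x) (Q1 y) = Q3 (dec (sub x y))"
| "sub (Q0 x) (Q2 y) = Q2 (dec (sub x y))"
| "sub (Q0 x) (Q3 y) = Q1 (dec (sub x y))"
| "sub (Q1 x) (Q0 y) = Q1 (sub x y)"
| "sub (Q1 x) (Q1 y) = C0 (sub x y)"
| "sub (Q1 x) (Q2 y) = Q3 (dec (sub x y))"
| "sub (Q1 x) (Q3 y) = Q2 (dec (sub x y))"
| "sub (Q2 x) (Q0 y) = Q2 (sub x y)"
| "sub (Q2 x) (Q1 y) = Q1 (sub x y)"
| "sub (Q2 x) (Q2 y) = C0 (sub x y)"
| "sub (Q2 x) (Q3 y) = Q3 (dec (sub x y))"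
| "sub (Q3 x) (Q0 y) = Q3 (sub x y)"
| "sub (Q3 x) (Q1 y) = Q2 (sub x y)"
| "sub (Q3 x) (Q2 y) = Q1 (sub x y)"
| "sub (Q3 x) (Q3 y) = C0 (sub x y)"

text \<open>Scanning starts at the least significant digit, so \<open>b\<close> carries the verdict
  on the digits passed so far, and every later unequal pair overrides it. The initial value decides
  ties: \<open>True\<close> for <=, \<open>False\<close> for <.\<close>

fun cmp :: "bool \<Rightarrow> quat \<Rightarrow> quat \<Rightarrow> bool" where
  "cmp b QE QE = b"
| "cmp b QE (Q0 y) = cmp b QE y"
| "cmp b (Q0 x) QE = cmp b x QE"
| "cmp b QE (Q1 y) = True"
| "cmp b (Q1 x) QE = False"
| "cmp b QE (Q2 y) = True"
| "cmp b (Q2 x) QE = False"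
| "cmp b QE (Q3 y) = True"
| "cmp b (Q3 x) QE = False"
| "cmp b (Q0 x) (Q0 y) = cmp b x y"
| "cmp b (Q0 x) (Q1 y) = cmp True x y"
| "cmp b (Q0 x) (Q2 y) = cmp True x y"
| "cmp b (Q0 x) (Q3 y) = cmp True x y"
| "cmp b (Q1 x) (Q0 y) = cmp False x y"
| "cmp b (Q1 x) (Q1 y) = cmp b x y"
| "cmp b (Q1 x) (Q2 y) = cmp True x y"
| "cmp b (Q1 x) (Q3 y) = cmp True x y"
| "cmp b (Q2 x) (Q0 y) = cmp False x y"
| "cmp b (Q2 x) (Q1 y) = cmp False x y"
| "cmp b (Q2 x) (Q2 y) = cmp b x y"
| "cmp b (Q2 x) (Q3 y) = cmp True x y"
| "cmp b (Q3 x) (Q0 y) = cmp False x y"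
| "cmp b (Q3 x) (Q1 y) = cmp False x y"
| "cmp b (Q3 x) (Q2 y) = cmp False x y"
| "cmp b (Q3 x) (Q3 y) = cmp b x y"

text \<open>\<open>y2\<close> and \<open>y3\<close> hold 2 y and 3 y, computed once for all digits.
  Auxiliary functions such as \<open>mul1\<close> serve as let bindings: an argument used several
  times is normalised before it is copied.\<close>

fun mul_aux :: "quat \<Rightarrow> quat \<Rightarrow> quat \<Rightarrow> quat \<Rightarrow> quat" where
  "mul_aux QE y y2 y3 = QE"
| "mul_aux (Q0 x) y y2 y3 = C0 (mul_aux x y y2 y3)"
| "mul_aux (Q1 x) y y2 y3 = add y (C0 (mul_aux x y y2 y3))"
| "mul_aux (Q2 x) y y2 y3 = add y2 (C0 (mul_aux x y y2 y3))"
| "mul_aux (Q3 x) y y2 y3 = add y3 (C0 (mul_aux x y y2 y3))"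

fun mul1 :: "quat \<Rightarrow> quat \<Rightarrow> quat \<Rightarrow> quat" where
  "mul1 x y y2 = mul_aux x y y2 (add y y2)"

fun mul :: "quat \<Rightarrow> quat \<Rightarrow> quat" where
  "mul x y = mul1 x y (add y y)"

text \<open>Long division finds each quotient digit by bisection: the current remainder
  \<open>v\<close>, less than 4 m, is compared with 2 m and then with m. The outcome is matched as a
  Boolean argument, so only the branch taken is unfolded.\<close>

fun div_lo :: "bool \<Rightarrow> quat \<Rightarrow> quat \<Rightarrow> quat \<Rightarrow> quat \<times> quat" where
  "div_lo True m q v = (C0 q, v)"
| "div_lo False m q v = (Q1 q, sub v m)"

fun div_hi :: "bool \<Rightarrow> quat \<Rightarrow> quat \<Rightarrow> quat \<Rightarrow> quat \<times> quat" where
  "div_hi True m q v = (Q2 q, v)"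
| "div_hi False m q v = (Q3 q, sub v m)"

fun div_hi' :: "quat \<Rightarrow> quat \<Rightarrow> quat \<Rightarrow> quat \<times> quat" where
  "div_hi' m q v = div_hi (cmp False v m) m q v"

fun div_digit :: "bool \<Rightarrow> quat \<Rightarrow> quat \<Rightarrow> quat \<Rightarrow> quat \<Rightarrow> quat \<times> quat" where
  "div_digit True m m2 q v = div_lo (cmp False v m) m q v"
| "div_digit False m m2 q v = div_hi' m q (sub v m2)"

fun div_step' :: "quat \<Rightarrow> quat \<Rightarrow> quat \<Rightarrow> quat \<Rightarrow> quat \<times> quat" where
  "div_step' m m2 q v = div_digit (cmp False v m2) m m2 q v"

fun div_step :: "quat \<Rightarrow> quat \<Rightarrow> (quat \<Rightarrow> quat) \<Rightarrow> quat \<times> quat \<Rightarrow> quat \<times> quat" where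
  "div_step m m2 f (q, r) = div_step' m m2 q (f r)"

primrec divmod_aux :: "quat \<Rightarrow> quat \<Rightarrow> quat \<Rightarrow> quat \<times> quat" where
  "divmod_aux m m2 QE = (QE, QE)"
| "divmod_aux m m2 (Q0 x) = div_step m m2 C0 (divmod_aux m m2 x)"
| "divmod_aux m m2 (Q1 x) = div_step m m2 Q1 (divmod_aux m m2 x)"
| "divmod_aux m m2 (Q2 x) = div_step m m2 Q2 (divmod_aux m m2 x)"
| "divmod_aux m m2 (Q3 x) = div_step m m2 Q3 (divmod_aux m m2 x)"

fun pos :: "quat \<Rightarrow> bool" where
  "pos QE = False"
| "pos (Q0 x) = pos x"
| "pos (Q1 x) = True"
| "pos (Q2 x) = True"
| "pos (Q3 x) = True"

text \<open>The \<open>False\<close> cases here and in \<open>diff_le\<close> reproduce the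
  conventions of \<open>nat\<close>: division by zero gives 0, and subtraction is truncated.\<close>

fun div_pos :: "bool \<Rightarrow> quat \<Rightarrow> quat \<Rightarrow> nat" where
  "div_pos False x y = qval QE"
| "div_pos True x y = qval (fst (divmod_aux y (add y y) x))"

fun diff_le :: "bool \<Rightarrow> quat \<Rightarrow> quat \<Rightarrow> nat" where
  "diff_le False x y = qval QE"
| "diff_le True x y = qval (sub x y)"

fun of_num :: "num \<Rightarrow> quat" where
  "of_num num.One = Q1 QE"
| "of_num (num.Bit0 num.One) = Q2 QE"
| "of_num (num.Bit1 num.One) = Q3 QE"
| "of_num (num.Bit0 (num.Bit0 n)) = Q0 (of_num n)"
| "of_num (num.Bit1 (num.Bit0 n)) = Q1 (of_num n)"
| "of_num (num.Bit0 (num.Bit1 n)) = Q2 (of_num n)"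
| "of_num (num.Bit1 (num.Bit1 n)) = Q3 (of_num n)"

lemma qval_C0 [simp]: "qval (C0 x) = 4 * qval x"
  by (cases x) auto

lemma qval_inc [simp]: "qval (inc x) = qval x + 1"
  by (induction x) auto

lemma qval_dec: "qval x > 0 \<Longrightarrow> qval (dec x) = qval x - 1"
  by (induction x) auto

lemma qval_add [simp]: "qval (add x y) = qval x + qval y"
  by (induction x y rule: add.induct) auto

lemma qval_sub: "qval y \<le> qval x \<Longrightarrow> qval (sub x y) = qval x - qval y"
  by (induction x y rule: sub.induct) (auto simp: qval_dec)

lemma cmp_iff: "cmp b x y \<longleftrightarrow> (if b then qval x \<le> qval y else qval x < qval y)"
  by (induction b x y rule: cmp.induct) auto

lemma qval_mul_aux:
  "qval y2 = 2 * qval y \<Longrightarrow> qval y3 = 3 * qval y \<Longrightarrow> qval (mul_aux x y y2 y3) = qval x * qval y"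
  by (induction x) (auto simp: algebra_simps)

lemma qval_mul: "qval (mul x y) = qval x * qval y"
  by (simp add: qval_mul_aux)

lemma pos_iff: "pos x \<longleftrightarrow> qval x > 0"
  by (induction x rule: pos.induct) auto

lemma div_step_correct:
  assumes "qval m2 = 2 * qval m" "qval (f r) < 4 * qval m"
  shows "case div_step m m2 f (q, r) of (q', r') \<Rightarrow>
           4 * qval q * qval m + qval (f r) = qval q' * qval m + qval r' \<and> qval r' < qval m"
  using assms
  by (cases "cmp False (f r) m2"; cases "cmp False (f r) m"; cases "cmp False (sub (f r) m2) m")
     (auto simp: cmp_iff qval_sub algebra_simps)

lemma divmod_aux_digit:
  assumes "qval m2 = 2 * qval m" "\<And>r. qval (f r) = 4 * qval r + k" "k < 4"
    and "case p of (q, r) \<Rightarrow> X = qval q * qval m + qval r \<and> qval r < qval m"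
  shows "case div_step m m2 f p of (q, r) \<Rightarrow> 4 * X + k = qval q * qval m + qval r \<and> qval r < qval m"
proof -
  obtain q r where p: "p = (q, r)" by fastforce
  have X: "X = qval q * qval m + qval r" "qval r < qval m" using assms(4) p by auto
  have "qval (f r) < 4 * qval m" using assms(2)[of r] assms(3) X(2) by linarith
  from div_step_correct[of m2 m f r q, OF assms(1) this] show ?thesis
    using assms(2)[of r] X(1) p by (simp del: div_step.simps add: algebra_simps)
qed

lemma divmod_aux_correct:
  assumes "qval m2 = 2 * qval m" "qval m > 0"
  shows "case divmod_aux m m2 x of (q, r) \<Rightarrow> qval x = qval q * qval m + qval r \<and> qval r < qval m"
proof (induction x)
  case QE
  show ?case using assms by simp
next
  case (Q0 x)
  show ?case using divmod_aux_digit[OF assms(1) _ _ Q0, of C0 0] by simp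
next
  case (Q1 x)
  show ?case using divmod_aux_digit[OF assms(1) _ _ Q1, of Q1 1] by simp
next
  case (Q2 x)
  show ?case using divmod_aux_digit[OF assms(1) _ _ Q2, of Q2 2] by simp
next
  case (Q3 x)
  show ?case using divmod_aux_digit[OF assms(1) _ _ Q3, of Q3 3] by simp
qed

lemma numeral_eq_qval: "numeral n = qval (of_num n)"
  proof (induction n rule: of_num.induct)
qed (simp_all only: of_num.simps qval.simps numeral.simps, simp_all del: numeral_plus_numeral numeral_plus_one add_numeral_left one_plus_numeral)

lemma nat_zero_qval: "(0::nat) = qval QE" by simp
lemma nat_one_qval: "(1::nat) = qval (Q1 QE)" by simp
lemma plus_qval: "qval x + qval y = qval (add x y)" by simp
lemma minus_qval: "qval x - qval y = diff_le (cmp True y x) x y"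
  by (cases "cmp True y x") (auto simp: cmp_iff qval_sub)
lemma times_qval: "qval x * qval y = qval (mul x y)" by (simp only: qval_mul)
lemma less_qval: "qval x < qval y \<longleftrightarrow> cmp False x y" by (simp add: cmp_iff)
lemma le_qval: "qval x \<le> qval y \<longleftrightarrow> cmp True x y" by (simp add: cmp_iff)

lemma div_qval: "qval x div qval y = div_pos (pos y) x y"
proof (cases "pos y")
  case True
  hence y: "qval y > 0" by (simp add: pos_iff)
  from divmod_aux_correct[OF _ y, of "add y y" x]
  have "qval x = qval (fst (divmod_aux y (add y y) x)) * qval y + qval (snd (divmod_aux y (add y y) x))"
       "qval (snd (divmod_aux y (add y y) x)) < qval y" by (auto simp: case_prod_beta)
  hence "qval x div qval y = qval (fst (divmod_aux y (add y y) x))"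
    by (intro div_nat_eqI) (auto simp: algebra_simps)
  thus ?thesis using True by simp
qed (auto simp: pos_iff)

text \<open>There is no rule for equality: two numbers are recognised as equal when their normal
  forms coincide, which is why leading zeros must be avoided.\<close>

lemmas quat_eval =
  nat_zero_qval nat_one_qval numeral_eq_qval plus_qval minus_qval times_qval div_qval less_qval le_qval
  fst_conv C0.simps inc.simps dec.simps add.simps sub.simps cmp.simps
  mul_aux.simps mul1.simps mul.simps div_lo.simps div_hi.simps div_hi'.simps div_digit.simps
  div_step'.simps div_step.simps divmod_aux.simps pos.simps div_pos.simps diff_le.simps of_num.simps

section \<open>Certified loops\<close>

text \<open>Recursion on the binary representation of the count spares arithmetic on a loop
  counter.\<close>

fun iter :: "num \<Rightarrow> ('a \<Rightarrow> 'a) \<Rightarrow> 'a \<Rightarrow> 'a" where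
  "iter num.One f x = f x"
| "iter (num.Bit0 n) f x = iter n f (iter n f x)"
| "iter (num.Bit1 n) f x = iter n f (iter n f (f x))"

lemma iter_eq_funpow: "iter n f = f ^^ numeral n"
  by (induction n) (simp_all only: fun_eq_iff iter.simps numeral.simps funpow_add o_apply funpow_0 funpow.simps One_nat_def id_apply simp_thms)

text \<open>The flag collects the inequalities \<open>a \<le> t * b\<close> for
  \<open>t = a div b\<close>; each of them says that the division was exact.\<close>

fun coeff_check'' :: "nat \<Rightarrow> nat \<Rightarrow> nat \<Rightarrow> nat \<Rightarrow> nat \<Rightarrow> bool \<Rightarrow> nat \<times> nat \<times> nat \<times> bool" where
  "coeff_check'' j a b t d ok = (j + 1, t, d + t, ok \<and> a \<le> t * b)"

fun coeff_check' :: "nat \<Rightarrow> nat \<Rightarrow> nat \<Rightarrow> nat \<Rightarrow> bool \<Rightarrow> nat \<times> nat \<times> nat \<times> bool" where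
  "coeff_check' j a b d ok = coeff_check'' j a b (a div b) d ok"

fun coeff_check :: "nat \<Rightarrow> nat \<times> nat \<times> nat \<times> bool \<Rightarrow> nat \<times> nat \<times> nat \<times> bool" where
  "coeff_check n (j, t, d, ok) = coeff_check' j (2 * (n * n - j * j) * t) ((2 * j + 1) * (j + 1)) d ok"

definition div_by :: "nat \<Rightarrow> nat \<Rightarrow> nat" where
  "div_by m x = x div m"

fun div_chain :: "(num \<times> nat) list \<Rightarrow> nat \<Rightarrow> nat list" and div_chain' :: "(num \<times> nat) list \<Rightarrow> nat \<Rightarrow> nat list" where
  "div_chain [] x = []"
| "div_chain ((k, m) # ks) x = div_chain' ks (iter k (div_by m) x)"
| "div_chain' ks x = x # div_chain ks x"

text \<open>The divisors accumulate to m^2, m^4, m^8, ..., m^128, using m^2 twice and then m^4 once,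
  2, 4, 8 and 16 times. As nested floor divisions compose, this yields the floors of x / m^s without
  ever forming a large power, and the quotients shrink along the way.\<close>

definition pow_divs' :: "nat \<Rightarrow> nat \<Rightarrow> nat \<Rightarrow> nat list" where
  "pow_divs' m2 m4 x = div_chain [(num.One, m2), (num.One, m2), (num.One, m4), (num.Bit0 num.One, m4),
      (num.Bit0 (num.Bit0 num.One), m4), (num.Bit0 (num.Bit0 (num.Bit0 num.One)), m4),
      (num.Bit0 (num.Bit0 (num.Bit0 (num.Bit0 num.One))), m4)] x"

definition pow_divs'' :: "nat \<Rightarrow> nat \<Rightarrow> nat list" where
  "pow_divs'' m2 x = pow_divs' m2 (m2 * m2) x"

definition pow_divs :: "nat \<Rightarrow> nat \<Rightarrow> nat list" where
  "pow_divs m x = pow_divs'' (m * m) x"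

fun list_add :: "nat list \<Rightarrow> nat list \<Rightarrow> nat list" where
  "list_add (x # xs) (y # ys) = (x + y) # list_add xs ys"
| "list_add xs ys = []"

text \<open>The sign alternates by exchanging the two accumulators in every step. After an even
  number of steps the first one holds the terms with even index, the positive ones.\<close>

fun alt_step' :: "nat \<Rightarrow> nat \<Rightarrow> nat \<Rightarrow> nat \<Rightarrow> nat \<Rightarrow> nat list \<Rightarrow> nat list \<Rightarrow> nat \<times> nat \<times> nat \<times> nat \<times> nat list \<times> nat list" where
  "alt_step' q j t c m A B = (j + 1, t, c, m + q, B, list_add A (pow_divs m c))"

fun alt_step :: "nat \<Rightarrow> nat \<Rightarrow> nat \<times> nat \<times> nat \<times> nat \<times> nat list \<times> nat list \<Rightarrow> nat \<times> nat \<times> nat \<times> nat \<times> nat list \<times> nat list" where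
  "alt_step n q (j, t, c, m, A, B) =
     alt_step' q j (2 * (n * n - j * j) * t div ((2 * j + 1) * (j + 1))) (c - t) m A B"

fun list_diff :: "nat list \<Rightarrow> nat list \<Rightarrow> nat list" where
  "list_diff (x # xs) (y # ys) = (x - y) # list_diff xs ys"
| "list_diff xs ys = []"

fun alt_result :: "nat \<times> nat \<times> nat \<times> nat \<times> nat list \<times> nat list \<Rightarrow> nat list" where
  "alt_result (j, t, c, m, A, B) = list_diff A B"

lemmas loop_eval = quat_eval iter.simps coeff_check''.simps coeff_check'.simps coeff_check.simps
  div_by_def div_chain.simps div_chain'.simps pow_divs'_def pow_divs''_def pow_divs_def
  list_add.simps alt_step'.simps alt_step.simps list_diff.simps alt_result.simps simp_thms

section \<open>Correctness of the loops for Chebyshev coefficients and alternating sums\<close>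

primrec cheb_coeff :: "nat \<Rightarrow> nat \<Rightarrow> nat" where
  "cheb_coeff n 0 = 1"
| "cheb_coeff n (Suc j) = 2 * (n * n - j * j) * cheb_coeff n j div ((2 * j + 1) * (j + 1))"

lemma coeff_check_funpow:
  "(coeff_check n ^^ m) (0, 1, 1, True) =
     (m, cheb_coeff n m, \<Sum>i\<le>m. cheb_coeff n i,
      \<forall>j<m. 2 * (n * n - j * j) * cheb_coeff n j \<le> cheb_coeff n (Suc j) * ((2 * j + 1) * (j + 1)))"
proof (induction m)
  case (Suc m)
  show ?case
    unfolding funpow.simps o_apply Suc by (auto simp: less_Suc_eq add.commute simp del: mult_Suc)
qed simp

lemma cheb_coeffs_cheb_coeff:
  assumes "\<And>j. j < n \<Longrightarrow> 2 * (n * n - j * j) * cheb_coeff n j \<le> cheb_coeff n (Suc j) * ((2 * j + 1) * (j + 1))"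
  shows "cheb_coeffs n (\<lambda>j. real (cheb_coeff n j))"
  unfolding cheb_coeffs_def
proof (intro conjI allI impI)
  fix j assume j: "j < n"
  have "cheb_coeff n (Suc j) * ((2 * j + 1) * (j + 1)) = 2 * (n * n - j * j) * cheb_coeff n j"
    using assms[OF j] div_times_less_eq_dividend[of "2 * (n * n - j * j) * cheb_coeff n j" "(2 * j + 1) * (j + 1)"]
    unfolding cheb_coeff.simps by (rule antisym[rotated])
  hence "real (cheb_coeff n (Suc j)) * real ((2 * j + 1) * (j + 1)) = real (2 * (n * n - j * j)) * real (cheb_coeff n j)"
    by (simp only: of_nat_mult[symmetric])
  moreover have "j * j \<le> n * n" using j by (intro mult_le_mono) auto
  hence "real (2 * (n * n - j * j)) = 2 * ((real n)\<^sup>2 - (real j)\<^sup>2)" by (simp add: of_nat_diff power2_eq_square)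
  moreover have "real ((2 * j + 1) * (j + 1)) = (2 * real j + 1) * (real j + 1)" by (simp add: algebra_simps)
  ultimately show "real (cheb_coeff n (Suc j)) * ((2 * real j + 1) * (real j + 1)) =
      real (cheb_coeff n j) * (2 * ((real n)\<^sup>2 - (real j)\<^sup>2))" by (simp only: mult.commute)
qed simp

lemma real_div_nat_bounds:
  assumes "d > 0"
  shows "real (n div d) \<le> real n / real d" "real n / real d \<le> real (n div d) + 1"
proof -
  have "real n = real d * real (n div d) + real (n mod d)"
    by (simp flip: of_nat_mult of_nat_add)
  moreover have "0 \<le> real (n mod d)" "real (n mod d) \<le> real d" using assms by (auto simp: less_imp_le)
  ultimately show "real (n div d) \<le> real n / real d" "real n / real d \<le> real (n div d) + 1"
    using assms by (simp_all add: field_simps)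
qed

definition expos :: "nat list" where "expos = [2, 4, 8, 16, 32, 64, 128]"

lemma div_by_funpow: "(div_by m ^^ k) x = x div m ^ k"
proof (induction k)
  case (Suc k)
  thus ?case by (simp add: div_by_def div_mult2_eq[symmetric] mult.commute)
qed simp

lemma pow_divs_eq: "pow_divs m x = map (\<lambda>s. x div m ^ s) expos"
  by (simp add: pow_divs_def pow_divs''_def pow_divs'_def iter_eq_funpow div_by_funpow expos_def div_by_def
      div_mult2_eq[symmetric] power_add[symmetric] power_mult_distrib power2_eq_square[symmetric]
      power_mult[symmetric] numeral.simps[symmetric] add_numeral_left)

lemma list_add_map: "list_add (map f xs) (map g xs) = map (\<lambda>x. f x + g x) xs"
  by (induction xs) auto

lemma list_diff_map: "list_diff (map f xs) (map g xs) = map (\<lambda>x. f x - g x) xs"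
  by (induction xs) auto

definition alt_quot :: "nat \<Rightarrow> nat \<Rightarrow> nat \<Rightarrow> nat \<Rightarrow> nat \<Rightarrow> nat \<Rightarrow> nat" where
  "alt_quot n d q r s j = (d - (\<Sum>i\<le>j. cheb_coeff n i)) div (q * j + r) ^ s"

lemma alt_step_funpow:
  "(alt_step n q ^^ m) (0, 1, d, r, map (\<lambda>_. 0) expos, map (\<lambda>_. 0) expos) =
     (m, cheb_coeff n m, d - (\<Sum>i<m. cheb_coeff n i), q * m + r,
      map (\<lambda>s. \<Sum>j<m. if even (m + j) then alt_quot n d q r s j else 0) expos,
      map (\<lambda>s. \<Sum>j<m. if odd (m + j) then alt_quot n d q r s j else 0) expos)"
proof (induction m)
  case (Suc m)
  have "d - (\<Sum>i<m. cheb_coeff n i) - cheb_coeff n m = d - (\<Sum>i\<le>m. cheb_coeff n i)"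
    by (simp flip: lessThan_Suc_atMost)
  thus ?case
    unfolding funpow.simps o_apply Suc alt_step.simps alt_step'.simps pow_divs_eq list_add_map
    by (auto simp: alt_quot_def add.commute)
qed simp

text \<open>Each of the \<open>n\<close> floor divisions costs at most 1, and the acceleration costs
  1 more. The guard \<open>l > 0\<close> excludes the case where the truncated difference of the two
  accumulators hides a negative value.\<close>

lemma alt_sum_approx:
  assumes n: "n > 0" "even n" and q: "q > 0" and r: "r > 0"
    and t: "cheb_coeffs n (\<lambda>j. real (cheb_coeff n j))"
    and d: "d = (\<Sum>i\<le>n. cheb_coeff n i)"
    and F: "\<And>s. s \<in> set expos \<Longrightarrow> (\<lambda>j. (-1) ^ j / real (q * j + r) ^ s) sums F s"
  shows "list_all2 (\<lambda>s l. l > 0 \<longrightarrow> \<bar>real d * F s - real l\<bar> \<le> real n + 1) expos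
           (alt_result ((alt_step n q ^^ n) (0, 1, d, r, map (\<lambda>_. 0) expos, map (\<lambda>_. 0) expos)))"
proof -
  let ?A = "\<lambda>s. \<Sum>j<n. if even (n + j) then alt_quot n d q r s j else 0"
  let ?B = "\<lambda>s. \<Sum>j<n. if odd (n + j) then alt_quot n d q r s j else 0"
  have "\<bar>real d * F s - real (?A s - ?B s)\<bar> \<le> real n + 1" if s: "s \<in> set expos" and pos: "?A s - ?B s > 0" for s
  proof -
    define c where "c j = real d - (\<Sum>i\<le>j. real (cheb_coeff n i))" for j
    define x where "x j = c j / real (q * j + r) ^ s" for j
    have err: "\<bar>x j - real (alt_quot n d q r s j)\<bar> \<le> 1" if j: "j < n" for j
    proof -
      have "(\<Sum>i\<le>j. cheb_coeff n i) \<le> d" unfolding d using j by (intro sum_mono2) auto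
      hence "c j = real (d - (\<Sum>i\<le>j. cheb_coeff n i))" by (simp add: c_def of_nat_diff)
      hence "x j = real (d - (\<Sum>i\<le>j. cheb_coeff n i)) / real ((q * j + r) ^ s)" by (simp add: x_def)
      thus ?thesis
        using real_div_nat_bounds[of "(q * j + r) ^ s" "d - (\<Sum>i\<le>j. cheb_coeff n i)"] r
        by (simp add: alt_quot_def abs_le_iff)
    qed
    have "real (?A s - ?B s) = real (?A s) - real (?B s)" using pos by (simp add: of_nat_diff)
    also have "\<dots> = (\<Sum>j<n. (-1) ^ j * real (alt_quot n d q r s j))"
      unfolding of_nat_sum sum_subtractf[symmetric] using n(2) by (intro sum.cong) auto
    finally have "\<bar>(\<Sum>j<n. (-1) ^ j * x j) - real (?A s - ?B s)\<bar> = \<bar>\<Sum>j<n. (-1) ^ j * (x j - real (alt_quot n d q r s j))\<bar>"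
      by (simp add: sum_subtractf right_diff_distrib)
    also have "\<dots> \<le> (\<Sum>j<n. \<bar>(-1) ^ j * (x j - real (alt_quot n d q r s j))\<bar>)" by (rule sum_abs)
    also have "\<dots> \<le> (\<Sum>j<n. 1)" using err by (intro sum_mono) (simp add: abs_mult)
    finally have "\<bar>(\<Sum>j<n. (-1) ^ j * x j) - real (?A s - ?B s)\<bar> \<le> real n" by simp
    moreover have "\<bar>real d * F s - (\<Sum>j<n. (-1) ^ j * c j / real (q * j + r) ^ s)\<bar> \<le> 1"
      by (rule accel_sums[OF t n(1) q r _ _ _ _ F[OF s]]) (use s in \<open>auto simp: d c_def expos_def intro!: sum_nonneg\<close>)
    moreover have "(\<Sum>j<n. (-1) ^ j * c j / real (q * j + r) ^ s) = (\<Sum>j<n. (-1) ^ j * x j)"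
      by (simp add: x_def)
    ultimately show ?thesis by linarith
  qed
  thus ?thesis
    unfolding alt_step_funpow alt_result.simps list_diff_map by (auto simp: list_all2_map2 list_all2_same)
qed

section \<open>Horner evaluation of series whose term ratios are rational\<close>

fun horner_step' :: "nat \<Rightarrow> nat \<Rightarrow> nat \<Rightarrow> nat \<Rightarrow> nat \<Rightarrow> nat \<Rightarrow> nat \<Rightarrow> nat \<times> nat" where
  "horner_step' w a b c d k h = (k, w + (a * k + b) * h div (c * k + d))"

fun horner_step :: "nat \<Rightarrow> nat \<Rightarrow> nat \<Rightarrow> nat \<Rightarrow> nat \<Rightarrow> nat \<times> nat \<Rightarrow> nat \<times> nat" where
  "horner_step w a b c d (k, h) = horner_step' w a b c d (k - 1) h"

text \<open>Evaluation proceeds from the innermost bracket, so the induction needs the series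
  started at an arbitrary offset \<open>m\<close>. Every intermediate value is at least
  \<open>w\<close>, hence each floor costs a relative error of at most 1 / w.\<close>

lemma horner_step_bounds:
  fixes a b c d w :: nat and S :: "nat \<Rightarrow> nat \<Rightarrow> real"
  assumes w: "w > 0" and d: "d > 0"
  defines "S \<equiv> \<lambda>m n. \<Sum>k<n. \<Prod>i<k. (a * real (m + i) + b) / (c * real (m + i) + d)"
  shows "\<exists>h. (horner_step w a b c d ^^ n) (m + n, 0) = (m, h) \<and>
             real h \<le> w * S m n \<and> w * S m n \<le> real h * (1 + n / w)"
proof (induction n arbitrary: m)
  case 0
  show ?case by (simp add: S_def)
next
  case (Suc n)
  obtain h where h: "(horner_step w a b c d ^^ n) (Suc m + n, 0) = (Suc m, h)"
    "real h \<le> w * S (Suc m) n" "w * S (Suc m) n \<le> real h * (1 + n / w)"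
    using Suc[of "Suc m"] by blast
  define r where "r = (a * real m + b) / (c * real m + d)"
  define y where "y = r * real h"
  define h' where "h' = w + (a * m + b) * h div (c * m + d)"
  have r: "r \<ge> 0" by (simp add: r_def)
  have S: "S m (Suc n) = 1 + r * S (Suc m) n"
    unfolding S_def sum.lessThan_Suc_shift prod.lessThan_Suc_shift by (simp add: r_def sum_distrib_left)
  have y: "y = real ((a * m + b) * h) / real (c * m + d)" by (simp add: y_def r_def)
  have fl: "real h' \<le> w + y" "w + y \<le> real h' + 1"
    using real_div_nat_bounds[of "c * m + d" "(a * m + b) * h"] d unfolding h'_def y of_nat_add[of w] by simp_all
  have "real h' \<le> w + r * (w * S (Suc m) n)"
    using fl(1) mult_left_mono[OF h(2) r] by (simp add: y_def)
  hence 1: "real h' \<le> w * S m (Suc n)" by (simp add: S algebra_simps)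
  have "w * S m (Suc n) \<le> w + y * (1 + n / w)"
    using mult_left_mono[OF h(3) r] by (simp add: S y_def algebra_simps)
  also have "\<dots> \<le> w + (real h' + 1 - w) * (1 + n / w)"
    using fl(2) by (intro add_left_mono mult_right_mono) auto
  \<comment> \<open>The summand \<open>- n\<close> arises because the exact leading term
    \<open>w\<close> carries no error; it absorbs \<open>n / w\<close>, so the relative errors add
    up instead of compounding.\<close>
  also have "\<dots> = real h' * (1 + n / w) + 1 - n + n / w" using w by (simp add: field_simps)
  also have "\<dots> \<le> real h' * (1 + n / w) + 1"
  proof -
    have "n / w \<le> n / 1" using w by (intro divide_left_mono) auto
    thus ?thesis by simp
  qed
  also have "\<dots> \<le> real h' * (1 + n / w) + real h' / w" using w by (simp add: h'_def)
  also have "\<dots> = real h' * (1 + Suc n / w)" using w by (simp add: field_simps)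
  finally have "w * S m (Suc n) \<le> real h' * (1 + Suc n / w)" .
  moreover have "(horner_step w a b c d ^^ Suc n) (m + Suc n, 0) = (m, h')" using h(1) by (simp add: h'_def)
  ultimately show ?case using 1 by blast
qed

lemma horner_bounds:
  fixes a b c d w :: nat and S :: real
  assumes "(horner_step w a b c d ^^ n) (n, 0) = (0, h)" "w > 0" "d > 0"
  defines "S \<equiv> \<Sum>k<n. \<Prod>i<k. (a * real i + b) / (c * real i + d)"
  shows "real h \<le> w * S" "w * S \<le> real h * (1 + n / w)"
  using horner_step_bounds[OF assms(2,3), where n = n and m = 0 and a = a and b = b and c = c] assms(1)
  by (auto simp: S_def)

section \<open>Powers, loop counts and certificate checks\<close>

fun square :: "nat \<Rightarrow> nat" where
  "square y = y * y"

fun pow_num :: "nat \<Rightarrow> num \<Rightarrow> nat" where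
  "pow_num x num.One = x"
| "pow_num x (num.Bit0 n) = square (pow_num x n)"
| "pow_num x (num.Bit1 n) = x * square (pow_num x n)"

text \<open>The exponent, like the count of \<open>iterate\<close>, is an \<open>int\<close>:
  numerals of type \<open>nat\<close> would be rewritten to \<open>qval\<close> terms, whereas these
  remain available as a \<open>num\<close> for \<open>pow_num\<close> and
  \<open>iter\<close>.\<close>

definition pow :: "nat \<Rightarrow> int \<Rightarrow> nat" where
  "pow x k = x ^ nat k"

lemma pow_num_eq: "pow_num x n = x ^ numeral n"
  by (induction n) (simp_all only: pow_num.simps square.simps power_numeral_even power_numeral_odd Let_def power_one_right numeral_One mult.assoc)

lemma pow_numeral: "pow x (numeral n) = pow_num x n"
  by (simp add: pow_def pow_num_eq)

definition iterate :: "int \<Rightarrow> ('a \<Rightarrow> 'a) \<Rightarrow> 'a \<Rightarrow> 'a" where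
  "iterate k f = f ^^ nat k"

lemma iterate_numeral: "iterate (numeral n) f = iter n f"
  by (simp add: iterate_def iter_eq_funpow)

text \<open>The ratio of \<open>x\<close> and \<open>y\<close> is confined to within 1 + 1/k both
  ways, without division. In all uses \<open>k\<close> is a power of 4, so multiplying by it is a
  shift of digits.\<close>

fun close_scaled :: "nat \<Rightarrow> nat \<Rightarrow> nat \<Rightarrow> bool" where
  "close_scaled k x y \<longleftrightarrow> k * x \<le> (k + 1) * y \<and> k * y \<le> (k + 1) * x"

text \<open>One row treats one exponent s, with z = 2^s. The entry \<open>f\<close> is tied to
  X(s)^2 / X(2 s) twice: through the next entry, and through the relation of Euler products with the
  table values in place of the alternating sums. The final entry must equal \<open>w\<close>,
  standing for X(256) = 1.\<close>

fun check_X :: "nat \<Rightarrow> nat \<Rightarrow> nat \<Rightarrow> ((nat \<times> nat) \<times> nat) list \<Rightarrow> nat list \<Rightarrow> bool" where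
  "check_X k w z (((c, d), f) # tab) (x # x2 # xs) \<longleftrightarrow>
     close_scaled k (x * x) (f * x2) \<and>
     close_scaled k (f * ((c + d) * ((z + 1) * (z - 2)))) (w * ((c - d) * ((z - 1) * (z + 2)))) \<and>
     check_X k w (square z) tab (x2 # xs)"
| "check_X k w z [] [x] \<longleftrightarrow> x \<le> w \<and> w \<le> x"
| "check_X k w z tab xs \<longleftrightarrow> False"

text \<open>Eliminating \<open>t\<close> and \<open>r\<close> from the last three conditions leaves
  g^2 (a + b) (a - b) (z^2 - 4) = w^2 (c + d) (c - d) (z^2 - 1), up to the tolerance: the relation
  at 7 mod 12 with g / w for Y(s)^2 / Y(2 s).\<close>

fun check_Y :: "nat \<Rightarrow> nat \<Rightarrow> nat \<Rightarrow>
    ((nat \<times> nat) \<times> (nat \<times> nat) \<times> nat \<times> nat \<times> nat) list \<Rightarrow> nat list \<Rightarrow> bool" where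
  "check_Y k w z (((c, d), (a, b), (g, t, r)) # tab) (y # y2 # ys) \<longleftrightarrow>
     close_scaled k (y * y) (g * y2) \<and> close_scaled k (g * (a + b)) (t * (c + d)) \<and>
     close_scaled k (t * (a - b)) (r * (c - d)) \<and>
     close_scaled k ((square z - 4) * (r * g)) ((square z - 1) * square w) \<and>
     check_Y k w (square z) tab (y2 # ys)"
| "check_Y k w z [] [y] \<longleftrightarrow> y \<le> w \<and> w \<le> y"
| "check_Y k w z tab ys \<longleftrightarrow> False"

text \<open>Positivity discharges the guard of \<open>alt_sum_approx\<close>; the gap keeps the
  differences \<open>c - d\<close> large, so that their absolute errors are small relative
  errors.\<close>

fun check_gap :: "nat \<Rightarrow> nat list \<Rightarrow> nat list \<Rightarrow> bool" where
  "check_gap b (c # cs) (d # ds) \<longleftrightarrow> 0 < d \<and> b + d \<le> c \<and> check_gap b cs ds"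
| "check_gap b [] [] \<longleftrightarrow> True"
| "check_gap b cs ds \<longleftrightarrow> False"

text \<open>Successive squarings with a fixed number of leading digits; \<open>j\<close> is the
  power of ten cut off after each squaring.\<close>

fun check_squares :: "nat \<Rightarrow> nat \<Rightarrow> nat list \<Rightarrow> nat list \<Rightarrow> bool" where
  "check_squares k m (e # e2 # es) (j # js) \<longleftrightarrow> close_scaled k (square e) (e2 * j) \<and> check_squares k m (e2 # es) js"
| "check_squares k m [e] [] \<longleftrightarrow> e \<le> m \<and> m \<le> e"
| "check_squares k m es js \<longleftrightarrow> False"

section \<open>Numerical evaluation\<close>

text \<open>The value of the Chebyshev polynomial of degree 140 at 3.\<close>

definition cheb_total :: nat where
  "cheb_total = 75190314080366684868397746853187801033285557223268124207108037662276098218628914899758932622712489673065537"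

text \<open>\<open>tab_q_r\<close> approximates \<open>cheb_total * alt_sum q r s\<close> for \<open>s = 2, 4, ..., 128\<close>.\<close>

definition tab_3_1 :: "nat list" where
  "tab_3_1 = [
    71544915724812583973099416678287001417404582828988655901843676326091219252447957790345347532989759059118024,
    74922258999976490914543214104947169429494783297923782443040843084877021325433725693727809292902452298361818,
    75189179136403658604917158392049839652707291166618321844111495600001070463867724091245774974100260833368196,
    75190314062862330758991012393855893485936476512709791482047314477785624848477543884867040205897480097574827,
    75190314080366684864321671827477795639223579787333303119568725893618734499419681281236186364833263158829343,
    75190314080366684868397746853187801033064592749673062918802636170140665243663343800856303358249734894991406,
    75190314080366684868397746853187801033285557223268124207108037662276098218628265543532824084884713619761606]"

definition tab_3_2 :: "nat list" where
  "tab_3_2 = [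
    16574645001340124470368182868530349811552988586243656210031648757976136281400230454238316748405835040864253,
    4593670462380173239454212542825545651277548905116821571749027746332946877807909962025279067289509065355083,
    293523850499388875816695173727970657640987838278490691833635428396630236062663353599222717054353943425425,
    1147312649593722939153538067904223735651838721198465376972599621467338183071146981535679867703568962413,
    17506609223865162280310654412652143603828494997215325626890825404978730155254176102740840040705341,
    4076075093790048658559370240588828879761962438527052693505062117679993029304446995687230,
    220964473595061349948908421049523575639119017548699264986896223479401]"

definition tab_6_1 :: "nat list" where
  "tab_6_1 = [
    73966316348462350445919695214933026671950299803003505220140730904669517333018013919443213230465155240936819,
    75161190750448119819146579514634145173515582529336502075735379045483249817733633834540671565983279344500955,
    75190301125533530373903752470690117660538563586702432006784723698305111694682888060179420496969180750521233,
    75190314080364422456804258215670754775602414922249480268350011606298907373795087785642458719588687859648187,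
    75190314080366684868397746785107006205055274257813589618062630533344347542678630281962049862110283142155408,
    75190314080366684868397746853187801033285557223268124145464530725842976976956873944819204474292917786734344,
    75190314080366684868397746853187801033285557223268124207108037662276098218628914899758932622712489673065536]"

definition tab_6_5 :: "nat list" where
  "tab_6_5 = [
    2557839999309635827704331666725419803100089055510821517680194391417592225647645105325935976480906510073738,
    115873683940206968945491257553135052798904493952519161393106283645469603425773703003938366915778727785337,
    192146378363786336305203866863288002734190463085484576973650557651663344938378296888734141483087780332,
    492765607529990040855280791460873721997725746439793370179913189646489324699311250581365498802249,
    3229399399475820335776799811636715514496512942483649349061764705001140732381164956018,
    138701648066236399862587798991933730008660578216970637216944267,
    255859380447959419]"

text \<open>
  All remaining tables are scaled by \<open>10^107\<close>, except \<open>tab_exp\<close>, which contains the leading 113 digits of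
  \<open>exp (2^i)\<close>.  With \<open>a\<close>, \<open>b\<close>, \<open>c\<close>, \<open>d\<close> for the entries of \<open>tab_6_1\<close>, \<open>tab_6_5\<close>, \<open>tab_3_1\<close>,
  \<open>tab_3_2\<close>: \<open>F = X(s)^2 / X(2s)\<close>, \<open>G = Y(s)^2 / Y(2s)\<close>, \<open>T = G (a + b) / (c + d)\<close> and
  \<open>R = T (a - b) / (c - d)\<close>.  The auxiliary quotients keep the products to be evaluated short.
\<close>

definition tab_X :: "nat list" where
  "tab_X = [
    106054829316911072817412636430987203493077130204487163127994372181794608024406637459031614387685633565015466,
    100168885398559067275170088161137297249065797084087806907962772379876101265905611432056292850079587480739485,
    100000256482995458217949082556532519082878785470110589926840456785521206744841388519046067896676786051115564,
    100000000000655362178367386236484714497797094959881687296903294728683357321499784850442510349998841979800012,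
    100000000000000000000004294967296047362482978918385003075319890210176985671091050354582069647196986936938707,
    100000000000000000000000000000000000000000000184467440737095516160022432007933033499577317497658968871928328,
    100000000000000000000000000000000000000000000000000000000000000000000000000000000000000000340282366920938463,
    100000000000000000000000000000000000000000000000000000000000000000000000000000000000000000000000000000000000]"

definition tab_Y :: "nat list" where
  "tab_Y = [
    102620214683123370070720186696636157236110932131334951481040066496546032939386454192999178263867916092605165,
    100042581563980611755042351989514470935753951516970430325188469565176171495645905062662708462289584842852087,
    100000017352669738664436240509574921758019650663590874791814917315464572004531774849410696779249373918677538,
    100000000000003009063895725812205318372234936201845086993620208999265504339443483953468813860767036667625136,
    100000000000000000000000000090544634412987030707607660494744161694514223584717355510786377939590910260630226,
    100000000000000000000000000000000000000000000000000000081983308209812575954296616129518766390595779865485746,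
    100000000000000000000000000000000000000000000000000000000000000000000000000000000000000000000000000000000000,
    100000000000000000000000000000000000000000000000000000000000000000000000000000000000000000000000000000000000]"

definition tab_F :: "nat list" where
  "tab_F = [
    112286632487586188669515047845488616820034334772438342384197101669112437478762892300742100845934872469968815,
    100337798670504992153180097837638977613616158937843311393352294460238490424705281628236048608369822500223875,
    100000512965993386165337872828073426078633654658754610827915394529316690607804688213417925503795096821265603,
    100000000001310724356734772501521669795652294553341644435382077592784460624775080356732569952564852146549890,
    100000000000000000000008589934592094724965957836770006154708186729374348170512230109777846528352989874969112,
    100000000000000000000000000000000000000000000368934881474191032320044864015866066999154634995317937743856657,
    100000000000000000000000000000000000000000000000000000000000000000000000000000000000000000680564733841876926]"

definition tab_G :: "nat list" where
  "tab_G = [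
    105264261447266406989265021915738835956137466811318347099248234734683636532732949927753453362405225703936600,
    100085163892409186208615002873773117544296447645171754480938318201172071798224207875187941511044272465352671,
    100000034705339479415403040971519674538555044153797098573619046277753804675290187597593805395495206016664638,
    100000000000006018127791451624410657617083408891020088268847307654507661730655453558573697001510705448743291,
    100000000000000000000000000181089268825974061415215320989488323389030623764062902772313124243964336700095480,
    100000000000000000000000000000000000000000000000000000163966616419625151908593232259037532781191559730971492,
    100000000000000000000000000000000000000000000000000000000000000000000000000000000000000000000000000000000001]"

definition tab_T :: "nat list" where
  "tab_T = [
    91412834272478033205047173761913331341883658423089306586106774950533988135642245625239505449174296885927677,
    94749786391189709156452505208575995591096529454220833254067913988217007085531425254915795299123892981026791,
    99612913146570938725028562207009423552409846425968840347710046341968512116929733816866533727104174628817187,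
    99998474168969157693398882851875442471176220124158625460413066606713375925337757812341590808085682910189251,
    99999999976716935645463648763771334549096435462024300282270093608876452509107291323019257123762142386700316,
    99999999999999999994578989137572477830550483539996316670982770642165824747835122169152559216345182520509956,
    99999999999999999999999999999999999999706126412294428123007815865694438580547060844517997689112623185679881]"

definition tab_R :: "nat list" where
  "tab_R = [
    118748755067854140792881285042057793015745014148179821865801576472003485036767413766917301682427754522252511,
    101104371772079233286201998859917461458902211213486921187284092208990312013016267186677719214800724091779338,
    100004543209216360853998250436216535729873253800252329173497910720502774325953092366216208000955636228564701,
    100000000069843175033417364205652007708001285439822490133464610806860850322196574044583105167587566276621835,
    100000000000000000016263032406193297687664213620850060733262630367620240989959891777273983162196046881970800,
    100000000000000000000000000000000000000881620763116715467009935983291532349781130310807646192044903936037324,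
    100000000000000000000000000000000000000000000000000000000000000000000000000002590850566528333387615905558839]"

definition tab_exp :: "nat list" where
  "tab_exp = [
    27182818284590452353602874713526624977572470936999595749669676277240766303535475945713821785251664274274663919320,
    73890560989306502272304274605750078131803155705518473240871278225225737960790577633843124850791217947737531612654,
    54598150033144239078110261202860878402790737038614068725826593958553662099935869481676980561944734142784115445771,
    29809579870417282747435920994528886737559679391328357022089635303877307251733675301573718714900181394246875041909,
    88861105205078726367630237407814503508027198218566388397839883170489809373214781504432221066858377072072820363454,
    78962960182680695160978022635108224219956195115352330655080020598754307854019888979038912604674262714833727050864,
    62351490808116168829092387089284697448313918462357999143885916990139847762868302695988544031276980033424886838413,
    38877084059945950922226736883574780727281750630829988857729684183082856273225377615246235498310754065395719880594,
    15114276650041035425200896657072865075062408982871207163163511142269980302984834833205536225206818387558476262106]"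

text \<open>Unlike the other constants, the two series values carry the scale 10^112.\<close>

definition series_Gamma :: nat where
  "series_Gamma = 3424904448624738141353208811383469513298612818286092392680953517048010242208523990729978118597482896342185202740873578109316320647231646056415625559449141321484666350632824361962225771741127127416942017080823769176355693363"

definition series_ln :: nat where
  "series_ln = 11405189944514195212966413823206087363024415964207646405308560053900826839823661295426875471977310200728890035153"

text \<open>The last entry of \<open>tab_exp\<close>; its value is about
  \<open>10 * exp 256\<close>.\<close>

definition approx_exp_256 :: nat where
  "approx_exp_256 = 15114276650041035425200896657072865075062408982871207163163511142269980302984834833205536225206818387558476262106"

definition approx_sqrt3 :: nat where
  "approx_sqrt3 = 173205080756887729352744634150587236694280525381038062805580697945193301690880003708114618675724857567562614"

definition approx_Gamma :: nat where
  "approx_Gamma = 362560990822190831193068515586767200299516768288006546743337799956991924353872912161836013672338430036147175"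

definition approx_alpha :: nat where
  "approx_alpha = 63890940544534388225494267492824509375497550802912334542169236570807631002764965824689717911252866438814165"

definition approx_beta :: nat where
  "approx_beta = 30231614235706563794776990048019971560241279518936964545886784128886544875241051089948746781397927270856774"

lemmas check_eval = loop_eval pow_numeral pow_num.simps square.simps iterate_numeral close_scaled.simps
  check_X.simps check_Y.simps check_squares.simps check_gap.simps zip_Cons_Cons zip_Nil list.sel(1) horner_step'.simps horner_step.simps
  tab_3_1_def tab_3_2_def tab_6_1_def tab_6_5_def tab_X_def tab_Y_def tab_F_def tab_G_def tab_T_def tab_R_def tab_exp_def series_Gamma_def series_ln_def
  approx_exp_256_def approx_sqrt3_def approx_Gamma_def approx_alpha_def approx_beta_def cheb_total_def

text \<open>The final coefficient, 2 * 4^139 = 2^139 * 2^140, is the absolute leading coefficient of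
  T(1 - 2 x) in degree 140.\<close>

lemma coeff_check_140: "iterate 140 (coeff_check 140) (0, 1, 1, True) = (140, 2 * pow 4 139, cheb_total, True)"
  by (simp only: check_eval)

lemma alt_result_3_1:
  "alt_result (iterate 140 (alt_step 140 3) (0, 1, cheb_total, 1, [0, 0, 0, 0, 0, 0, 0], [0, 0, 0, 0, 0, 0, 0])) = tab_3_1"
  by (simp only: check_eval)

lemma alt_result_3_2:
  "alt_result (iterate 140 (alt_step 140 3) (0, 1, cheb_total, 2, [0, 0, 0, 0, 0, 0, 0], [0, 0, 0, 0, 0, 0, 0])) = tab_3_2"
  by (simp only: check_eval)

lemma alt_result_6_1:
  "alt_result (iterate 140 (alt_step 140 6) (0, 1, cheb_total, 1, [0, 0, 0, 0, 0, 0, 0], [0, 0, 0, 0, 0, 0, 0])) = tab_6_1"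
  by (simp only: check_eval)

lemma alt_result_6_5:
  "alt_result (iterate 140 (alt_step 140 6) (0, 1, cheb_total, 5, [0, 0, 0, 0, 0, 0, 0], [0, 0, 0, 0, 0, 0, 0])) = tab_6_5"
  by (simp only: check_eval)

lemma horner_Gamma: "iterate 768 (horner_step (pow 10 112) 0 1024 4 5) (768, 0) = (0, series_Gamma)"
  by (simp only: check_eval)

lemma horner_exp: "iterate 80 (horner_step (pow 10 112) 0 1 1 1) (80, 0) = (0, hd tab_exp)"
  by (simp only: check_eval)

lemma horner_ln: "iterate 232 (horner_step (pow 10 112) 2 1 6 9) (232, 0) = (0, series_ln)"
  by (simp only: check_eval)

lemma check_gap_tabs: "check_gap (3 * pow 10 106) tab_3_1 tab_3_2" "check_gap (3 * pow 10 106) tab_6_1 tab_6_5"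
  by (simp_all only: check_eval)

lemma check_tab_X: "check_X (pow 4 175) (pow 10 107) 4 (zip (zip tab_3_1 tab_3_2) tab_F) tab_X"
  by (simp only: check_eval)

lemma check_tab_Y: "check_Y (pow 4 175) (pow 10 107) 4
    (zip (zip tab_3_1 tab_3_2) (zip (zip tab_6_1 tab_6_5) (zip tab_G (zip tab_T tab_R)))) tab_Y"
  by (simp only: check_eval)

lemma check_exp: "check_squares (pow 4 184) approx_exp_256 tab_exp
    [pow 10 112, pow 10 113, pow 10 113, pow 10 112, pow 10 113, pow 10 113, pow 10 113, pow 10 113]"
  by (simp only: check_eval)

text \<open>The literal approximates alpha^2, scaled by 10^107; the second check is alpha^4 = (4/27)
  X(2)^2.\<close>

lemma check_alpha:
  "close_scaled (pow 4 175) (square approx_alpha) (40820522836652281486212213895693122623533448574907818723137707407211531018880264803855344509204339383262001 * pow 10 107)"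
  "close_scaled (pow 4 175) (27 * square 40820522836652281486212213895693122623533448574907818723137707407211531018880264803855344509204339383262001) (4 * square (hd tab_X))"
  by (simp_all only: check_eval)

text \<open>In order of appearance and scaled by 10^107, the literals are p = X(2) Y(2); p^2; l1 =
  (2 pi^2 / 27) S with S the series behind \<open>series_ln\<close>; l2 = l1 sqrt 3; l3 = l2 p^2; v
  = beta Gamma(1/4); and v^2. Since ln(2 + sqrt 3) = (2 / sqrt 3) S, the definition of beta gives
  v^4 = (27/32) l3.\<close>

lemma check_beta:
  "close_scaled (pow 4 175) (square approx_sqrt3) (3 * square (pow 10 107))"
  "close_scaled (pow 4 175) (10000 * (approx_Gamma * approx_exp_256)) (16 * series_Gamma)"
  "close_scaled (pow 4 175) (hd tab_X * hd tab_Y) (108833693526834205267357750595702506998134086696217528435428021628450497515027072827551361593558934744340056 * pow 10 107)"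
  "close_scaled (pow 4 175) (square 108833693526834205267357750595702506998134086696217528435428021628450497515027072827551361593558934744340056) (118447728466928735934874725386949485747611337139947258335482075383768086034923372861537352182165620947220910 * pow 10 107)"
  "close_scaled (pow 4 175) ((hd tab_3_1 - hd tab_3_2) * series_ln) (83381268793805480668039454563622226399302158278544479805577599516932172973527442001312506649990131625460175 * (cheb_total * 100000))"
  "close_scaled (pow 4 175) (83381268793805480668039454563622226399302158278544479805577599516932172973527442001312506649990131625460175 * approx_sqrt3) (144420593950428409914405218571170290654918204802564866412468101194236656338423630195860634527947144860898610 * pow 10 107)"
  "close_scaled (pow 4 175) (144420593950428409914405218571170290654918204802564866412468101194236656338423630195860634527947144860898610 * 118447728466928735934874725386949485747611337139947258335482075383768086034923372861537352182165620947220910) (171062912972729151572513258701201121254094590196466491371633072120986189161207876132533833837005983574765130 * pow 10 107)"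
  "close_scaled (pow 4 175) (square 109608040114520211556962847838921212291441073431958404586122353963211424637170321627396405904943890752232087) (120139224577462718714029710639363066049334460295706219402661345243802408084493311821241028863778669623645835 * pow 10 107)"
  "close_scaled (pow 4 175) (32 * square 120139224577462718714029710639363066049334460295706219402661345243802408084493311821241028863778669623645835) (27 * (171062912972729151572513258701201121254094590196466491371633072120986189161207876132533833837005983574765130 * pow 10 107))"
  "close_scaled (pow 4 175) (109608040114520211556962847838921212291441073431958404586122353963211424637170321627396405904943890752232087 * pow 10 107) (approx_beta * approx_Gamma)"
  by (simp_all only: check_eval)

section \<open>Error propagation\<close>

definition log_close :: "real \<Rightarrow> real \<Rightarrow> real \<Rightarrow> bool" where
  "log_close e x y \<longleftrightarrow> 0 < x \<and> 0 < y \<and> \<bar>ln x - ln y\<bar> \<le> e"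

lemma log_closeI:
  assumes "0 < x" "0 < y" "0 \<le> e" "x \<le> (1 + e) * y" "y \<le> (1 + e) * x"
  shows "log_close e x y"
proof -
  have *: "ln a - ln b \<le> e" if "0 < a" "0 < b" "a \<le> (1 + e) * b" for a b
  proof -
    have "ln a - ln b = ln (a / b)" using that by (simp add: ln_div)
    also have "\<dots> \<le> a / b - 1" using that by (intro ln_le_minus_one) simp
    also have "\<dots> \<le> e" using that by (simp add: field_simps)
    finally show ?thesis .
  qed
  show ?thesis using *[of x y] *[of y x] assms by (simp add: log_close_def abs_le_iff)
qed

lemma log_closeD:
  assumes "log_close e x y" "e < 1"
  shows "y * (1 - e) \<le> x" "x * (1 - e) \<le> y"
proof -
  have *: "b * (1 - e) \<le> a" if "0 < a" "0 < b" "ln b - ln a \<le> e" for a b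
  proof -
    have "1 - e \<le> exp (- e)" using exp_ge_add_one_self[of "- e"] by simp
    also have "\<dots> \<le> exp (ln (a / b))" using that by (simp add: ln_div)
    also have "\<dots> = a / b" using that by simp
    finally show ?thesis using that by (simp add: field_simps)
  qed
  show "y * (1 - e) \<le> x" "x * (1 - e) \<le> y"
    using *[of x y] *[of y x] assms by (auto simp: log_close_def abs_le_iff)
qed

lemma log_close_abs:
  fixes l n x :: real
  assumes "\<bar>x - l\<bar> \<le> n" "0 \<le> e" "n < l" "n \<le> e * (l - n)"
  shows "log_close e x l"
proof -
  have "0 \<le> n" using assms(1) by linarith
  have "e * (l - n) \<le> e * l" "e * (l - n) \<le> e * x"
    using assms \<open>0 \<le> n\<close> by (auto intro!: mult_left_mono simp: abs_le_iff)
  hence "n \<le> e * l" "n \<le> e * x" using assms(4) by linarith+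
  thus ?thesis using assms \<open>0 \<le> n\<close> by (intro log_closeI) (auto simp: abs_le_iff distrib_right)
qed

lemma le_one_plus_mult: "0 \<le> e \<Longrightarrow> 0 \<le> y \<Longrightarrow> x \<le> y \<Longrightarrow> x \<le> (1 + e) * (y :: real)"
  by (simp add: distrib_right add_increasing2)

lemma close_scaled_pos: "close_scaled k x y \<Longrightarrow> 0 < k \<Longrightarrow> 0 < y \<Longrightarrow> 0 < x"
  by (cases x) auto

lemma close_scaled_log:
  assumes "close_scaled k x y" "0 < x" "0 < y" "0 < k" "1 / real k \<le> e"
  shows "log_close e (real x) (real y)"
proof -
  have "real (k * x) \<le> real ((k + 1) * y)" "real (k * y) \<le> real ((k + 1) * x)"
    using assms(1) by (simp_all only: of_nat_le_iff close_scaled.simps)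
  hence "real k * real x \<le> (real k + 1) * real y" "real k * real y \<le> (real k + 1) * real x" by (simp_all add: algebra_simps)
  hence "log_close (1 / real k) (real x) (real y)"
    using assms by (intro log_closeI) (simp_all add: field_simps)
  thus ?thesis using assms(5) by (simp add: log_close_def)
qed

definition ulp :: real where "ulp = 1 / 10 ^ 105"

lemma L_chi12_alt_sums:
  assumes "s \<ge> 2"
  shows "(2 ^ s - 2) * L_series chi12_0 s = (2 ^ s - 1) * (alt_sum 3 1 s - alt_sum 3 2 s)"
    "(2 ^ s + 2) * L_series chi12_3 s = (2 ^ s + 1) * (alt_sum 3 1 s + alt_sum 3 2 s)"
  unfolding L_chi12_of_L_chi3[OF assms] L_chi3_0[OF assms, symmetric] L_chi3[OF assms, symmetric]
  by (simp_all add: field_simps)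

lemma euler_prod_5_mod_6_step:
  assumes s: "s \<ge> 2"
  shows "(euler_prod 6 5 s)\<^sup>2 * ((alt_sum 3 1 s + alt_sum 3 2 s) * ((2 ^ s + 1) * (2 ^ s - 2))) =
         euler_prod 6 5 (2 * s) * ((alt_sum 3 1 s - alt_sum 3 2 s) * ((2 ^ s - 1) * (2 ^ s + 2)))"
proof -
  have "(euler_prod 6 5 s)\<^sup>2 * ((alt_sum 3 1 s + alt_sum 3 2 s) * ((2 ^ s + 1) * (2 ^ s - 2))) =
    (euler_prod 6 5 s)\<^sup>2 * ((2 ^ s + 1) * (alt_sum 3 1 s + alt_sum 3 2 s)) * (2 ^ s - 2)" by (simp only: mult_ac)
  also have "\<dots> = ((euler_prod 6 5 s)\<^sup>2 * L_series chi12_3 s) * ((2 ^ s + 2) * (2 ^ s - 2))"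
    by (simp only: L_chi12_alt_sums[OF s, symmetric] mult_ac)
  also have "\<dots> = euler_prod 6 5 (2 * s) * (((2 ^ s - 2) * L_series chi12_0 s) * (2 ^ s + 2))"
    by (simp only: euler_prod_5_mod_6[OF s] mult_ac)
  also have "\<dots> = euler_prod 6 5 (2 * s) * ((alt_sum 3 1 s - alt_sum 3 2 s) * ((2 ^ s - 1) * (2 ^ s + 2)))"
    by (simp only: L_chi12_alt_sums[OF s] mult_ac)
  finally show ?thesis .
qed

lemma euler_prod_7_mod_12_step:
  assumes s: "s \<ge> 2"
  shows "(euler_prod 12 7 s) ^ 4 * ((alt_sum 6 1 s + alt_sum 6 5 s) * (alt_sum 6 1 s - alt_sum 6 5 s) * ((2 ^ s)\<^sup>2 - 4)) =
         (euler_prod 12 7 (2 * s))\<^sup>2 *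
           ((alt_sum 3 1 s - alt_sum 3 2 s) * (alt_sum 3 1 s + alt_sum 3 2 s) * ((2 ^ s)\<^sup>2 - 1))"
proof -
  have z: "(2 ^ s)\<^sup>2 - 4 = (2 ^ s - 2) * (2 ^ s + (2 :: real))" "(2 ^ s)\<^sup>2 - 1 = (2 ^ s - 1) * (2 ^ s + (1 :: real))"
    by (simp_all add: power2_eq_square algebra_simps)
  have "(euler_prod 12 7 s) ^ 4 * ((alt_sum 6 1 s + alt_sum 6 5 s) * (alt_sum 6 1 s - alt_sum 6 5 s) * ((2 ^ s)\<^sup>2 - 4)) =
    ((euler_prod 12 7 s) ^ 4 * (L_series chi12_4 s * L_series chi12_12 s)) * ((2 ^ s - 2) * (2 ^ s + 2))"
    by (simp only: L_chi12_4[OF s] L_chi12_12[OF s] z mult_ac)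
  also have "\<dots> = (euler_prod 12 7 (2 * s))\<^sup>2 * (((2 ^ s - 2) * L_series chi12_0 s) * ((2 ^ s + 2) * L_series chi12_3 s))"
    by (simp only: euler_prod_7_mod_12[OF s] mult_ac)
  also have "\<dots> = (euler_prod 12 7 (2 * s))\<^sup>2 *
           ((alt_sum 3 1 s - alt_sum 3 2 s) * (alt_sum 3 1 s + alt_sum 3 2 s) * ((2 ^ s)\<^sup>2 - 1))"
    by (simp only: L_chi12_alt_sums[OF s] z mult_ac)
  finally show ?thesis .
qed

text \<open>The bound 141 is one unit for each of the 140 floors and one for the
  acceleration.\<close>

fun tab_ok :: "real \<Rightarrow> nat \<Rightarrow> nat \<Rightarrow> nat \<Rightarrow> nat \<Rightarrow> (nat \<times> nat) list \<Rightarrow> bool" where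
  "tab_ok D q r1 r2 s [] \<longleftrightarrow> True"
| "tab_ok D q r1 r2 s ((c, d) # tab) \<longleftrightarrow>
     \<bar>D * alt_sum q r1 s - real c\<bar> \<le> 141 \<and> \<bar>D * alt_sum q r2 s - real d\<bar> \<le> 141 \<and>
     3 * 10 ^ 106 + d \<le> c \<and> tab_ok D q r1 r2 (2 * s) tab"

text \<open>A sum or difference of two entries is off by at most 282, which is less than
  \<open>10 * ulp\<close> relative to a quantity of at least 3 * 10^106.\<close>

lemma tab_ok_log_close:
  assumes "tab_ok D q r1 r2 s ((c, d) # tab)" "D > 0"
  shows "log_close (10 * ulp) (alt_sum q r1 s + alt_sum q r2 s) ((real c + real d) / D)"
    "log_close (10 * ulp) (alt_sum q r1 s - alt_sum q r2 s) ((real c - real d) / D)"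
proof -
  have cd: "3 * 10 ^ 106 + real d \<le> real c"
    using assms(1) of_nat_mono[of "3 * 10 ^ 106 + d" c, where 'a = real] by simp
  have *: "log_close (10 * ulp) x (l / D)" if "\<bar>D * x - l\<bar> \<le> 282" "3 * 10 ^ 106 \<le> l" for x l
  proof -
    have "log_close (10 * ulp) (D * x) l"
    proof (rule log_close_abs[OF that(1)])
      show "282 \<le> 10 * ulp * (l - 282)" using that(2) by (simp add: ulp_def field_simps)
    qed (use that(2) in \<open>simp_all add: ulp_def\<close>)
    thus ?thesis using assms(2) by (auto simp: log_close_def ln_mult ln_div zero_less_mult_iff)
  qed
  show "log_close (10 * ulp) (alt_sum q r1 s + alt_sum q r2 s) ((real c + real d) / D)"
    by (rule *) (use assms(1) cd in \<open>simp_all add: distrib_left abs_le_iff\<close>)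
  show "log_close (10 * ulp) (alt_sum q r1 s - alt_sum q r2 s) ((real c - real d) / D)"
    by (rule *) (use assms(1) cd in \<open>simp_all add: right_diff_distrib abs_le_iff\<close>)
qed

text \<open>The tolerance reproduces itself: 2 ln X(s) inherits 30 ulp from X(2 s), 10 from each of
  two combinations of alternating sums and 1 from each of two checks; half of 52 is below 30.
  Positivity of the entries is read off the checks, starting from the known positive side.\<close>

lemma check_X_correct:
  assumes "check_X k w z tab xs" "z = 2 ^ s" "s \<ge> 2" "tab_ok D 3 1 2 s (map fst tab)" "D > 0"
    and "k > 0" "1 / real k \<le> ulp" "w > 0"
    and "log_close (30 * ulp) (euler_prod 6 5 (s * 2 ^ length tab)) 1"
  shows "log_close (30 * ulp) (euler_prod 6 5 s) (real (hd xs) / real w)"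
  using assms
proof (induction k w z tab xs arbitrary: s rule: check_X.induct)
  case (1 k w z c d f tab x x2 xs)
  have chk: "close_scaled k (x * x) (f * x2)"
    "close_scaled k (f * ((c + d) * ((z + 1) * (z - 2)))) (w * ((c - d) * ((z - 1) * (z + 2))))"
    using "1.prems" by simp_all
  have IH: "log_close (30 * ulp) (euler_prod 6 5 (2 * s)) (real x2 / real w)"
    using "1.IH"[of "2 * s"] "1.prems" by (simp add: power_mult power_even_eq power2_eq_square mult_ac)
  have tab: "tab_ok D 3 1 2 s ((c, d) # map fst tab)" using "1.prems" by simp
  note close = tab_ok_log_close[OF tab "1.prems"(5)]
  have cd: "d < c" "d \<le> c" "0 < real c - real d" "0 < real c + real d" using tab by simp_all
  have "4 \<le> (2::real) ^ s" "4 \<le> (2::nat) ^ s"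
    using \<open>s \<ge> 2\<close> power_increasing[of 2 s "2 :: real"] power_increasing[of 2 s "2 :: nat"] by simp_all
  hence z: "4 \<le> z" "4 \<le> real z" "real z = 2 ^ s" using "1.prems" by simp_all
  let ?k1 = "(2 ^ s + 1) * (2 ^ s - 2) :: real" and ?k2 = "(2 ^ s - 1) * (2 ^ s + 2) :: real"
  have k12: "0 < ?k1" "0 < ?k2" using z by (auto intro!: mult_pos_pos)
  have "real (z - 2) = real z - 2" "real (z - 1) = real z - 1" using z(1) by (simp_all add: of_nat_diff)
  hence zdiff: "real (z - 2) = 2 ^ s - 2" "real (z - 1) = 2 ^ s - 1" by (simp_all only: z(3))
  have real: "real (f * ((c + d) * ((z + 1) * (z - 2)))) = real f * ((real c + real d) * ?k1)"
    "real (w * ((c - d) * ((z - 1) * (z + 2)))) = real w * ((real c - real d) * ?k2)"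
    using z cd by (simp_all only: of_nat_mult of_nat_add of_nat_1 of_nat_numeral zdiff of_nat_diff)
  have "0 < w * ((c - d) * ((z - 1) * (z + 2)))" using \<open>w > 0\<close> cd(1) z(1) by simp
  moreover from this have "0 < f" using close_scaled_pos[OF chk(2) \<open>k > 0\<close>] by (auto intro: Nat.gr0I)
  ultimately have "log_close ulp (real f * ((real c + real d) * ?k1)) (real w * ((real c - real d) * ?k2))"
    using close_scaled_log[OF chk(2) close_scaled_pos[OF chk(2)] _ \<open>k > 0\<close>] "1.prems" unfolding real by blast
  hence 1: "\<bar>(ln (real f) + (ln (real c + real d) + ln ?k1)) - (ln (real w) + (ln (real c - real d) + ln ?k2))\<bar> \<le> ulp"
    using \<open>0 < f\<close> \<open>w > 0\<close> cd k12 by (simp only: log_close_def ln_mult_pos mult_pos_pos of_nat_0_less_iff)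
  have "0 < x2" using IH \<open>w > 0\<close> by (auto simp: log_close_def zero_less_divide_iff)
  hence "0 < f * x2" using \<open>0 < f\<close> by simp
  hence "0 < x" using close_scaled_pos[OF chk(1) \<open>k > 0\<close>] by (auto intro: Nat.gr0I)
  hence "log_close ulp (real x * real x) (real f * real x2)"
    using close_scaled_log[OF chk(1) _ \<open>0 < f * x2\<close> \<open>k > 0\<close>] "1.prems" by simp
  hence 2: "\<bar>(ln (real x) + ln (real x)) - (ln (real f) + ln (real x2))\<bar> \<le> ulp"
    using \<open>0 < f\<close> \<open>0 < x\<close> \<open>0 < x2\<close> by (simp only: log_close_def ln_mult_pos mult_pos_pos of_nat_0_less_iff)
  have E: "0 < euler_prod 6 5 s" "0 < euler_prod 6 5 (2 * s)"
    using euler_prod_ge_1[of s 6 5] euler_prod_ge_1[of "2 * s" 6 5] \<open>s \<ge> 2\<close> by simp_all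
  have A: "0 < alt_sum 3 1 s + alt_sum 3 2 s" "0 < alt_sum 3 1 s - alt_sum 3 2 s"
    using close by (simp_all add: log_close_def)
  have "ln ((euler_prod 6 5 s)\<^sup>2 * ((alt_sum 3 1 s + alt_sum 3 2 s) * ?k1)) =
        ln (euler_prod 6 5 (2 * s) * ((alt_sum 3 1 s - alt_sum 3 2 s) * ?k2))"
    by (simp only: euler_prod_5_mod_6_step[OF \<open>s \<ge> 2\<close>])
  hence 3: "2 * ln (euler_prod 6 5 s) + (ln (alt_sum 3 1 s + alt_sum 3 2 s) + ln ?k1) =
        ln (euler_prod 6 5 (2 * s)) + (ln (alt_sum 3 1 s - alt_sum 3 2 s) + ln ?k2)"
    using k12 E A by (simp only: ln_mult_pos ln_realpow mult_pos_pos zero_less_power of_nat_numeral)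
  have 4: "\<bar>ln (euler_prod 6 5 (2 * s)) - (ln (real x2) - ln (real w))\<bar> \<le> 30 * ulp"
    using IH \<open>0 < x2\<close> \<open>w > 0\<close> by (simp add: log_close_def ln_div)
  have 5: "\<bar>ln (alt_sum 3 1 s + alt_sum 3 2 s) - (ln (real c + real d) - ln D)\<bar> \<le> 10 * ulp"
    "\<bar>ln (alt_sum 3 1 s - alt_sum 3 2 s) - (ln (real c - real d) - ln D)\<bar> \<le> 10 * ulp"
    using close cd \<open>D > 0\<close> by (simp_all add: log_close_def ln_div)
  have "\<bar>ln (euler_prod 6 5 s) - (ln (real x) - ln (real w))\<bar> \<le> 30 * ulp"
    using 1 2 3 4 5 unfolding abs_le_iff by linarith
  thus ?case using E \<open>0 < x\<close> \<open>w > 0\<close> by (simp add: log_close_def ln_div)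
next
  case (2 k w z x)
  hence "x = w" by simp
  thus ?case using 2 by simp
qed auto

text \<open>The budget for 4 ln Y(s) is 2 * 30 ulp from Y(2 s), 4 * 10 from the alternating sums and
  5 from the checks (the first one counts twice); a quarter of 105 is below 30.\<close>

lemma check_Y_correct:
  assumes "check_Y k w z tab ys" "z = 2 ^ s" "s \<ge> 2" "tab_ok D 3 1 2 s (map fst tab)"
    and "tab_ok D 6 1 5 s (map (\<lambda>row. fst (snd row)) tab)" "D > 0"
    and "k > 0" "1 / real k \<le> ulp" "w > 0"
    and "log_close (30 * ulp) (euler_prod 12 7 (s * 2 ^ length tab)) 1"
  shows "log_close (30 * ulp) (euler_prod 12 7 s) (real (hd ys) / real w)"
  using assms
proof (induction k w z tab ys arbitrary: s rule: check_Y.induct)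
  case (1 k w z c d a b g t r tab y y2 ys)
  have chk: "close_scaled k (y * y) (g * y2)" "close_scaled k (g * (a + b)) (t * (c + d))"
    "close_scaled k (t * (a - b)) (r * (c - d))"
    "close_scaled k ((square z - 4) * (r * g)) ((square z - 1) * square w)"
    using "1.prems" by simp_all
  have IH: "log_close (30 * ulp) (euler_prod 12 7 (2 * s)) (real y2 / real w)"
    using "1.IH"[of "2 * s"] "1.prems" by (simp add: power_mult power_even_eq power2_eq_square mult_ac)
  have tab: "tab_ok D 3 1 2 s ((c, d) # map fst tab)" "tab_ok D 6 1 5 s ((a, b) # map (\<lambda>row. fst (snd row)) tab)"
    using "1.prems" by simp_all
  note close = tab_ok_log_close[OF tab(1) "1.prems"(6)] tab_ok_log_close[OF tab(2) "1.prems"(6)]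
  have cd: "d < c" "d \<le> c" "b < a" "b \<le> a"
      "0 < real c - real d" "0 < real c + real d" "0 < real a - real b" "0 < real a + real b"
    using tab by simp_all
  have "4 \<le> (2::real) ^ s" "4 \<le> (2::nat) ^ s"
    using \<open>s \<ge> 2\<close> power_increasing[of 2 s "2 :: real"] power_increasing[of 2 s "2 :: nat"] by simp_all
  hence z: "4 \<le> z" "4 \<le> real z" "real z = 2 ^ s" using "1.prems" by simp_all
  have "16 \<le> z * z" using mult_le_mono[OF z(1) z(1)] by simp
  hence z2: "4 < square z" "1 < square z" "16 \<le> (2 ^ s :: real)\<^sup>2" "real (square z) = (2 ^ s)\<^sup>2"
    using of_nat_mono[of 16 "z * z", where 'a = real] z by (simp_all add: power2_eq_square)
  let ?k1 = "(2 ^ s)\<^sup>2 - 4 :: real" and ?k2 = "(2 ^ s)\<^sup>2 - 1 :: real"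
  have k12: "0 < ?k1" "0 < ?k2" using z2 by simp_all
  have "real (square z - 4) = real (square z) - 4" "real (square z - 1) = real (square z) - 1"
    using z2(1) by (simp_all add: of_nat_diff del: square.simps)
  hence zdiff: "real (square z - 4) = ?k1" "real (square z - 1) = ?k2" by (simp_all only: z2(4))
  have real: "real ((square z - 4) * (r * g)) = ?k1 * (real r * real g)"
     "real ((square z - 1) * square w) = ?k2 * (real w * real w)"
     "real (g * (a + b)) = real g * (real a + real b)" "real (t * (c + d)) = real t * (real c + real d)"
     "real (t * (a - b)) = real t * (real a - real b)" "real (r * (c - d)) = real r * (real c - real d)"
     "real (y * y) = real y * real y" "real (g * y2) = real g * real y2"
    by (simp_all only: of_nat_mult of_nat_add of_nat_diff[OF cd(2)] of_nat_diff[OF cd(4)] zdiff square.simps[of w])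
  have p4: "0 < (square z - 1) * square w" using z2 \<open>w > 0\<close> by simp
  have "0 < r" "0 < g" using close_scaled_pos[OF chk(4) \<open>k > 0\<close> p4] by (auto intro: Nat.gr0I)
  hence p3: "0 < r * (c - d)" and p2: "0 < g * (a + b)" using cd by simp_all
  have "0 < t" using close_scaled_pos[OF chk(3) \<open>k > 0\<close> p3] by (auto intro: Nat.gr0I)
  hence p2': "0 < t * (c + d)" using cd by simp
  have "0 < y2" using IH \<open>w > 0\<close> by (auto simp: log_close_def zero_less_divide_iff)
  hence p1: "0 < g * y2" using \<open>0 < g\<close> by simp
  have "0 < y" using close_scaled_pos[OF chk(1) \<open>k > 0\<close> p1] by (auto intro: Nat.gr0I)
  have log: "log_close ulp (real u) (real v)" if "close_scaled k u v" "0 < v" for u v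
    using close_scaled_log[OF that(1) close_scaled_pos[OF that(1) \<open>k > 0\<close> that(2)] that(2) \<open>k > 0\<close>] "1.prems" by blast
  note positive = \<open>0 < g\<close> \<open>0 < r\<close> \<open>0 < t\<close> \<open>0 < y\<close> \<open>0 < y2\<close> \<open>0 < w\<close> cd k12
  have 1: "\<bar>(ln (real y) + ln (real y)) - (ln (real g) + ln (real y2))\<bar> \<le> ulp"
    using log[OF chk(1) p1] positive unfolding real by (simp only: log_close_def ln_mult_pos mult_pos_pos of_nat_0_less_iff)
  have 2: "\<bar>(ln (real g) + ln (real a + real b)) - (ln (real t) + ln (real c + real d))\<bar> \<le> ulp"
    using log[OF chk(2) p2'] positive unfolding real by (simp only: log_close_def ln_mult_pos mult_pos_pos of_nat_0_less_iff)
  have 3: "\<bar>(ln (real t) + ln (real a - real b)) - (ln (real r) + ln (real c - real d))\<bar> \<le> ulp"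
    using log[OF chk(3) p3] positive unfolding real by (simp only: log_close_def ln_mult_pos mult_pos_pos of_nat_0_less_iff)
  have 4: "\<bar>(ln ?k1 + (ln (real r) + ln (real g))) - (ln ?k2 + (ln (real w) + ln (real w)))\<bar> \<le> ulp"
    using log[OF chk(4) p4] positive unfolding real by (simp only: log_close_def ln_mult_pos mult_pos_pos of_nat_0_less_iff)
  have E: "0 < euler_prod 12 7 s" "0 < euler_prod 12 7 (2 * s)"
    using euler_prod_ge_1[of s 12 7] euler_prod_ge_1[of "2 * s" 12 7] \<open>s \<ge> 2\<close> by simp_all
  have A: "0 < alt_sum 3 1 s + alt_sum 3 2 s" "0 < alt_sum 3 1 s - alt_sum 3 2 s"
     "0 < alt_sum 6 1 s + alt_sum 6 5 s" "0 < alt_sum 6 1 s - alt_sum 6 5 s"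
    using close by (simp_all add: log_close_def)
  have "ln ((euler_prod 12 7 s) ^ 4 * ((alt_sum 6 1 s + alt_sum 6 5 s) * (alt_sum 6 1 s - alt_sum 6 5 s) * ?k1)) =
        ln ((euler_prod 12 7 (2 * s))\<^sup>2 *
           ((alt_sum 3 1 s - alt_sum 3 2 s) * (alt_sum 3 1 s + alt_sum 3 2 s) * ?k2))"
    by (simp only: euler_prod_7_mod_12_step[OF \<open>s \<ge> 2\<close>])
  hence 5: "4 * ln (euler_prod 12 7 s) + (ln (alt_sum 6 1 s + alt_sum 6 5 s) + ln (alt_sum 6 1 s - alt_sum 6 5 s) + ln ?k1) =
        2 * ln (euler_prod 12 7 (2 * s)) + (ln (alt_sum 3 1 s - alt_sum 3 2 s) + ln (alt_sum 3 1 s + alt_sum 3 2 s) + ln ?k2)"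
    using k12 E A by (simp only: ln_mult_pos ln_realpow mult_pos_pos zero_less_power of_nat_numeral)
  have 6: "\<bar>ln (euler_prod 12 7 (2 * s)) - (ln (real y2) - ln (real w))\<bar> \<le> 30 * ulp"
    using IH \<open>0 < y2\<close> \<open>w > 0\<close> by (simp add: log_close_def ln_div)
  have 7: "\<bar>ln (alt_sum 3 1 s + alt_sum 3 2 s) - (ln (real c + real d) - ln D)\<bar> \<le> 10 * ulp"
    "\<bar>ln (alt_sum 3 1 s - alt_sum 3 2 s) - (ln (real c - real d) - ln D)\<bar> \<le> 10 * ulp"
    "\<bar>ln (alt_sum 6 1 s + alt_sum 6 5 s) - (ln (real a + real b) - ln D)\<bar> \<le> 10 * ulp"
    "\<bar>ln (alt_sum 6 1 s - alt_sum 6 5 s) - (ln (real a - real b) - ln D)\<bar> \<le> 10 * ulp"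
    using close cd \<open>D > 0\<close> by (simp_all add: log_close_def ln_div)
  have "\<bar>ln (euler_prod 12 7 s) - (ln (real y) - ln (real w))\<bar> \<le> 30 * ulp"
    using 1 2 3 4 5 6 7 unfolding abs_le_iff by linarith
  thus ?case using E \<open>0 < y\<close> \<open>w > 0\<close> by (simp add: log_close_def ln_div)
next
  case (2 k w z y)
  hence "y = w" by simp
  thus ?case using 2 by simp
qed auto

lemma close_scaled_ln:
  assumes "close_scaled k x y" "0 < y" "0 < k" "1 / real k \<le> e"
  shows "0 < x" "\<bar>ln (real x) - ln (real y)\<bar> \<le> e"
  using close_scaled_log[OF assms(1) close_scaled_pos[OF assms(1,3,2)] assms(2-4)] close_scaled_pos[OF assms(1,3,2)]
  by (simp_all add: log_close_def)

text \<open>Only the square root of X(2) enters, so half of 30 ulp is inherited and the two checks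
  add less than 1.\<close>

lemma alpha0_3_approx:
  assumes X: "log_close (30 * ulp) (euler_prod 6 5 2) (real x / real w)"
    and chk: "close_scaled k (square a) (a2 * w)" "close_scaled k (27 * square a2) (4 * square x)"
    and k: "0 < k" "1 / real k \<le> ulp" and w: "0 < w"
  shows "log_close (20 * ulp) alpha0_3 (real a / real w)"
proof -
  have x: "0 < x" using X w by (auto simp: log_close_def zero_less_divide_iff)
  have "0 < 4 * square x" using x by simp
  note 1 = close_scaled_ln[OF chk(2) this k]
  have a2: "0 < a2" using 1(1) by (auto intro: Nat.gr0I)
  hence "0 < a2 * w" using w by simp
  note 2 = close_scaled_ln[OF chk(1) this k]
  have a: "0 < a" using 2(1) by (auto intro: Nat.gr0I)
  let ?P = "prime_product 3 {2}"
  have E: "0 < euler_prod 6 5 2" using euler_prod_ge_1[of 2 6 5] by simp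
  have P: "0 < ?P"
    using prime_product_3 E prime_product_nonneg[of 3 "{2}"] by (cases "?P = 0") auto
  have "ln (?P\<^sup>2) = ln (4 / 3 * euler_prod 6 5 2)" by (simp only: prime_product_3)
  hence "2 * ln ?P = ln 4 - ln 3 + ln (euler_prod 6 5 2)"
    using P E by (simp add: ln_realpow ln_mult_pos ln_div)
  moreover have ln4: "ln 4 = 2 * ln (2 :: real)" using ln_realpow[of 2 2] by simp
  moreover have "ln alpha0_3 = - (1 / 2 * ln 2 + 1 / 4 * ln 3) + ln ?P"
    using P by (simp add: alpha0_3_def ln_mult_pos ln_div ln_powr)
  moreover have "ln (27 :: real) = 3 * ln 3" using ln_realpow[of 3 3] by simp
  moreover have "\<bar>(ln 27 + 2 * ln (real a2)) - (ln 4 + 2 * ln (real x))\<bar> \<le> ulp"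
    using 1(2) a2 x by (simp add: ln_mult_pos)
  moreover have "\<bar>2 * ln (real a) - (ln (real a2) + ln (real w))\<bar> \<le> ulp"
    using 2(2) a a2 w by (simp add: ln_mult_pos)
  moreover have "\<bar>ln (euler_prod 6 5 2) - (ln (real x) - ln (real w))\<bar> \<le> 30 * ulp"
    using X x w by (simp add: log_close_def ln_div)
  ultimately have "\<bar>ln alpha0_3 - (ln (real a) - ln (real w))\<bar> \<le> 20 * ulp"
    unfolding abs_le_iff by linarith
  moreover have "0 < alpha0_3" using P by (simp add: alpha0_3_def)
  ultimately show ?thesis using a w by (simp add: log_close_def ln_div)
qed

lemma pi_square_alt_sum: "2 * pi\<^sup>2 = 27 * (alt_sum 3 1 2 - alt_sum 3 2 2)"
  using L_chi12_alt_sums(1)[of 2] L_chi12_0_2 by simp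

text \<open>In logarithms everything is linear: \<open>pi\<close> is eliminated through the
  alternating sums, and the four-fold logarithm of \<open>v\<close> collects the checks. The largest
  contribution is 30 ulp, from half of ln X(2) + ln Y(2).\<close>

lemma beta0_approx:
  fixes x y p p2 c d lam q l1 l2 l3 v v2 b g w D k :: nat
  assumes X: "log_close (30 * ulp) (euler_prod 6 5 2) (real x / real w)"
    and Y: "log_close (30 * ulp) (euler_prod 12 7 2) (real y / real w)"
    and tab: "log_close (10 * ulp) (alt_sum 3 1 2 - alt_sum 3 2 2) ((real c - real d) / real D)" "d < c"
    and Gamma: "\<bar>ln (Gamma (1 / 4)) - (ln (real g) - ln (real w))\<bar> \<le> 5 * ulp"
    and lam: "\<bar>ln (ln (2 + sqrt 3)) - (ln 2 - 1 / 2 * ln 3 + ln (real lam) - ln (real w) - 5 * ln 10)\<bar> \<le> 2 * ulp" "0 < lam"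
    and q: "close_scaled k (square q) (3 * square w)"
    and p: "close_scaled k (x * y) (p * w)" "close_scaled k (square p) (p2 * w)"
    and l: "close_scaled k ((c - d) * lam) (l1 * (D * 100000))" "close_scaled k (l1 * q) (l2 * w)"
      "close_scaled k (l2 * p2) (l3 * w)"
    and v: "close_scaled k (square v) (v2 * w)" "close_scaled k (32 * square v2) (27 * (l3 * w))"
      "close_scaled k (v * w) (b * g)"
    and k: "0 < k" "1 / real k \<le> ulp" and w: "0 < w" and D: "0 < D" and g: "0 < g"
    and pos: "0 < p" "0 < p2" "0 < l1" "0 < l2" "0 < l3" "0 < v2" "0 < b"
  shows "log_close (100 * ulp) beta0 (real b / real w)"
proof -
  have x: "0 < x" using X w by (auto simp: log_close_def zero_less_divide_iff)
  have y: "0 < y" using Y w by (auto simp: log_close_def zero_less_divide_iff)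
  have q0: "0 < q" using close_scaled_ln(1)[OF q _ k] w by (auto intro: Nat.gr0I)
  have v0: "0 < v" using close_scaled_ln(1)[OF v(1) _ k] pos w by (auto intro: Nat.gr0I)
  have cd: "0 < real c - real d" "real (c - d) = real c - real d" using tab(2) by (simp_all add: of_nat_diff)
  have 1: "\<bar>2 * ln (real q) - (ln 3 + 2 * ln (real w))\<bar> \<le> ulp"
    using close_scaled_ln(2)[OF q _ k] q0 w by (simp add: ln_mult_pos)
  have 2: "\<bar>(ln (real x) + ln (real y)) - (ln (real p) + ln (real w))\<bar> \<le> ulp"
    using close_scaled_ln(2)[OF p(1) _ k] x y pos w by (simp add: ln_mult_pos)
  have 3: "\<bar>2 * ln (real p) - (ln (real p2) + ln (real w))\<bar> \<le> ulp"
    using close_scaled_ln(2)[OF p(2) _ k] pos w by (simp add: ln_mult_pos)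
  have ln5: "ln 100000 = 5 * ln (10 :: real)" using ln_realpow[of 10 5] by simp
  have 4: "\<bar>(ln (real c - real d) + ln (real lam)) - (ln (real l1) + (ln (real D) + ln 100000))\<bar> \<le> ulp"
    using close_scaled_ln(2)[OF l(1) _ k] cd lam(2) pos D by (simp add: ln_mult_pos)
  have 5: "\<bar>(ln (real l1) + ln (real q)) - (ln (real l2) + ln (real w))\<bar> \<le> ulp"
    using close_scaled_ln(2)[OF l(2) _ k] q0 pos w by (simp add: ln_mult_pos)
  have 6: "\<bar>(ln (real l2) + ln (real p2)) - (ln (real l3) + ln (real w))\<bar> \<le> ulp"
    using close_scaled_ln(2)[OF l(3) _ k] pos w by (simp add: ln_mult_pos)
  have 7: "\<bar>2 * ln (real v) - (ln (real v2) + ln (real w))\<bar> \<le> ulp"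
    using close_scaled_ln(2)[OF v(1) _ k] v0 pos w by (simp add: ln_mult_pos)
  have 8: "\<bar>(ln 32 + 2 * ln (real v2)) - (ln 27 + (ln (real l3) + ln (real w)))\<bar> \<le> ulp"
    using close_scaled_ln(2)[OF v(2) _ k] pos w by (simp add: ln_mult_pos)
  have 9: "\<bar>(ln (real v) + ln (real w)) - (ln (real b) + ln (real g))\<bar> \<le> ulp"
    using close_scaled_ln(2)[OF v(3) _ k] v0 pos w g by (simp add: ln_mult_pos)
  have 10: "\<bar>ln (euler_prod 6 5 2) - (ln (real x) - ln (real w))\<bar> \<le> 30 * ulp"
    "\<bar>ln (euler_prod 12 7 2) - (ln (real y) - ln (real w))\<bar> \<le> 30 * ulp"
    using X Y x y w by (simp_all add: log_close_def ln_div)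
  have 11: "\<bar>ln (alt_sum 3 1 2 - alt_sum 3 2 2) - (ln (real c - real d) - ln (real D))\<bar> \<le> 10 * ulp"
    using tab(1) cd D by (simp add: log_close_def ln_div)
  have "ln (2 * pi\<^sup>2) = ln (27 * (alt_sum 3 1 2 - alt_sum 3 2 2))" by (simp only: pi_square_alt_sum)
  hence 12: "ln 2 + 2 * ln pi = ln 27 + ln (alt_sum 3 1 2 - alt_sum 3 2 2)"
    using tab(1) by (simp add: ln_mult_pos ln_realpow log_close_def del: right_diff_distrib_numeral)
  have ln32: "ln 32 = 5 * ln (2 :: real)" using ln_realpow[of 2 5] by simp
  let ?P = "prime_product 12 {5, 7, 11}"
  have E: "0 < euler_prod 6 5 2" "0 < euler_prod 12 7 2"
    using euler_prod_ge_1[of 2 6 5] euler_prod_ge_1[of 2 12 7] by simp_all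
  have P: "0 < ?P"
    using prime_product_12 E prime_product_nonneg[of 12 "{5, 7, 11}"] by (cases "?P = 0") auto
  have "ln (?P\<^sup>2) = ln (euler_prod 6 5 2 * euler_prod 12 7 2)" by (simp only: prime_product_12)
  hence 13: "2 * ln ?P = ln (euler_prod 6 5 2) + ln (euler_prod 12 7 2)"
    using P E by (simp add: ln_realpow ln_mult_pos)
  have G: "0 < Gamma (1 / 4 :: real)" by (intro Gamma_real_pos) simp
  have l0: "0 < ln (2 + sqrt 3)" by (intro ln_gt_zero) (simp add: add_pos_nonneg)
  have 14: "ln beta0 = 1 / 4 * ln 3 + 1 / 2 * ln pi - 5 / 4 * ln 2 + (1 / 4 * ln (ln (2 + sqrt 3)) - ln (Gamma (1 / 4))) + ln ?P"
    using P l0 less_imp_neq[OF G] by (simp add: beta0_def ln_mult_pos ln_div ln_powr ln_sqrt)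
  have "\<bar>ln beta0 - (ln (real b) - ln (real w))\<bar> \<le> 100 * ulp"
    using 1 2 3 4 5 6 7 8 9 10 11 12 13 14 ln32 ln5 lam(1) Gamma unfolding abs_le_iff by linarith
  moreover have "0 < beta0" using P G l0 by (simp add: beta0_def)
  ultimately show ?thesis using pos w by (simp add: log_close_def ln_div)
qed

primrec squares_target :: "real \<Rightarrow> nat list \<Rightarrow> real" where
  "squares_target x [] = x"
| "squares_target x (j # js) = squares_target (2 * x - ln (real j)) js"

text \<open>Every squaring doubles the error accumulated in the logarithm, hence the sharper
  tolerance 4^184 for the chain of exponentials.\<close>

lemma check_squares_correct:
  assumes "check_squares k m es js" "0 < k" "1 / real k \<le> e" "0 < m" "\<forall>j\<in>set js. 0 < j"
    and "\<bar>x - ln (real (hd es))\<bar> \<le> \<delta>"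
  shows "\<bar>squares_target x js - ln (real m)\<bar> \<le> 2 ^ length js * (\<delta> + e) \<and> 0 < hd es"
  using assms
proof (induction k m es js arbitrary: x \<delta> rule: check_squares.induct)
  case (1 k m e1 e2 es j js)
  have e2: "0 < e2"
    \<comment> \<open>The induction hypothesis is used here with zero error, merely to draw
      positivity backwards from the end of the list.\<close>
    using "1.IH"[of "ln (real e2)" 0] "1.prems" by simp
  have "close_scaled k (square e1) (e2 * j)" "0 < e2 * j" using "1.prems" e2 by simp_all
  note c = close_scaled_ln[OF this \<open>0 < k\<close> "1.prems"(3)]
  have e1: "0 < e1" using c(1) by (auto intro: Nat.gr0I)
  have "\<bar>2 * ln (real e1) - (ln (real e2) + ln (real j))\<bar> \<le> e"
    using c(2) e1 e2 "1.prems" by (simp add: ln_mult_pos)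
  moreover have "\<bar>x - ln (real e1)\<bar> \<le> \<delta>" using "1.prems" by simp
  ultimately have "\<bar>(2 * x - ln (real j)) - ln (real (hd (e2 # es)))\<bar> \<le> 2 * \<delta> + e"
    unfolding list.sel abs_le_iff by linarith
  from "1.IH"[OF _ _ _ _ _ this] have "\<bar>squares_target (2 * x - ln (real j)) js - ln (real m)\<bar> \<le> 2 ^ length js * (2 * \<delta> + e + e)"
    using "1.prems" by simp
  also have "\<dots> = 2 ^ length (j # js) * (\<delta> + e)" by (simp add: algebra_simps)
  finally show ?case using e1 by simp
next
  case (2 k m e1)
  have "0 \<le> e" using order_trans[OF _ "2.prems"(3), of 0] by simp
  moreover have "e1 = m" using "2.prems"(1) by simp
  ultimately show ?case using "2.prems"(4,6) by simp
qed auto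

lemma pow_4_175: "0 < pow 4 175" "1 / real (pow 4 175) \<le> ulp"
  by (simp_all add: pow_def ulp_def)

lemma inverse_pow_4_184: "1 / real (pow 4 184) \<le> 1 / 10 ^ 110"
  by (simp add: pow_def)

lemma ln_pow: "ln (real (pow 10 k)) = of_int k * ln 10" if "0 \<le> k"
  using that by (simp add: pow_def ln_realpow)

lemma cheb_total: "cheb_total = (\<Sum>i\<le>140. cheb_coeff 140 i)" "cheb_coeffs 140 (\<lambda>j. real (cheb_coeff 140 j))"
proof -
  have *: "(coeff_check 140 ^^ 140) (0, 1, 1, True) = (140, 2 * pow 4 139, cheb_total, True)"
    using coeff_check_140 by (simp only: iterate_def) simp
  show "cheb_total = (\<Sum>i\<le>140. cheb_coeff 140 i)"
    using * unfolding coeff_check_funpow by simp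
  have "\<forall>j<140. 2 * (140 * 140 - j * j) * cheb_coeff 140 j \<le> cheb_coeff 140 (Suc j) * ((2 * j + 1) * (j + 1))"
    using * unfolding coeff_check_funpow by (simp only: prod.inject)
  thus "cheb_coeffs 140 (\<lambda>j. real (cheb_coeff 140 j))" by (intro cheb_coeffs_cheb_coeff) blast
qed

lemma alt_sum_tab:
  assumes "q > 0" "r > 0"
    and "alt_result (iterate 140 (alt_step 140 q) (0, 1, cheb_total, r, [0, 0, 0, 0, 0, 0, 0], [0, 0, 0, 0, 0, 0, 0])) = tab"
  shows "list_all2 (\<lambda>s l. l > 0 \<longrightarrow> \<bar>real cheb_total * alt_sum q r s - real l\<bar> \<le> 141) expos tab"
proof -
  have "map (\<lambda>_. 0) expos = [0, 0, 0, 0, 0, 0, 0 :: nat]" by (simp add: expos_def)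
  moreover have "iterate 140 (alt_step 140 q) = (alt_step 140 q ^^ 140)" by (simp add: iterate_def)
  moreover have "(\<lambda>j. (- 1) ^ j / real (q * j + r) ^ s) sums alt_sum q r s" if "s \<in> set expos" for s
    using that assms by (intro alt_sum_sums) (auto simp: expos_def)
  from alt_sum_approx[OF _ _ assms(1,2) cheb_total(2,1) this]
  have "list_all2 (\<lambda>s l. l > 0 \<longrightarrow> \<bar>real cheb_total * alt_sum q r s - real l\<bar> \<le> real 140 + 1) expos
      (alt_result ((alt_step 140 q ^^ 140) (0, 1, cheb_total, r, map (\<lambda>_. 0) expos, map (\<lambda>_. 0) expos)))"
    by simp
  ultimately show ?thesis using assms(3) by simp
qed

fun doubling :: "nat \<Rightarrow> nat list \<Rightarrow> bool" where
  "doubling s [] \<longleftrightarrow> True"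
| "doubling s (x # xs) \<longleftrightarrow> x = s \<and> doubling (2 * s) xs"

lemma tab_okI:
  assumes "list_all2 (\<lambda>s l. l > 0 \<longrightarrow> \<bar>D * alt_sum q r1 s - real l\<bar> \<le> 141) ss cs"
    and "list_all2 (\<lambda>s l. l > 0 \<longrightarrow> \<bar>D * alt_sum q r2 s - real l\<bar> \<le> 141) ss ds"
    and "doubling s ss" "check_gap (3 * 10 ^ 106) cs ds"
  shows "tab_ok D q r1 r2 s (zip cs ds)"
  using assms
proof (induction ss arbitrary: s cs ds)
  case (Cons x ss)
  thus ?case by (auto simp: list_all2_Cons1)
qed simp

lemma tab_ok_tabs:
  "tab_ok (real cheb_total) 3 1 2 2 (zip tab_3_1 tab_3_2)"
  "tab_ok (real cheb_total) 6 1 5 2 (zip tab_6_1 tab_6_5)"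
proof -
  have dbl: "doubling 2 expos" by (simp add: expos_def)
  have "pow 10 106 = 10 ^ 106" by (simp add: pow_def)
  note gap = check_gap_tabs[unfolded this]
  show "tab_ok (real cheb_total) 3 1 2 2 (zip tab_3_1 tab_3_2)"
    by (rule tab_okI[OF alt_sum_tab[OF _ _ alt_result_3_1] alt_sum_tab[OF _ _ alt_result_3_2] dbl gap(1)]) simp_all
  show "tab_ok (real cheb_total) 6 1 5 2 (zip tab_6_1 tab_6_5)"
    by (rule tab_okI[OF alt_sum_tab[OF _ _ alt_result_6_1] alt_sum_tab[OF _ _ alt_result_6_5] dbl gap(2)]) simp_all
qed

lemma cheb_total_pos: "0 < cheb_total"
  by (simp add: cheb_total_def)

text \<open>The least admissible prime is 5 and two powers are spent on convergence, so 5^152 >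
  10^106 decides.\<close>

lemma euler_prod_close_1:
  assumes "\<And>p. prime p \<Longrightarrow> p mod m = r \<Longrightarrow> p \<ge> 5" "s \<ge> 154"
  shows "log_close (30 * ulp) (euler_prod m r s) 1"
proof -
  have E: "1 \<le> euler_prod m r s" using assms(2) by (intro euler_prod_ge_1) simp
  have "euler_prod m r s \<le> exp (4 / real 5 ^ (s - 2))"
    using assms by (intro euler_prod_le) auto
  hence "ln (euler_prod m r s) \<le> ln (exp (4 / real 5 ^ (s - 2)))"
    using E by (subst ln_le_cancel_iff) auto
  also have "\<dots> = 4 / 5 ^ (s - 2)" by (simp only: ln_exp of_nat_numeral)
  also have "\<dots> \<le> 4 / 5 ^ 152" using assms(2) by (intro divide_left_mono power_increasing) auto
  also have "\<dots> \<le> 30 * ulp" by (simp add: ulp_def)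
  finally show ?thesis using E by (simp add: log_close_def)
qed

lemma euler_prod_6_5_2: "log_close (30 * ulp) (euler_prod 6 5 2) (real (hd tab_X) / real (pow 10 107))"
proof (rule check_X_correct[OF check_tab_X])
  have "map fst (zip (zip tab_3_1 tab_3_2) tab_F) = zip tab_3_1 tab_3_2"
    by (simp add: tab_3_1_def tab_3_2_def tab_F_def)
  thus "tab_ok (real cheb_total) 3 1 2 2 (map fst (zip (zip tab_3_1 tab_3_2) tab_F))"
    using tab_ok_tabs by simp
  have "p \<ge> 5" if "prime p" "p mod 6 = 5" for p :: nat
    using that mod_less_eq_dividend[of p 6] by simp
  moreover have "length (zip (zip tab_3_1 tab_3_2) tab_F) = 7"
    by (simp add: tab_3_1_def tab_3_2_def tab_F_def)
  ultimately show "log_close (30 * ulp) (euler_prod 6 5 (2 * 2 ^ length (zip (zip tab_3_1 tab_3_2) tab_F))) 1"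
    using euler_prod_close_1[of 6 5 256] by simp
qed (use pow_4_175 cheb_total_pos in \<open>simp_all add: pow_def\<close>)

lemma euler_prod_12_7_2: "log_close (30 * ulp) (euler_prod 12 7 2) (real (hd tab_Y) / real (pow 10 107))"
proof (rule check_Y_correct[OF check_tab_Y])
  let ?tab = "zip (zip tab_3_1 tab_3_2) (zip (zip tab_6_1 tab_6_5) (zip tab_G (zip tab_T tab_R)))"
  have "map fst ?tab = zip tab_3_1 tab_3_2" "map (\<lambda>row. fst (snd row)) ?tab = zip tab_6_1 tab_6_5"
    by (simp_all add: tab_3_1_def tab_3_2_def tab_6_1_def tab_6_5_def tab_G_def tab_T_def tab_R_def)
  thus "tab_ok (real cheb_total) 3 1 2 2 (map fst ?tab)" "tab_ok (real cheb_total) 6 1 5 2 (map (\<lambda>row. fst (snd row)) ?tab)"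
    using tab_ok_tabs by simp_all
  have "p \<ge> 5" if "prime p" "p mod 12 = 7" for p :: nat
    using that mod_less_eq_dividend[of p 12] by simp
  moreover have "length ?tab = 7"
    by (simp add: tab_3_1_def tab_3_2_def tab_6_1_def tab_6_5_def tab_G_def tab_T_def tab_R_def)
  ultimately show "log_close (30 * ulp) (euler_prod 12 7 (2 * 2 ^ length ?tab)) 1"
    using euler_prod_close_1[of 12 7 256] by simp
qed (use pow_4_175 cheb_total_pos in \<open>simp_all add: pow_def\<close>)

lemma horner_log:
  fixes a b c d n h :: nat
  assumes "iterate (int n) (horner_step (pow 10 112) a b c d) (n, 0) = (0, h)" "d > 0" "0 < n" "n \<le> 1000"
  defines "S \<equiv> \<Sum>k<n. \<Prod>i<k. (a * real i + b) / (c * real i + d)"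
  shows "0 < h" "1 \<le> S" "\<bar>ln (real h) - 112 * ln 10 - ln S\<bar> \<le> real n / 10 ^ 112" "real h \<le> 10 ^ 112 * S"
proof -
  have w: "real (pow 10 112) = 10 ^ 112" by (simp add: pow_def)
  have "0 < pow 10 112" by (simp add: pow_def)
  from horner_bounds[OF assms(1)[unfolded iterate_def nat_int] this assms(2)]
  have b: "real h \<le> 10 ^ 112 * S" "10 ^ 112 * S \<le> real h * (1 + real n / 10 ^ 112)"
    by (simp_all only: S_def w)
  show "real h \<le> 10 ^ 112 * S" by (rule b)
  have "(\<Sum>k\<in>{0}. \<Prod>i<k. (a * real i + b) / (c * real i + d)) \<le> S"
    unfolding S_def using assms(3) by (intro sum_mono2) (auto intro!: prod_nonneg)
  thus S: "1 \<le> S" by simp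
  have "0 < 10 ^ 112 * S" using S by simp
  also note b(2)
  finally have "0 < real h" by (simp add: zero_less_mult_iff add_pos_nonneg)
  thus h: "0 < h" by simp
  have "log_close (real n / 10 ^ 112) (real h) (10 ^ 112 * S)"
  proof (rule log_closeI)
    show "real h \<le> (1 + real n / 10 ^ 112) * (10 ^ 112 * S)"
      using b(1) S by (intro le_one_plus_mult) auto
  qed (use b h S in \<open>simp_all add: mult.commute\<close>)
  moreover have "ln (10 ^ 112 * S) = 112 * ln 10 + ln S"
    using S ln_realpow[of 10 112] by (subst ln_mult_pos) simp_all
  ultimately show "\<bar>ln (real h) - 112 * ln 10 - ln S\<bar> \<le> real n / 10 ^ 112"
    by (simp only: log_close_def diff_diff_eq)
qed

lemma exp_1_approx: "\<bar>1 + 112 * ln 10 - ln (real (hd tab_exp))\<bar> \<le> 1 / 10 ^ 110"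
proof -
  define S where "S = (\<Sum>k<80. \<Prod>i<k. 1 / (real i + 1))"
  have h: "1 \<le> S" "\<bar>ln (real (hd tab_exp)) - 112 * ln 10 - ln S\<bar> \<le> 80 / 10 ^ 112"
    using horner_log(2,3)[of 80 0 1 1 1 "hd tab_exp"] horner_exp by (simp_all add: S_def)
  have e: "S \<le> exp 1" "exp 1 \<le> S + 3 / fact 80" using exp_1_bounds[of 80] by (simp_all add: S_def)
  have "3 / fact 80 \<le> (3 :: real) / 10 ^ 116" using fact_80_ge by (intro divide_left_mono) auto
  also have "\<dots> \<le> 1 / 10 ^ 112" by simp
  finally have "3 / fact 80 \<le> 1 / (10 :: real) ^ 112" .
  hence "exp 1 \<le> S + 1 / 10 ^ 112 * 1" using e(2) unfolding mult_1_right by linarith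
  also have "\<dots> \<le> S + 1 / 10 ^ 112 * S" using h(1) by (intro add_left_mono mult_left_mono) auto
  finally have "exp 1 \<le> (1 + 1 / 10 ^ 112) * S" by (simp add: distrib_right)
  moreover have "S \<le> (1 + 1 / 10 ^ 112) * exp 1"
    using e(1) by (intro le_one_plus_mult) auto
  ultimately have "log_close (1 / 10 ^ 112) (exp 1) S" using h(1) by (intro log_closeI) auto
  hence "\<bar>1 - ln S\<bar> \<le> 1 / 10 ^ 112" by (simp add: log_close_def)
  moreover have "1 / 10 ^ 112 + 80 / 10 ^ 112 \<le> (1 :: real) / 10 ^ 110" by simp
  ultimately show ?thesis using h(2) unfolding abs_le_iff by linarith
qed

lemma exp_256_approx: "\<bar>256 + ln 10 - ln (real approx_exp_256)\<bar> \<le> ulp"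
proof -
  let ?js = "[pow 10 112, pow 10 113, pow 10 113, pow 10 112, pow 10 113, pow 10 113, pow 10 113, pow 10 113]"
  have "0 < approx_exp_256" "0 < pow 4 184" "\<forall>j\<in>set ?js. 0 < j"
    by (simp_all add: approx_exp_256_def pow_def)
  from check_squares_correct[OF check_exp this(2) inverse_pow_4_184 this(1,3) exp_1_approx]
  have "\<bar>squares_target (1 + 112 * ln 10) ?js - ln (real approx_exp_256)\<bar>
      \<le> 2 ^ length ?js * (1 / 10 ^ 110 + 1 / 10 ^ 110)" ..
  \<comment> \<open>The scale 112 is doubled eight times while the listed exponents are taken off,
    which leaves exactly one power of ten.\<close>
  moreover have "squares_target (1 + 112 * ln 10) ?js = 256 + ln 10"
    by (simp add: ln_pow)
  moreover have "length ?js = 8" by simp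
  ultimately have "\<bar>256 + ln 10 - ln (real approx_exp_256)\<bar> \<le> 2 ^ 8 * (1 / 10 ^ 110 + 1 / 10 ^ 110)" by (simp only:)
  also have "\<dots> \<le> ulp" by (simp add: ulp_def)
  finally show ?thesis .
qed

lemma Gamma_quarter_approx:
  "\<bar>ln (Gamma (1 / 4)) - (ln (real approx_Gamma) - ln (real (pow 10 107)))\<bar> \<le> 5 * ulp" (is ?A)
  "0 < approx_Gamma" (is ?B)
proof -
  define S where "S = (\<Sum>k<768. \<Prod>i<k. 1024 / (4 * real i + 5))"
  have h: "0 < series_Gamma" "1 \<le> S" "\<bar>ln (real series_Gamma) - 112 * ln 10 - ln S\<bar> \<le> 768 / 10 ^ 112"
    "real series_Gamma \<le> 10 ^ 112 * S"
    using horner_log[of 768 0 1024 4 5 series_Gamma] horner_Gamma by (simp_all add: S_def)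
  have b: "4 * exp (- 256) * (4 * S) \<le> Gamma (1 / 4)" "Gamma (1 / 4) \<le> 4 * exp (- 256) * (4 * S + 2)"
    using Gamma_quarter_bounds[OF _ pow_256_768_le_pochhammer] by (simp_all add: S_def)
  \<comment> \<open>The size of the computed series shows \<open>S\<close> to be so large that the
    additive slack 2 in the bounds is relatively below \<open>ulp\<close>.\<close>
  have "10 ^ 112 * 10 ^ 106 \<le> real series_Gamma" by (simp add: series_Gamma_def)
  hence "10 ^ 112 * 10 ^ 106 \<le> 10 ^ 112 * S" using h(4) by linarith
  hence S: "10 ^ 106 \<le> S" by (simp only: mult_le_cancel_left_pos zero_less_power zero_less_numeral)
  have "2 \<le> ulp * (4 * 10 ^ 106)" by (simp add: ulp_def)
  also have "\<dots> \<le> ulp * (4 * S)" using S by (intro mult_left_mono) (auto simp: ulp_def)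
  finally have "4 * exp (- 256) * (4 * S + 2) \<le> 4 * exp (- 256) * (4 * S + ulp * (4 * S))" by (intro mult_left_mono) auto
  also have "\<dots> = (1 + ulp) * (4 * exp (- 256) * (4 * S))" by (simp add: algebra_simps)
  finally have "Gamma (1 / 4) \<le> (1 + ulp) * (4 * exp (- 256) * (4 * S))" using b(2) by linarith
  moreover have G: "0 < Gamma (1 / 4 :: real)" by (intro Gamma_real_pos) simp
  moreover from this b(1) have "4 * exp (- 256) * (4 * S) \<le> (1 + ulp) * Gamma (1 / 4)"
    by (intro le_one_plus_mult) (auto simp: ulp_def)
  ultimately have "log_close ulp (Gamma (1 / 4)) (4 * exp (- 256) * (4 * S))"
    using h(2) by (intro log_closeI) (auto simp: ulp_def)
  moreover have ln16: "ln 16 = 2 * ln (4 :: real)" using ln_realpow[of 4 2] by simp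
  ultimately have 1: "\<bar>ln (Gamma (1 / 4)) - (ln 16 - 256 + ln S)\<bar> \<le> ulp"
    using h(2) by (simp add: log_close_def ln_mult_pos)
  have "0 < 16 * series_Gamma" using h(1) by simp
  note 2 = close_scaled_ln[OF check_beta(2) this pow_4_175]
  show ?B using 2(1) by (auto intro: Nat.gr0I)
  \<comment> \<open>The factor 10000 balances the scales: 10^107 for \<open>approx_Gamma\<close> and
    10 for \<open>approx_exp_256\<close> against 10^112 for \<open>series_Gamma\<close>.\<close>
  have ln10: "ln 10000 = 4 * ln (10 :: real)" using ln_realpow[of 10 4] by simp
  have E: "0 < approx_exp_256" by (simp add: approx_exp_256_def)
  have "\<bar>(ln 10000 + (ln (real approx_Gamma) + ln (real approx_exp_256))) - (ln 16 + ln (real series_Gamma))\<bar> \<le> ulp"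
    using 2(2) h(1) \<open>?B\<close> E by (simp add: ln_mult_pos)
  moreover have "768 / 10 ^ 112 \<le> ulp" by (simp add: ulp_def)
  moreover have "ln (real (pow 10 107)) = 107 * ln 10" by (simp add: ln_pow)
  ultimately show ?A
    using 1 h(3) exp_256_approx ln10 unfolding abs_le_iff by linarith
qed

lemma ln_2_plus_sqrt_3_approx:
  "\<bar>ln (ln (2 + sqrt 3)) - (ln 2 - 1 / 2 * ln 3 + ln (real series_ln) - ln (real (pow 10 107)) - 5 * ln 10)\<bar> \<le> 2 * ulp"
  "0 < series_ln"
proof -
  define S where "S = (\<Sum>k<232. \<Prod>i<k. (2 * real i + 1) / (6 * real i + 9))"
  have h: "0 < series_ln" "1 \<le> S" "\<bar>ln (real series_ln) - 112 * ln 10 - ln S\<bar> \<le> 232 / 10 ^ 112"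
    using horner_log[of 232 2 1 6 9 series_ln] horner_ln by (simp_all add: S_def)
  show "0 < series_ln" by (rule h)
  have b: "2 / sqrt 3 * S \<le> ln (2 + sqrt 3)" "ln (2 + sqrt 3) \<le> 2 / sqrt 3 * (S + 2 / 3 ^ 232)"
    using ln_2_plus_sqrt_3_bounds[of 232] by (simp_all add: S_def)
  have "2 / 3 ^ 232 \<le> ulp * 1" by (simp add: ulp_def)
  also have "\<dots> \<le> ulp * S" using h(2) by (intro mult_left_mono) (auto simp: ulp_def)
  finally have "2 / sqrt 3 * (S + 2 / 3 ^ 232) \<le> 2 / sqrt 3 * (S + ulp * S)" by (intro mult_left_mono) auto
  hence "ln (2 + sqrt 3) \<le> (1 + ulp) * (2 / sqrt 3 * S)" using b(2) by (simp add: algebra_simps)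
  moreover have "0 < ln (2 + sqrt 3)" by (intro ln_gt_zero) (simp add: add_pos_nonneg)
  moreover from this b(1) have "2 / sqrt 3 * S \<le> (1 + ulp) * ln (2 + sqrt 3)"
    by (intro le_one_plus_mult) (auto simp: ulp_def)
  ultimately have "log_close ulp (ln (2 + sqrt 3)) (2 / sqrt 3 * S)"
    using h(2) by (intro log_closeI) (auto simp: ulp_def)
  moreover have "ln (2 / sqrt 3 * S) = ln 2 - 1 / 2 * ln 3 + ln S"
    using h(2) by (simp add: ln_mult_pos ln_div ln_sqrt)
  ultimately have "\<bar>ln (ln (2 + sqrt 3)) - (ln 2 - 1 / 2 * ln 3 + ln S)\<bar> \<le> ulp"
    by (simp only: log_close_def)
  moreover have "232 / 10 ^ 112 \<le> ulp" by (simp add: ulp_def)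
  moreover have "ln (real (pow 10 107)) = 107 * ln 10" by (simp add: ln_pow)
  ultimately show "\<bar>ln (ln (2 + sqrt 3)) - (ln 2 - 1 / 2 * ln 3 + ln (real series_ln) - ln (real (pow 10 107)) - 5 * ln 10)\<bar> \<le> 2 * ulp"
    using h(3) unfolding abs_le_iff by linarith
qed

text \<open>\<open>m\<close> consists of the seven guard digits after the 100 displayed ones.
  Staying 20000 units, that is 2 * 10^(-103), away from both ends of their range, they absorb the
  error, so no carry can reach the displayed digits.\<close>

lemma decimals_begin_approx:
  assumes close: "log_close e x (real a / real (pow 10 107))" and e: "0 \<le> e" "e \<le> 1 / 10 ^ 103"
    and a: "a = 10000000 * N + m" "20000 \<le> m" "m + 20000 \<le> 10000000" "a \<le> pow 10 107"
  shows "decimals_begin x 100 (real N / 10 ^ 100)"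
proof -
  define y where "y = real a / real (pow 10 107)"
  have pow: "real (pow 10 107) = 10 ^ 107" by (simp add: pow_def)
  have y: "0 \<le> y" "y \<le> 1" using a(4) by (simp_all add: y_def pow_def divide_le_eq_1)
  have "y = (10000000 * real N + real m) / (10000000 * 10 ^ 100)" by (simp add: y_def pow a(1))
  also have "\<dots> = real N / 10 ^ 100 + real m / 10 ^ 107" by (simp add: add_divide_distrib)
  finally have yN: "y = real N / 10 ^ 100 + real m / 10 ^ 107" .
  have "20000 / 10 ^ 107 \<le> real m / 10 ^ 107" "real m / 10 ^ 107 \<le> 9980000 / (10 ^ 107 :: real)"
    using a(2,3) by (intro divide_right_mono; simp)+
  hence m: "2 / 10 ^ 103 \<le> real m / 10 ^ 107" "real m / 10 ^ 107 + 2 / 10 ^ 103 \<le> 1 / (10 ^ 100 :: real)"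
    by simp_all
  have e1: "e < 1" using e(2) by (rule order_le_less_trans) simp
  note c = log_closeD[OF close[folded y_def] e1]
  have "y * e \<le> 1 * e" using y e by (intro mult_right_mono)
  hence "y - 1 / 10 ^ 103 \<le> x" using c(1) e(2) by (simp add: right_diff_distrib)
  moreover have "x < y + 2 / 10 ^ 103"
  proof (rule ccontr)
    assume "\<not> x < y + 2 / 10 ^ 103"
    hence "(y + 2 / 10 ^ 103) * (1 - e) \<le> x * (1 - e)" using e1 by (intro mult_right_mono) auto
    hence "(y + 2 / 10 ^ 103) * (1 - e) \<le> y" using c(2) by linarith
    hence "2 / 10 ^ 103 \<le> y * e + 2 / 10 ^ 103 * e" by (simp add: algebra_simps)
    moreover have "2 / 10 ^ 103 * e \<le> 2 / 10 ^ 103 * (1 / 10 ^ 103)" using e by (intro mult_left_mono) auto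
    ultimately have "2 / 10 ^ 103 \<le> 1 / 10 ^ 103 + 2 / 10 ^ 103 * (1 / 10 ^ 103 :: real)"
      using \<open>y * e \<le> 1 * e\<close> e(2) by linarith
    thus False by simp
  qed
  ultimately show ?thesis using m yN unfolding decimals_begin_def by linarith
qed

theorem theorem1p1:
  shows "decimals_begin alpha0_3 100
           0.6389094054453438822549426749282450937549755080291233454216923657080763100276496582468971791125286643
       \<and> decimals_begin beta0 100
           0.3023161423570656379477699004801997156024127951893696454588678412888654487524105108994874678139792727"
proof
  have w: "0 < pow 10 107" by (simp add: pow_def)
  have a: "log_close (20 * ulp) alpha0_3 (real approx_alpha / real (pow 10 107))"
    by (rule alpha0_3_approx[OF euler_prod_6_5_2 check_alpha pow_4_175 w])
  have "decimals_begin alpha0_3 100 (real 6389094054453438822549426749282450937549755080291233454216923657080763100276496582468971791125286643 / 10 ^ 100)"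
    by (rule decimals_begin_approx[OF a, where m = 8814165]) (simp_all add: ulp_def approx_alpha_def pow_def)
  thus "decimals_begin alpha0_3 100
           0.6389094054453438822549426749282450937549755080291233454216923657080763100276496582468971791125286643"
    by (simp only: of_nat_numeral)
  have tab: "tab_ok (real cheb_total) 3 1 2 2 ((hd tab_3_1, hd tab_3_2) # zip (tl tab_3_1) (tl tab_3_2))"
    using tab_ok_tabs(1) by (simp add: tab_3_1_def tab_3_2_def)
  have b: "log_close (100 * ulp) beta0 (real approx_beta / real (pow 10 107))"
    by (rule beta0_approx[OF euler_prod_6_5_2 euler_prod_12_7_2 tab_ok_log_close(2)[OF tab] _ Gamma_quarter_approx(1)
         ln_2_plus_sqrt_3_approx check_beta(1) check_beta(3-)])
       (use pow_4_175 w cheb_total_pos Gamma_quarter_approx(2) in \<open>simp_all add: tab_3_1_def tab_3_2_def approx_beta_def\<close>)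
  have "decimals_begin beta0 100 (real 3023161423570656379477699004801997156024127951893696454588678412888654487524105108994874678139792727 / 10 ^ 100)"
    by (rule decimals_begin_approx[OF b, where m = 856774]) (simp_all add: ulp_def approx_beta_def pow_def)
  thus "decimals_begin beta0 100
           0.3023161423570656379477699004801997156024127951893696454588678412888654487524105108994874678139792727"
    by (simp only: of_nat_numeral)
qed

end
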